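(* There is an algorithm which, given the run-length encodings of two strings $X$ and $Y$ whose run-length encodings have compressed lengths $n$ and $m$ respectively, computes the edit distance between $X$ and $Y$ in $\mathcal{O}(mn\log(mn))$ time.
   Context: The edit distance between two strings $X$ and $Y$ is the minimum number of single-character insertions, deletions and substitutions (each of unit cost) needed to transform $X$ into $Y$. The run-length encoding (RLE) of a string compresses maximal blocks of consecutive identical symbols: a run in which the symbol $\sigma$ is repeated $i$ times is denoted $\sigma^i$, and the string is given as the sequence of its runs, e.g. $\mathtt{aaabbbbaaa}$ is given as $\mathtt{a}^3\mathtt{b}^4\mathtt{a}^3$. The compressed length of a string is the number of runs in its RLE; it is at least $1$. The running time must not depend on the uncompressed lengths of the strings. Time is measured on a unit-cost RAM in which a symbol, or an integer of magnitude polynomial in the sum of the uncompressed lengths, fits in one word, and arithmetic operations and comparisons on words take constant time. In the $\mathcal{O}$-bound, $\log$ is read as $\max(1,\log_2)$. *)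

theory Defs
  imports Complex_Main
begin

section \<open>Edit distance\<close>

inductive edit_op :: "'a list \<Rightarrow> 'a list \<Rightarrow> bool" where
  insertion: "edit_op (u @ v) (u @ [a] @ v)"
| deletion: "edit_op (u @ [a] @ v) (u @ v)"
| substitution: "edit_op (u @ [a] @ v) (u @ [b] @ v)"

definition edit_distance :: "'a list \<Rightarrow> 'a list \<Rightarrow> nat" where
  "edit_distance X Y = (LEAST k. (edit_op ^^ k) X Y)"

lemma edit_distance_attained: "(edit_op ^^ edit_distance X Y) X Y"
proof -
  have del: "edit_op\<^sup>*\<^sup>* X []" for X :: "'a list"
  proof (induction X)
    case (Cons a X)
    have "edit_op ([] @ [a] @ X) ([] @ X)" by (rule deletion)
    with Cons.IH show ?case by (auto intro: converse_rtranclp_into_rtranclp)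
  qed simp
  have ins: "edit_op\<^sup>*\<^sup>* [] Y" for Y :: "'a list"
  proof (induction Y)
    case (Cons a Y)
    have "edit_op ([] @ Y) ([] @ [a] @ Y)" by (rule insertion)
    with Cons.IH show ?case by (auto intro: rtranclp.rtrancl_into_rtrancl)
  qed simp
  have "edit_op\<^sup>*\<^sup>* X Y" by (rule rtranclp_trans[OF del ins])
  then obtain k where "(edit_op ^^ k) X Y" by (auto simp: rtranclp_power)
  then show ?thesis unfolding edit_distance_def by (rule LeastI)
qed


section \<open>Run-length encoding\<close>

text \<open>A run \<open>\<sigma>\<^sup>i\<close> is the pair \<open>(\<sigma>, i)\<close>.\<close>

fun rle :: "'a list \<Rightarrow> ('a \<times> nat) list" where
  "rle [] = []"
| "rle (x # xs) =
    (case rle xs of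
       [] \<Rightarrow> [(x, 1)]
     | (y, i) # rs \<Rightarrow> if x = y then (y, Suc i) # rs else (x, 1) # (y, i) # rs)"

lemma concat_rle: "concat (map (\<lambda>(a, i). replicate i a) (rle X)) = X"
  by (induction X) (auto split: list.splits)

lemma rle_maximal: "(\<forall>(a, i) \<in> set (rle X). i > 0) \<and> distinct_adj (map fst (rle X))"
  by (induction X) (auto split: list.splits)

lemma rle_eq_Nil_iff: "rle X = [] \<longleftrightarrow> X = []"
  by (cases X) (auto split: list.splits)


section \<open>The unit-cost RAM\<close>

text \<open>
  Words are integers, and a symbol is itself a word.  A machine has a word capacity \<open>W\<close>: its
  registers and memory cells hold integers of magnitude at most \<open>W\<close>.  An instruction whose
  result does not fit in a word, that accesses a negative address, or that divides by zero makes
  the machine fault, i.e. there is no next configuration and the run is not a halting one.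
  A program is a fixed finite list of instructions, so it uses finitely many registers.  Register
  and memory contents are thus the only unbounded storage, and memory is addressed indirectly
  through registers.  Jump targets are indices into the program.
\<close>

type_synonym word = int
type_synonym reg = nat

datatype arith_op = Plus | Minus | Times | Div | Mod

datatype instr =
    Const reg word
  | Copy reg reg
  | Arith arith_op reg reg reg  \<comment> \<open>destination, left operand, right operand\<close>
  | Load reg reg                \<comment> \<open>destination, register holding the address\<close>
  | Store reg reg               \<comment> \<open>register holding the address, source\<close>
  | Jump nat
  | JumpEq reg reg nat
  | JumpLess reg reg nat
  | Halt

type_synonym program = "instr list"

record config =
  pc :: nat
  regs :: "reg \<Rightarrow> word"
  mem :: "nat \<Rightarrow> word"

fun arith :: "arith_op \<Rightarrow> word \<Rightarrow> word \<Rightarrow> word option" where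
  "arith Plus x y = Some (x + y)"
| "arith Minus x y = Some (x - y)"
| "arith Times x y = Some (x * y)"
| "arith Div x y = (if y = 0 then None else Some (x div y))"
| "arith Mod x y = (if y = 0 then None else Some (x mod y))"

definition goto :: "nat \<Rightarrow> config \<Rightarrow> config" where
  "goto l c = c\<lparr>pc := l\<rparr>"

definition advance :: "config \<Rightarrow> config" where
  "advance c = goto (Suc (pc c)) c"

definition set_reg :: "word \<Rightarrow> reg \<Rightarrow> word \<Rightarrow> config \<Rightarrow> config option" where
  "set_reg W d v c = (if \<bar>v\<bar> \<le> W then Some (advance (c\<lparr>regs := (regs c)(d := v)\<rparr>)) else None)"

fun exec_instr :: "word \<Rightarrow> instr \<Rightarrow> config \<Rightarrow> config option" where
  "exec_instr W (Const d v) c = set_reg W d v c"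
| "exec_instr W (Copy d a) c = set_reg W d (regs c a) c"
| "exec_instr W (Arith f d a b) c =
    (case arith f (regs c a) (regs c b) of None \<Rightarrow> None | Some v \<Rightarrow> set_reg W d v c)"
| "exec_instr W (Load d a) c =
    (if 0 \<le> regs c a then set_reg W d (mem c (nat (regs c a))) c else None)"
| "exec_instr W (Store a s) c =
    (if 0 \<le> regs c a
     then Some (advance (c\<lparr>mem := (mem c)(nat (regs c a) := regs c s)\<rparr>)) else None)"
| "exec_instr W (Jump l) c = Some (goto l c)"
| "exec_instr W (JumpEq a b l) c =
    Some (if regs c a = regs c b then goto l c else advance c)"
| "exec_instr W (JumpLess a b l) c =
    Some (if regs c a < regs c b then goto l c else advance c)"
| "exec_instr W Halt c = None"

definition step :: "word \<Rightarrow> program \<Rightarrow> config \<Rightarrow> config \<Rightarrow> bool" where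
  "step W P c c' \<longleftrightarrow> pc c < length P \<and> exec_instr W (P ! pc c) c = Some c'"

text \<open>Started in \<open>c\<close>, the program reaches a \<open>Halt\<close> instruction after exactly \<open>t\<close> unit-cost steps,
  without faulting, and register 0 then holds the result.\<close>

definition halts_with :: "word \<Rightarrow> program \<Rightarrow> config \<Rightarrow> nat \<Rightarrow> word \<Rightarrow> bool" where
  "halts_with W P c t v \<longleftrightarrow>
    (\<exists>c'. (step W P ^^ t) c c' \<and> pc c' < length P \<and> P ! pc c' = Halt \<and> regs c' 0 = v)"

text \<open>Registers 0 and 1 initially hold the numbers of runs of the two strings.  The runs, those of
  the first string before those of the second, are stored from address 0 on, each as its symbol
  followed by its length.  All other registers and memory cells are 0.\<close>

definition encode_runs :: "(word \<times> nat) list \<Rightarrow> word list" where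
  "encode_runs rs = concat (map (\<lambda>(a, i). [a, int i]) rs)"

definition initial_config :: "(word \<times> nat) list \<Rightarrow> (word \<times> nat) list \<Rightarrow> config" where
  "initial_config r s =
    \<lparr>pc = 0,
     regs = (\<lambda>_. 0)(0 := int (length r), 1 := int (length s)),
     mem = (\<lambda>a. let ws = encode_runs r @ encode_runs s in if a < length ws then ws ! a else 0)\<rparr>"

text \<open>A word is large enough for the input if it holds every symbol and every integer of magnitude
  up to the \<open>k\<close>-th power of the sum of the uncompressed lengths.\<close>

definition word_fits :: "nat \<Rightarrow> word list \<Rightarrow> word list \<Rightarrow> word \<Rightarrow> bool" where
  "word_fits k X Y W \<longleftrightarrow>
    (\<forall>a \<in> set X \<union> set Y. \<bar>a\<bar> \<le> W) \<and> int (length X + length Y) ^ k \<le> W"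

text \<open>The logarithm of the time bound, so that the bound does not vanish at 1.\<close>

definition log1 :: "real \<Rightarrow> real" where
  "log1 x = max 1 (log 2 x)"

end

theory Submission
  imports Defs
begin

text \<open>
  The runs cut the dynamic programming table into \<open>m n\<close> blocks.  Along a side of a block, indexed by
  the diagonal \<open>d\<close>, the table is a minimum of an ordered list of cones
  \<open>d \<mapsto> max v (max (\<alpha> - d) (\<beta> + d))\<close>.  In a block of equal symbols the table is constant along the
  diagonals, so the lists of the left and top sides are just concatenated.  In a block of distinct
  symbols every cone propagates on its own to the bottom and right sides, where it is again a cone
  whose parameters arise from \<open>(v, \<alpha>, \<beta>)\<close> by selecting components and adding constants.  In both
  cases the list is then cut at the diagonal of the bottom right corner of the block.  As the table
  is 1-Lipschitz, the cones beyond one that attains the minimum there can be replaced by a single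
  cone with its apex at the corner, so a cut raises the number of cones by at most one.  Hence there
  are never more than \<open>O(m n)\<close> cones, and with 2-3 trees whose nodes carry pending maps every block
  takes \<open>O(log (m n))\<close> time.

  The algorithm is written in a small functional language of integers and pairs, for which costs are
  derived by a weakest precondition calculus; a compiler to the RAM preserves them up to a constant.
\<close>

section \<open>Edit distance by recursion\<close>

text \<open>A cone crosses a block of distinct symbols on its own because the recurrence uses only
  minima and the addition of 1: once the continuation of each single cone satisfies it, so does
  their minimum. Three parameters suffice since a path in such a block costs the larger of its
  horizontal and vertical extent. Maps that select components and add constants are closed under
  composition, so they can wait in tree nodes, and they commute with minima, so the stored minima
  stay usable. The delicate point of the count is that such a block produces two lists from the same
  cones, one for each outgoing side. They agree in value at the common corner, so both cuts happen
  at the same index and at most one extra cone results. Every crossing and cut adds constants to the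
  parameters, and memory is never reclaimed, so numbers grow with the number of blocks and addresses
  with the running time; both stay polynomial, which fixes the exponent of the word size. Trees are
  immutable, so the same trees feed both sides without a copy. The table is indexed by suffixes,
  because \<open>ed\<close> consumes strings from the front.\<close>

fun ed :: "'a list \<Rightarrow> 'a list \<Rightarrow> nat" where
  "ed [] ys = length ys"
| "ed (x # xs) [] = Suc (length xs)"
| "ed (x # xs) (y # ys) =
    (if x = y then ed xs ys else Suc (min (ed xs ys) (min (ed xs (y # ys)) (ed (x # xs) ys))))"

lemma ed_Nil2 [simp]: "ed xs [] = length xs"
  by (cases xs) auto

lemma ed_commute: "ed xs ys = ed ys xs"
  by (induction xs ys rule: ed.induct) auto

text \<open>The induction is on the total length rather than along \<open>ed\<close>, since the step
  also needs the claim for the head \<open>y\<close> of the second string; \<open>ed_commute\<close>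
  turns that into an instance for shorter strings.\<close>

lemma ed_Cons_Lipschitz: "ed (x # xs) ys \<le> Suc (ed xs ys) \<and> ed xs ys \<le> Suc (ed (x # xs) ys)"
proof (induction "length xs + length ys" arbitrary: x xs ys rule: less_induct)
  case less
  show ?case
  proof (cases ys)
    case (Cons y ys')
    have 1: "ed xs (y # ys') \<le> Suc (ed xs ys') \<and> ed xs ys' \<le> Suc (ed xs (y # ys'))"
      using less[of ys' xs y] Cons by (simp add: ed_commute)
    have 2: "ed xs ys' \<le> Suc (ed (x # xs) ys')"
      using less[of xs ys' x] Cons by simp
    show ?thesis using 1 2 Cons by auto
  qed auto
qed

lemma ed_Cons2_Lipschitz: "ed xs (y # ys) \<le> Suc (ed xs ys)" "ed xs ys \<le> Suc (ed xs (y # ys))"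
  using ed_Cons_Lipschitz[of y ys xs] by (simp_all add: ed_commute)

text \<open>Edit operations act in the middle of a string, so a comparison of \<open>X\<close> with
  \<open>Z\<close> must survive a common prefix. Quantifying over all \<open>Y\<close> lets the
  recurrence carry it through letter by letter.\<close>

lemma ed_append_context:
  assumes "\<And>Y. ed X Y \<le> Suc (ed Z Y)"
  shows "ed (u @ X) Y \<le> Suc (ed (u @ Z) Y)"
proof (induction u arbitrary: Y)
  case (Cons a u)
  show ?case
  proof (induction Y)
    case Nil
    show ?case using assms[of "[]"] by simp
  next
    case (Cons y ys)
    show ?case using Cons Cons.IH \<open>\<And>Y. ed (u @ X) Y \<le> Suc (ed (u @ Z) Y)\<close>[of ys]
      \<open>\<And>Y. ed (u @ X) Y \<le> Suc (ed (u @ Z) Y)\<close>[of "y # ys"] by auto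
  qed
qed (use assms in simp)

lemma ed_edit_op:
  assumes "edit_op X Z"
  shows "ed X Y \<le> Suc (ed Z Y)"
  using assms
proof cases
  case (insertion u v a)
  then show ?thesis using ed_append_context[of v "a # v" u Y] ed_Cons_Lipschitz[of a v] by simp
next
  case (deletion u a v)
  then show ?thesis using ed_append_context[of "a # v" v u Y] ed_Cons_Lipschitz[of a v] by simp
next
  case (substitution u a v b)
  \<comment> \<open>Passing through \<open>v\<close> would cost 2. Instead both sides are compared
    with \<open>ed v ys\<close>: the left one is at most one more, and \<open>ed v ys\<close> is at
    most \<open>ed (b # v) (y # ys)\<close>.\<close>
  have "ed (a # v) Y \<le> Suc (ed (b # v) Y)" for Y
  proof (cases Y)
    case (Cons y ys)
    show ?thesis
      using Cons ed_Cons_Lipschitz[of a v ys] ed_Cons_Lipschitz[of b v ys]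
        ed_Cons2_Lipschitz(1)[of v y ys] ed_Cons2_Lipschitz(2)[of v ys y] by auto
  qed auto
  then show ?thesis using substitution ed_append_context[of "a # v" "b # v" u Y] by simp
qed

lemma edit_op_Cons: "edit_op X Y \<Longrightarrow> edit_op (x # X) (x # Y)"
  by (erule edit_op.cases) (metis append_Cons edit_op.intros)+

lemma edit_op_pow_Cons: "(edit_op ^^ k) X Y \<Longrightarrow> (edit_op ^^ k) (x # X) (x # Y)"
  by (induction k arbitrary: Y) (auto intro: edit_op_Cons)

lemma edit_op_pow_delete: "(edit_op ^^ length X) X []"
proof (induction X)
  case (Cons a X)
  have "edit_op (a # X) X" using edit_op.deletion[of "[]" a X] by simp
  then show ?case using Cons by (auto simp: relpowp_Suc_right simp del: relpowp.simps intro: relpowp_Suc_I2)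
qed simp

lemma edit_op_pow_insert: "(edit_op ^^ length Y) [] Y"
proof (induction Y)
  case (Cons a X)
  have "edit_op X (a # X)" using edit_op.insertion[of "[]" X a] by simp
  then show ?case using Cons by auto
qed simp

lemma ed_attained: "(edit_op ^^ ed X Y) X Y"
proof (induction X Y rule: ed.induct)
  case (3 x xs y ys)
  show ?case
  proof (cases "x = y")
    case True
    then show ?thesis using 3 edit_op_pow_Cons by auto
  next
    case False
    have a: "edit_op (x # xs) (y # xs)" using edit_op.substitution[of "[]" x xs y] by simp
    have b: "edit_op (x # xs) xs" using edit_op.deletion[of "[]" x xs] by simp
    have c: "edit_op ys (y # ys)" using edit_op.insertion[of "[]" ys y] by simp
    have "(edit_op ^^ Suc (ed xs ys)) (x # xs) (y # ys)"
      using relpowp_Suc_I2[OF a edit_op_pow_Cons[OF 3(2)]] False by blast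
    moreover have "(edit_op ^^ Suc (ed xs (y # ys))) (x # xs) (y # ys)"
      using relpowp_Suc_I2[OF b 3(3)] False by blast
    moreover have "(edit_op ^^ Suc (ed (x # xs) ys)) (x # xs) (y # ys)"
      using relpowp_Suc_I[OF 3(4) c] False by blast
    ultimately show ?thesis using False by (auto simp only: ed.simps min_def if_False split: if_splits)
  qed
qed (use edit_op_pow_insert edit_op_pow_delete[of "_ # _"] in auto)

text \<open>By \<open>ed_edit_op\<close> one operation lowers \<open>ed\<close> by at most 1, and
  \<open>ed Y Y\<close> is 0.\<close>

lemma ed_le: "(edit_op ^^ k) X Y \<Longrightarrow> ed X Y \<le> k"
proof (induction k arbitrary: X)
  case 0
  have "ed Y Y = 0" for Y :: "'a list" by (induction Y) auto
  then show ?case using 0 by simp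
next
  case (Suc k)
  then obtain Z where "edit_op X Z" "(edit_op ^^ k) Z Y" by (meson relpowp_Suc_D2)
  then show ?case using Suc.IH ed_edit_op[of X Z Y] by fastforce
qed

lemma edit_distance_eq_ed: "edit_distance X Y = ed X Y"
  unfolding edit_distance_def by (rule Least_equality) (auto intro: ed_attained ed_le)

section \<open>Cones and blocks\<close>

text \<open>The second entries of a trip are the parameters of a cone.  The first entries matter when a trip
  is used as a map on trips: its component \<open>(s, x)\<close> is replaced by component \<open>s\<close> of the argument plus \<open>x\<close>.
  Composition of maps and application to a cone are then the same operation.\<close>

type_synonym comp = "int \<times> int"
datatype trip = Trip (tv: comp) (ta: comp) (tb: comp)

definition vv :: "trip \<Rightarrow> int" where "vv x = snd (tv x)"
definition aa :: "trip \<Rightarrow> int" where "aa x = snd (ta x)"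
definition bb :: "trip \<Rightarrow> int" where "bb x = snd (tb x)"

text \<open>The diagonals where the two arms meet the level \<open>vv x\<close>: if
  \<open>lft x \<le> rgt x\<close>, the cone is flat between them and has slopes -1 and 1
  outside.\<close>

definition lft :: "trip \<Rightarrow> int" where "lft x = aa x - vv x"
definition rgt :: "trip \<Rightarrow> int" where "rgt x = vv x - bb x"

definition cone :: "trip \<Rightarrow> int \<Rightarrow> int" where
  "cone x d = max (vv x) (max (aa x - d) (bb x + d))"

definition get :: "trip \<Rightarrow> int \<Rightarrow> comp" where
  "get m s = (if s = 0 then tv m else if s = 1 then ta m else tb m)"

definition select :: "trip \<Rightarrow> comp \<Rightarrow> comp" where
  "select m c = (fst (get m (fst c)), snd (get m (fst c)) + snd c)"

definition comp_map :: "trip \<Rightarrow> trip \<Rightarrow> trip" where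
  "comp_map \<mu> m = Trip (select m (tv \<mu>)) (select m (ta \<mu>)) (select m (tb \<mu>))"

text \<open>What crossing a block of distinct symbols with height \<open>h\<close>, width \<open>w\<close>, first diagonal \<open>a\<close> and
  last diagonal \<open>b\<close> does to a cone.\<close>

definition top_to_bottom :: "int \<Rightarrow> trip" where "top_to_bottom h = Trip (0, h) (1, 0) (2, h)"
definition top_to_right :: "int \<Rightarrow> trip" where "top_to_right b = Trip (2, b) (0, b) (2, 0)"
definition left_to_right :: "int \<Rightarrow> trip" where "left_to_right w = Trip (0, w) (1, w) (2, 0)"
definition left_to_bottom :: "int \<Rightarrow> trip" where "left_to_bottom a = Trip (1, - a) (1, 0) (0, - a)"
text \<open>The two clipping maps belong to the cut. They rewrite one arm so that the plateau begins
  or ends at \<open>e\<close>; a cone whose plateau contains \<open>e\<close> stays the same on the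
  other side of \<open>e\<close>.\<close>

definition clip_left :: "int \<Rightarrow> trip" where "clip_left e = Trip (0, 0) (0, e) (2, 0)"
definition clip_right :: "int \<Rightarrow> trip" where "clip_right e = Trip (0, 0) (1, 0) (0, - e)"
definition corner :: "int \<Rightarrow> int \<Rightarrow> trip" where "corner v d = Trip (0, v) (0, v + d) (0, v - d)"

lemma comp_map_comps [simp]:
  "vv (comp_map (top_to_bottom h) x) = vv x + h" "aa (comp_map (top_to_bottom h) x) = aa x" "bb (comp_map (top_to_bottom h) x) = bb x + h"
  "vv (comp_map (top_to_right b) x) = bb x + b" "aa (comp_map (top_to_right b) x) = vv x + b" "bb (comp_map (top_to_right b) x) = bb x"
  "vv (comp_map (left_to_right w) x) = vv x + w" "aa (comp_map (left_to_right w) x) = aa x + w" "bb (comp_map (left_to_right w) x) = bb x"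
  "vv (comp_map (left_to_bottom a) x) = aa x - a" "aa (comp_map (left_to_bottom a) x) = aa x" "bb (comp_map (left_to_bottom a) x) = vv x - a"
  "vv (comp_map (clip_left e) x) = vv x" "aa (comp_map (clip_left e) x) = vv x + e" "bb (comp_map (clip_left e) x) = bb x"
  "vv (comp_map (clip_right e) x) = vv x" "aa (comp_map (clip_right e) x) = aa x" "bb (comp_map (clip_right e) x) = vv x - e"
  "vv (corner v d) = v" "aa (corner v d) = v + d" "bb (corner v d) = v - d"
  by (simp_all add: comp_map_def select_def get_def vv_def aa_def bb_def corner_def
      top_to_bottom_def top_to_right_def left_to_right_def left_to_bottom_def clip_left_def clip_right_def)

text \<open>The plateaus lie in \<open>[a, b]\<close>, whereas \<open>F\<close> is the minimum only
  on \<open>[p, q]\<close>. The intervals differ on the sides where cones leave a block: there the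
  plateaus spread over all diagonals of the block, and the side covers only some of them. The cut
  makes the two intervals equal again.\<close>

definition represents :: "int \<Rightarrow> int \<Rightarrow> int \<Rightarrow> int \<Rightarrow> trip list \<Rightarrow> (int \<Rightarrow> int) \<Rightarrow> bool" where
  "represents a b p q xs F \<longleftrightarrow>
    (\<forall>x \<in> set xs. a \<le> lft x \<and> lft x \<le> rgt x \<and> rgt x \<le> b) \<and>
    sorted (map lft xs) \<and> sorted (map rgt xs) \<and>
    (\<forall>d. p \<le> d \<and> d \<le> q \<longrightarrow> (\<forall>x \<in> set xs. F d \<le> cone x d) \<and> (\<exists>x \<in> set xs. cone x d = F d))"

lemma cone_eq_sum:
  assumes "lft x \<le> rgt x"
  shows "cone x d = vv x + max 0 (lft x - d) + max 0 (d - rgt x)"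
proof -
  have "aa x = vv x + lft x" "bb x = vv x - rgt x"
    by (simp_all add: lft_def rgt_def)
  then have "cone x d = vv x + max 0 (max (lft x - d) (d - rgt x))"
    by (simp add: cone_def max_def)
  also have "max 0 (max (lft x - d) (d - rgt x)) = max 0 (lft x - d) + max 0 (d - rgt x)"
    using assms by (simp add: max_def)
  finally show ?thesis by simp
qed

lemma cone_difference_mono:
  assumes "lft x \<le> rgt x" "lft y \<le> rgt y" "lft x \<le> lft y" "rgt x \<le> rgt y" "d \<le> e"
  shows "cone x d - cone x e \<le> cone y d - cone y e"
proof -
  have "max 0 (lft x - d) - max 0 (lft x - e) \<le> max 0 (lft y - d) - max 0 (lft y - e)"
    using assms by (simp add: max_def)
  moreover have "max 0 (d - rgt x) - max 0 (e - rgt x) \<le> max 0 (d - rgt y) - max 0 (e - rgt y)"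
    using assms by (simp add: max_def)
  ultimately show ?thesis using assms by (simp add: cone_eq_sum)
qed

lemma cone_corner: "cone (corner v e) d = v + \<bar>d - e\<bar>"
  unfolding cone_def by simp

section \<open>Cutting a list of cones at a diagonal\<close>

definition split_first :: "('a \<Rightarrow> bool) \<Rightarrow> 'a list \<Rightarrow> 'a list \<times> 'a list" where
  "split_first p xs = (takeWhile (\<lambda>x. \<not> p x) xs, dropWhile (\<lambda>x. \<not> p x) xs)"

lemma split_first_Some:
  assumes "split_first p xs = (ys, zs)" "x \<in> set xs" "p x"
  obtains z zs' where "zs = z # zs'" "p z" "xs = ys @ z # zs'" "\<forall>y \<in> set ys. \<not> p y"
proof -
  have "zs \<noteq> []" using assms by (auto simp: split_first_def)
  then obtain z zs' where z: "zs = z # zs'" by (cases zs) auto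
  have "p z" using assms(1) z hd_dropWhile[of "\<lambda>x. \<not> p x" xs] by (auto simp: split_first_def)
  moreover have "xs = ys @ zs" using assms(1) by (auto simp: split_first_def)
  moreover have "\<forall>y \<in> set ys. \<not> p y" using assms(1) by (auto simp: split_first_def dest: set_takeWhileD)
  ultimately show ?thesis using z that by blast
qed

lemma split_first_props:
  assumes "split_first p xs = (ys, zs)"
  shows "xs = ys @ zs" "\<forall>y \<in> set ys. \<not> p y"
  using assms by (auto simp: split_first_def dest: set_takeWhileD)

lemma split_first_mono:
  assumes "split_first p xs = (ys, zs)" "sorted_wrt (\<lambda>x y. p x \<longrightarrow> p y) xs"
  shows "\<forall>z \<in> set zs. p z"
proof (cases zs)
  case (Cons z zs')
  have "p z" using assms(1) Cons hd_dropWhile[of "\<lambda>x. \<not> p x" xs] by (auto simp: split_first_def)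
  then show ?thesis using split_first_props(1)[OF assms(1)] assms(2) Cons by (auto simp: sorted_wrt_append)
qed simp

text \<open>The sentinel \<open>bg\<close> exceeds all distances and stands for the minimum of an empty list.\<close>

definition min_list_val :: "int \<Rightarrow> (trip \<Rightarrow> int) \<Rightarrow> trip list \<Rightarrow> int" where
  "min_list_val bg f xs = (if xs = [] then bg else Min (f ` set xs))"

text \<open>The classes \<open>P\<close>, \<open>M\<close> and \<open>S\<close> have their plateaus
  before, across and after \<open>e\<close>. Within a class the value at \<open>e\<close> is one
  parameter plus a constant, so componentwise minima find it. Testing the classes in this order and
  taking the first hit inside a class selects the first minimiser of the whole list.\<close>

definition cut_list :: "int \<Rightarrow> int \<Rightarrow> trip list \<Rightarrow> trip list \<times> trip list" where
  "cut_list bg e t =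
    (case split_first (\<lambda>x. e \<le> rgt x) t of (P, R) \<Rightarrow>
     case split_first (\<lambda>x. e < lft x) R of (M, S) \<Rightarrow>
     let p = min_list_val bg (\<lambda>x. bb x + e) P; m = min_list_val bg vv M; s = min_list_val bg (\<lambda>x. aa x - e) S;
         D = min p (min m s)
     in if p = D then
          (case split_first (\<lambda>x. bb x \<le> D - e) P of (P1, P2) \<Rightarrow>
            (P1 @ [hd P2], corner D e # map (comp_map (clip_left e)) M @ S))
        else if m = D then
          (case split_first (\<lambda>x. vv x \<le> D) M of (M1, M2) \<Rightarrow>
            (P @ map (comp_map (clip_right e)) (M1 @ [hd M2]), map (comp_map (clip_left e)) M2 @ S))
        else
          (case split_first (\<lambda>x. aa x \<le> D + e) S of (S1, S2) \<Rightarrow>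
            (P @ map (comp_map (clip_right e)) M @ [corner D e], S2)))"

text \<open>The argmin \<open>q\<close> of the cut falls in one of three classes; in each class the cut lists are
  described relative to it.\<close>

lemma cut_list_cases:
  assumes wf: "\<forall>x \<in> set t. lft x \<le> rgt x" "sorted (map lft t)" "sorted (map rgt t)"
    and ex: "x0 \<in> set t" "cone x0 e = Fe" and lb: "\<forall>x \<in> set t. Fe \<le> cone x e" and bg: "Fe < bg"
  obtains P1 q P2 M S where "t = P1 @ q # P2 @ M @ S" "cone q e = Fe" "\<forall>x \<in> set P1. Fe < cone x e"
      "\<forall>x \<in> set (P1 @ q # P2). rgt x < e" "\<forall>x \<in> set M. lft x \<le> e \<and> e \<le> rgt x" "\<forall>x \<in> set S. e < lft x"
      "cut_list bg e t = (P1 @ [q], corner Fe e # map (comp_map (clip_left e)) M @ S)"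
  | P M1 q M2 S where "t = P @ M1 @ q # M2 @ S" "cone q e = Fe" "\<forall>x \<in> set (P @ M1). Fe < cone x e"
      "\<forall>x \<in> set P. rgt x < e" "\<forall>x \<in> set (M1 @ q # M2). lft x \<le> e \<and> e \<le> rgt x" "\<forall>x \<in> set S. e < lft x"
      "cut_list bg e t = (P @ map (comp_map (clip_right e)) (M1 @ [q]), map (comp_map (clip_left e)) (q # M2) @ S)"
  | P M S1 q S2 where "t = P @ M @ S1 @ q # S2" "cone q e = Fe" "\<forall>x \<in> set (P @ M @ S1). Fe < cone x e"
      "\<forall>x \<in> set P. rgt x < e" "\<forall>x \<in> set M. lft x \<le> e \<and> e \<le> rgt x" "\<forall>x \<in> set (S1 @ q # S2). e < lft x"
      "cut_list bg e t = (P @ map (comp_map (clip_right e)) M @ [corner Fe e], q # S2)"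
proof -
  obtain P R where PR: "split_first (\<lambda>x. e \<le> rgt x) t = (P, R)" by force
  obtain M S where MS: "split_first (\<lambda>x. e < lft x) R = (M, S)" by force
  have tPR: "t = P @ R" and P: "\<forall>x \<in> set P. rgt x < e" using split_first_props[OF PR] by auto
  have RMS: "R = M @ S" and M1: "\<forall>x \<in> set M. lft x \<le> e" using split_first_props[OF MS] by auto
  have t: "t = P @ M @ S" using tPR RMS by simp
  \<comment> \<open>The two sortings enter here: both tests are monotone along the list, so the
    prefixes up to the first hit are the complete classes.\<close>
  have R: "\<forall>x \<in> set R. e \<le> rgt x"
    by (rule split_first_mono[OF PR]) (use wf(3) in \<open>auto simp: sorted_wrt_map elim!: sorted_wrt_mono_rel[rotated]\<close>)
  have S: "\<forall>x \<in> set S. e < lft x"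
    by (rule split_first_mono[OF MS])
      (use wf(2) tPR in \<open>auto simp: sorted_wrt_map sorted_wrt_append elim!: sorted_wrt_mono_rel[rotated]\<close>)
  have M: "\<forall>x \<in> set M. lft x \<le> e \<and> e \<le> rgt x" using M1 R RMS by auto
  have cP: "cone x e = bb x + e" if "x \<in> set P" for x
    using P wf(1) that t by (force simp: cone_def lft_def rgt_def)
  have cM: "cone x e = vv x" if "x \<in> set M" for x
    using M that by (force simp: cone_def lft_def rgt_def)
  have cS: "cone x e = aa x - e" if "x \<in> set S" for x
    using S wf(1) that t by (force simp: cone_def lft_def rgt_def)
  define p where "p = min_list_val bg (\<lambda>x. bb x + e) P"
  define m where "m = min_list_val bg vv M"
  define s where "s = min_list_val bg (\<lambda>x. aa x - e) S"
  have mvl_eq: "Fe \<le> min_list_val bg f xs \<and> (min_list_val bg f xs = Fe \<longleftrightarrow> (\<exists>x \<in> set xs. cone x e = Fe))"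
    if f: "\<And>x. x \<in> set xs \<Longrightarrow> cone x e = f x" and sub: "set xs \<subseteq> set t" for f xs
  proof (cases "xs = []")
    case False
    have lb': "Fe \<le> f x" if "x \<in> set xs" for x using lb sub f that by force
    have *: "Min (f ` set xs) \<in> f ` set xs" using False by (intro Min_in) auto
    have "Fe \<le> Min (f ` set xs)" using lb' False by (subst Min_ge_iff) auto
    moreover have "Min (f ` set xs) = Fe" if "x \<in> set xs" "cone x e = Fe" for x
    proof -
      have "Min (f ` set xs) \<le> Fe" using that f[of x] by (metis List.finite_set Min_le finite_imageI image_eqI)
      then show ?thesis using \<open>Fe \<le> Min (f ` set xs)\<close> by simp
    qed
    moreover obtain y where "y \<in> set xs" "Min (f ` set xs) = f y" using * by blast
    ultimately show ?thesis using f False by (metis min_list_val_def)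
  qed (use bg in \<open>auto simp: min_list_val_def\<close>)
  have p: "Fe \<le> p \<and> (p = Fe \<longleftrightarrow> (\<exists>x \<in> set P. cone x e = Fe))"
    unfolding p_def by (rule mvl_eq) (use cP t in auto)
  have m: "Fe \<le> m \<and> (m = Fe \<longleftrightarrow> (\<exists>x \<in> set M. cone x e = Fe))"
    unfolding m_def by (rule mvl_eq) (use cM t in auto)
  have s: "Fe \<le> s \<and> (s = Fe \<longleftrightarrow> (\<exists>x \<in> set S. cone x e = Fe))"
    unfolding s_def by (rule mvl_eq) (use cS t in auto)
  have "p = Fe \<or> m = Fe \<or> s = Fe" using p m s ex t by auto
  then have D: "min p (min m s) = Fe" using p m s by linarith
  note cut = cut_list_def[of bg e t, unfolded PR prod.case MS p_def[symmetric] m_def[symmetric]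
      s_def[symmetric] D Let_def]
  consider "p = Fe" | "p \<noteq> Fe" "m = Fe" | "p \<noteq> Fe" "m \<noteq> Fe" "s = Fe"
    using \<open>p = Fe \<or> m = Fe \<or> s = Fe\<close> by blast
  then show ?thesis
  proof cases
    case 1
    then obtain x where x: "x \<in> set P" "cone x e = Fe" using p by auto
    obtain P1 P2 where b: "split_first (\<lambda>x. bb x \<le> Fe - e) P = (P1, P2)" by force
    have "bb x \<le> Fe - e" using x cP by force
    from split_first_Some[OF b x(1) this] obtain q P2' where q: "P2 = q # P2'" "bb q \<le> Fe - e"
      "P = P1 @ q # P2'" "\<forall>y\<in>set P1. \<not> bb y \<le> Fe - e" by metis
    show ?thesis
    proof (rule that(1)[of P1 q P2' M S])
      show "cone q e = Fe" using cP[of q] q lb t by force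
      show "\<forall>x\<in>set P1. Fe < cone x e" using cP q by force
      show "cut_list bg e t = (P1 @ [q], corner Fe e # map (comp_map (clip_left e)) M @ S)"
        using cut 1 b q by simp
    qed (use t q P M S in auto)
  next
    case 2
    then obtain x where x: "x \<in> set M" "cone x e = Fe" using m by auto
    obtain M1 M2 where b: "split_first (\<lambda>x. vv x \<le> Fe) M = (M1, M2)" by force
    have "vv x \<le> Fe" using x cM by force
    from split_first_Some[OF b x(1) this] obtain q M2' where q: "M2 = q # M2'" "vv q \<le> Fe"
      "M = M1 @ q # M2'" "\<forall>y\<in>set M1. \<not> vv y \<le> Fe" by metis
    show ?thesis
    proof (rule that(2)[of P M1 q M2' S])
      show "cone q e = Fe" using cM[of q] q lb t by force
      show "\<forall>x\<in>set (P @ M1). Fe < cone x e" using cM q p 2 lb t by (force simp: order_less_le)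
      show "cut_list bg e t = (P @ map (comp_map (clip_right e)) (M1 @ [q]), map (comp_map (clip_left e)) (q # M2') @ S)"
        using cut 2 b q by simp
    qed (use t q P M S in auto)
  next
    case 3
    then obtain x where x: "x \<in> set S" "cone x e = Fe" using s by auto
    obtain S1 S2 where b: "split_first (\<lambda>x. aa x \<le> Fe + e) S = (S1, S2)" by force
    have "aa x \<le> Fe + e" using x cS by force
    from split_first_Some[OF b x(1) this] obtain q S2' where q: "S2 = q # S2'" "aa q \<le> Fe + e"
      "S = S1 @ q # S2'" "\<forall>y\<in>set S1. \<not> aa y \<le> Fe + e" by metis
    show ?thesis
    proof (rule that(3)[of P M S1 q S2'])
      show "cone q e = Fe" using cS[of q] q lb t by force
      show "\<forall>x\<in>set (P @ M @ S1). Fe < cone x e" using cS q p m 3 lb t by (force simp: order_less_le)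
      show "cut_list bg e t = (P @ map (comp_map (clip_right e)) M @ [corner Fe e], q # S2')"
        using cut 3 b q by simp
    qed (use t q P M S in auto)
  qed
qed

lemma length_takeWhile_first:
  assumes "\<forall>x \<in> set xs. f x \<noteq> c" "f q = c"
  shows "length (takeWhile (\<lambda>y. y \<noteq> c) (map f (xs @ q # ys))) = length xs"
  using assms by (induction xs) auto

text \<open>\<open>k\<close> is the position of the first minimiser, described through the values at
  \<open>e\<close> alone. The outgoing sides of a block are cut from possibly different lists with
  equal values at the corner, so the two bounds can be added for a common \<open>k\<close>, which
  leaves one extra cone.\<close>

lemma cut_list_length:
  assumes "\<forall>x \<in> set t. lft x \<le> rgt x" "sorted (map lft t)" "sorted (map rgt t)"
    and "x0 \<in> set t" "cone x0 e = Fe" and "\<forall>x \<in> set t. Fe \<le> cone x e" and "Fe < bg"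
  defines "k \<equiv> length (takeWhile (\<lambda>y. y \<noteq> Fe) (map (\<lambda>x. cone x e) t))"
  shows "length (fst (cut_list bg e t)) \<le> k + 1" "length (snd (cut_list bg e t)) + k \<le> length t"
proof -
  have "length (fst (cut_list bg e t)) \<le> k + 1 \<and> length (snd (cut_list bg e t)) + k \<le> length t"
    using assms(1-7)
  proof (cases rule: cut_list_cases)
    case (1 P1 q P2 M S)
    have "k = length P1" unfolding k_def 1(1) by (rule length_takeWhile_first) (use 1 in auto)
    then show ?thesis using 1 by simp
  next
    case (2 P M1 q M2 S)
    have "k = length (P @ M1)" unfolding k_def 2(1) append_assoc[symmetric]
      by (rule length_takeWhile_first) (use 2(2,3) in \<open>auto simp del: set_append\<close>)
    then show ?thesis using 2 by simp
  next
    case (3 P M S1 q S2)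
    have "k = length (P @ M @ S1)"
      using length_takeWhile_first[of "P @ M @ S1" "\<lambda>x. cone x e" Fe q S2, OF _ 3(2)] 3(1,3) unfolding k_def
      by (simp add: order_less_imp_not_eq2)
    then show ?thesis using 3 by simp
  qed
  then show "length (fst (cut_list bg e t)) \<le> k + 1" "length (snd (cut_list bg e t)) + k \<le> length t" by auto
qed

lemma represents_cone_CR:
  assumes "lft x \<le> rgt x" "e \<le> rgt x" "d \<le> e"
  shows "cone (comp_map (clip_right e) x) d = cone x d"
  using assms unfolding cone_def lft_def rgt_def by (simp add: max_def)

lemma represents_cone_CL:
  assumes "lft x \<le> rgt x" "lft x \<le> e" "e \<le> d"
  shows "cone (comp_map (clip_left e) x) d = cone x d"
  using assms unfolding cone_def lft_def rgt_def by (simp add: max_def)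

lemma lft_rgt_simps [simp]:
  "lft (comp_map (clip_left e) x) = e" "rgt (comp_map (clip_left e) x) = rgt x"
  "lft (comp_map (clip_right e) x) = lft x" "rgt (comp_map (clip_right e) x) = e"
  "lft (corner v e) = e" "rgt (corner v e) = e"
  by (simp_all add: lft_def rgt_def)

text \<open>Before \<open>e\<close> the first minimiser \<open>q\<close> is no larger than any cone
  after it, so those can go. If \<open>q\<close> lies beyond \<open>e\<close>, a corner takes its
  place, and \<open>lip\<close> keeps the corner from falling below \<open>F\<close>. Plateaus
  across \<open>e\<close> are shortened, which changes nothing before \<open>e\<close>.\<close>

lemma cut_list_left:
  assumes rep: "represents a b p e t F" and ap: "a \<le> e" "p \<le> e" and bg: "F e < bg"
    and lip: "\<And>d. p \<le> d \<Longrightarrow> d \<le> e \<Longrightarrow> F d \<le> F e + (e - d)"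
  shows "represents a e p e (fst (cut_list bg e t)) F"
proof -
  have wf: "\<forall>x \<in> set t. a \<le> lft x \<and> lft x \<le> rgt x \<and> rgt x \<le> b"
    and so: "sorted (map lft t)" "sorted (map rgt t)"
    and lb: "\<And>d x. p \<le> d \<Longrightarrow> d \<le> e \<Longrightarrow> x \<in> set t \<Longrightarrow> F d \<le> cone x d"
    and ex: "\<And>d. p \<le> d \<Longrightarrow> d \<le> e \<Longrightarrow> \<exists>x \<in> set t. cone x d = F d"
    using rep by (auto simp: represents_def)
  obtain x0 where x0: "x0 \<in> set t" "cone x0 e = F e" using ex[of e] ap by auto
  have wf': "\<forall>x \<in> set t. lft x \<le> rgt x" and lb': "\<forall>x \<in> set t. F e \<le> cone x e" using wf lb ap by auto
  have dom: "cone q d \<le> cone y d" if "t = u @ q # v" "y \<in> set v" "cone q e = F e" "p \<le> d" "d \<le> e" for q u v y d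
  proof -
    have "lft q \<le> lft y" "rgt q \<le> rgt y" using so that(1,2) by (auto simp: sorted_append)
    then show ?thesis using cone_difference_mono[of q y d e] wf that lb[of e y] ap by auto
  qed
  from wf' so x0 lb' bg show ?thesis
  proof (cases rule: cut_list_cases)
    case (1 P1 q P2 M S)
    have "\<exists>x \<in> set (P1 @ [q]). cone x d = F d" if d: "p \<le> d" "d \<le> e" for d
    proof -
      obtain x where x: "x \<in> set t" "cone x d = F d" using ex d by auto
      show ?thesis
      proof (cases "x \<in> set (P1 @ [q])")
        case False
        then have "cone q d \<le> cone x d" using dom[OF 1(1), of x d] 1(2) d x 1(1) by auto
        then show ?thesis using x lb[OF d, of q] 1(1) by auto
      qed (use x in auto)
    qed
    then show ?thesis
      unfolding represents_def 1(7) using so lb wf 1 by (auto simp: sorted_append)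
  next
    case (2 P M1 q M2 S)
    have t: "t = (P @ M1) @ q # M2 @ S" using 2(1) by simp
    have c: "cone (comp_map (clip_right e) x) d = cone x d" if "x \<in> set (M1 @ [q])" "d \<le> e" for x d
      using that 2 wf' by (intro represents_cone_CR) auto
    have "\<exists>x \<in> set (P @ map (comp_map (clip_right e)) (M1 @ [q])). cone x d = F d" if d: "p \<le> d" "d \<le> e" for d
    proof -
      obtain x where x: "x \<in> set t" "cone x d = F d" using ex d by auto
      have "\<exists>x \<in> set (P @ M1 @ [q]). cone x d = F d"
      proof (cases "x \<in> set (P @ M1 @ [q])")
        case False
        then have "cone q d \<le> cone x d" using dom[OF t, of x d] 2(2) d x t by auto
        then show ?thesis using x lb[OF d, of q] t by auto
      qed (use x in auto)
      then show ?thesis using c d by (auto intro: rev_bexI)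
    qed
    moreover have "sorted (map rgt (P @ map (comp_map (clip_right e)) (M1 @ [q])))"
      using so(2) 2(1,4) by (auto simp: sorted_append o_def map_replicate_const order_less_imp_le)
    moreover have "sorted (map lft (P @ map (comp_map (clip_right e)) (M1 @ [q])))"
      using so(1) 2(1) by (auto simp: sorted_append o_def map_replicate_const)
    moreover have "\<forall>x \<in> set (P @ map (comp_map (clip_right e)) (M1 @ [q])). a \<le> lft x \<and> lft x \<le> rgt x \<and> rgt x \<le> e"
      using 2(4,5) wf t by (auto intro: order_less_imp_le)
    moreover have "F d \<le> cone x d" if "p \<le> d" "d \<le> e" "x \<in> set (P @ map (comp_map (clip_right e)) (M1 @ [q]))" for x d
      using that lb[OF that(1,2)] c t by auto
    ultimately show ?thesis unfolding represents_def 2(7) fst_conv by blast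
  next
    case (3 P M S1 q S2)
    have c: "cone (comp_map (clip_right e) x) d = cone x d" if "x \<in> set M" "d \<le> e" for x d
      using that 3 wf' by (intro represents_cone_CR) auto
    have co: "F d \<le> cone (corner (F e) e) d" if "p \<le> d" "d \<le> e" for d
      using lip[OF that] that by (simp add: cone_corner)
    have "\<exists>x \<in> set (P @ map (comp_map (clip_right e)) M @ [corner (F e) e]). cone x d = F d" if d: "p \<le> d" "d \<le> e" for d
    proof -
      obtain x where x: "x \<in> set t" "cone x d = F d" using ex d by auto
      consider "x \<in> set P" | "x \<in> set M" | "x \<in> set (S1 @ q # S2)" using x(1) 3(1) by auto
      then show ?thesis
      proof cases
        case 3
        then have "e < lft x" "lft x \<le> rgt x" "F e \<le> cone x e"
          using \<open>\<forall>x \<in> set (S1 @ q # S2). e < lft x\<close> wf' lb' x(1) by auto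
        \<comment> \<open>Both cones have slope -1 up to \<open>e\<close>, and at \<open>e\<close>
          the corner is no higher.\<close>
        then have "cone (corner (F e) e) d \<le> cone x d"
          using d by (auto simp: cone_corner cone_def lft_def rgt_def max_def split: if_splits)
        then have "cone (corner (F e) e) d = F d" using co[OF d] x(2) by simp
        then show ?thesis by simp
      qed (use x c[of x d] d in \<open>auto intro: rev_bexI\<close>)
    qed
    moreover have "sorted (map rgt (P @ map (comp_map (clip_right e)) M @ [corner (F e) e]))"
      using so(2) 3(1,4) by (auto simp: sorted_append o_def map_replicate_const order_less_imp_le)
    moreover have "sorted (map lft (P @ map (comp_map (clip_right e)) M @ [corner (F e) e]))"
      using so(1) 3(1,4,5) wf' by (auto simp: sorted_append o_def map_replicate_const) (metis Un_iff order.trans order_less_imp_le)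
    moreover have "\<forall>x \<in> set (P @ map (comp_map (clip_right e)) M @ [corner (F e) e]). a \<le> lft x \<and> lft x \<le> rgt x \<and> rgt x \<le> e"
      using 3(1,4,5) wf ap by (auto intro: order_less_imp_le)
    moreover have "F d \<le> cone x d" if "p \<le> d" "d \<le> e" "x \<in> set (P @ map (comp_map (clip_right e)) M @ [corner (F e) e])" for x d
      using that lb[OF that(1,2)] c co 3(1) by auto
    ultimately show ?thesis unfolding represents_def 3(7) fst_conv by blast
  qed
qed

text \<open>The mirror image of \<open>cut_list_left\<close>: now \<open>q\<close> beats the cones
  before it. The cones of \<open>P2\<close>, which come after \<open>q\<close> but have their
  plateaus before \<open>e\<close>, are covered by the corner as well.\<close>

lemma cut_list_right:
  assumes rep: "represents a b e p t F" and ap: "e \<le> b" "e \<le> p" and bg: "F e < bg"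
    and lip: "\<And>d. e \<le> d \<Longrightarrow> d \<le> p \<Longrightarrow> F d \<le> F e + (d - e)"
  shows "represents e b e p (snd (cut_list bg e t)) F"
proof -
  have wf: "\<forall>x \<in> set t. a \<le> lft x \<and> lft x \<le> rgt x \<and> rgt x \<le> b"
    and so: "sorted (map lft t)" "sorted (map rgt t)"
    and lb: "\<And>d x. e \<le> d \<Longrightarrow> d \<le> p \<Longrightarrow> x \<in> set t \<Longrightarrow> F d \<le> cone x d"
    and ex: "\<And>d. e \<le> d \<Longrightarrow> d \<le> p \<Longrightarrow> \<exists>x \<in> set t. cone x d = F d"
    using rep by (auto simp: represents_def)
  obtain x0 where x0: "x0 \<in> set t" "cone x0 e = F e" using ex[of e] ap by auto
  have wf': "\<forall>x \<in> set t. lft x \<le> rgt x" and lb': "\<forall>x \<in> set t. F e \<le> cone x e" using wf lb ap by auto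
  have dom: "cone q d \<le> cone y d" if "t = u @ q # v" "y \<in> set u" "cone q e = F e" "e \<le> d" "d \<le> p" for q u v y d
  proof -
    have "lft y \<le> lft q" "rgt y \<le> rgt q" using so that(1,2) by (auto simp: sorted_append)
    then show ?thesis using cone_difference_mono[of y q e d] wf that lb[of e y] ap by auto
  qed
  from wf' so x0 lb' bg show ?thesis
  proof (cases rule: cut_list_cases)
    case (1 P1 q P2 M S)
    let ?R = "corner (F e) e # map (comp_map (clip_left e)) M @ S"
    have c: "cone (comp_map (clip_left e) x) d = cone x d" if "x \<in> set M" "e \<le> d" for x d
      using that 1 wf' by (intro represents_cone_CL) auto
    have co: "F d \<le> cone (corner (F e) e) d" if "e \<le> d" "d \<le> p" for d
      using lip[OF that] that by (simp add: cone_corner)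
    have "\<exists>x \<in> set ?R. cone x d = F d" if d: "e \<le> d" "d \<le> p" for d
    proof -
      obtain x where x: "x \<in> set t" "cone x d = F d" using ex d by auto
      consider "x \<in> set S" | "x \<in> set M" | "x \<in> set (P1 @ q # P2)" using x(1) 1(1) by auto
      then show ?thesis
      proof cases
        case 3
        then have "rgt x < e" "lft x \<le> rgt x" "F e \<le> cone x e"
          using \<open>\<forall>x \<in> set (P1 @ q # P2). rgt x < e\<close> wf' lb' x(1) by auto
        then have "cone (corner (F e) e) d \<le> cone x d"
          using d by (auto simp: cone_corner cone_def lft_def rgt_def max_def split: if_splits)
        then have "cone (corner (F e) e) d = F d" using co[OF d] x(2) by simp
        then show ?thesis by simp
      qed (use x c[of x d] d in \<open>auto intro: rev_bexI\<close>)
    qed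
    moreover have "sorted (map lft ?R)"
      using so(1) 1(1,6) by (auto simp: sorted_append o_def map_replicate_const order_less_imp_le)
    moreover have "sorted (map rgt ?R)"
      using so(2) 1(1,5,6) wf' by (auto simp: sorted_append o_def map_replicate_const) (metis Un_iff order.trans order_less_imp_le)
    moreover have "\<forall>x \<in> set ?R. e \<le> lft x \<and> lft x \<le> rgt x \<and> rgt x \<le> b"
      using 1(1,5,6) wf ap by (auto intro: order_less_imp_le)
    moreover have "F d \<le> cone x d" if "e \<le> d" "d \<le> p" "x \<in> set ?R" for x d
      using that lb[OF that(1,2)] c co 1(1) by auto
    ultimately show ?thesis unfolding represents_def 1(7) snd_conv by blast
  next
    case (2 P M1 q M2 S)
    let ?R = "map (comp_map (clip_left e)) (q # M2) @ S"
    have t: "t = (P @ M1) @ q # M2 @ S" using 2(1) by simp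
    have c: "cone (comp_map (clip_left e) x) d = cone x d" if "x \<in> set (q # M2)" "e \<le> d" for x d
      using that 2 wf' by (intro represents_cone_CL) auto
    have "\<exists>x \<in> set ?R. cone x d = F d" if d: "e \<le> d" "d \<le> p" for d
    proof -
      obtain x where x: "x \<in> set t" "cone x d = F d" using ex d by auto
      have "\<exists>x \<in> set (q # M2 @ S). cone x d = F d"
      proof (cases "x \<in> set (q # M2 @ S)")
        case False
        then have "cone q d \<le> cone x d" using dom[OF t, of x d] 2(2) d x t by auto
        then show ?thesis using x lb[OF d, of q] t by auto
      qed (use x in auto)
      then show ?thesis using c d by (auto intro: rev_bexI)
    qed
    moreover have "sorted (map lft ?R)"
      using so(1) 2(1,6) by (auto simp: sorted_append o_def map_replicate_const order_less_imp_le)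
    moreover have "sorted (map rgt ?R)"
      using so(2) 2(1) by (auto simp: sorted_append o_def map_replicate_const)
    moreover have "\<forall>x \<in> set ?R. e \<le> lft x \<and> lft x \<le> rgt x \<and> rgt x \<le> b"
      using 2(5,6) wf t by (auto intro: order_less_imp_le)
    moreover have "F d \<le> cone x d" if "e \<le> d" "d \<le> p" "x \<in> set ?R" for x d
      using that lb[OF that(1,2)] c t by auto
    ultimately show ?thesis unfolding represents_def 2(7) snd_conv by blast
  next
    case (3 P M S1 q S2)
    have t: "t = (P @ M @ S1) @ q # S2" using 3(1) by simp
    have "\<exists>x \<in> set (q # S2). cone x d = F d" if d: "e \<le> d" "d \<le> p" for d
    proof -
      obtain x where x: "x \<in> set t" "cone x d = F d" using ex d by auto
      show ?thesis
      proof (cases "x \<in> set (q # S2)")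
        case False
        then have "cone q d \<le> cone x d" using dom[OF t, of x d] 3(2) d x t by auto
        then show ?thesis using x lb[OF d, of q] t by auto
      qed (use x in auto)
    qed
    moreover have "sorted (map lft (q # S2))" "sorted (map rgt (q # S2))"
      using so t by (auto simp: sorted_append)
    moreover have "\<forall>x \<in> set (q # S2). e \<le> lft x \<and> lft x \<le> rgt x \<and> rgt x \<le> b"
      using 3(6) wf t by (auto intro: order_less_imp_le)
    moreover have "F d \<le> cone x d" if "e \<le> d" "d \<le> p" "x \<in> set (q # S2)" for x d
      using that lb[OF that(1,2)] t by auto
    ultimately show ?thesis unfolding represents_def 3(7) snd_conv by blast
  qed
qed

section \<open>Crossing a block of distinct symbols\<close>

definition ext_left :: "int \<Rightarrow> trip \<Rightarrow> nat \<Rightarrow> nat \<Rightarrow> int" where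
  "ext_left c x i j = max (vv x + int j) (max (aa x - c + int i) (bb x + c + int j - int i))"

text \<open>On the side where the cone enters (\<open>i = 0\<close> here, \<open>j = 0\<close> for
  \<open>ext_left\<close>) this is the cone itself. Inside the block it is the cheapest continuation
  of the cone, regarded on the whole line, by unit-cost steps down, right or diagonally.\<close>

definition ext_top :: "int \<Rightarrow> trip \<Rightarrow> nat \<Rightarrow> nat \<Rightarrow> int" where
  "ext_top c x i j = max (vv x + int i) (max (bb x + c + int j) (aa x - c - int j + int i))"

text \<open>The hypothesis forbids both arms to reach the level \<open>x\<close> at once; for cones
  it follows from \<open>lft x \<le> rgt x\<close>. At \<open>x = y = z\<close>, for instance, all
  three arguments of the minimum would exceed the right-hand side.\<close>

lemma max_step:
  fixes x y z :: int
  assumes "y < x \<or> z < x"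
  shows "min (max x (max y (z + 1))) (min (max x (max (y + 1) z)) (max (x + 1) (max y (z + 2)))) = max x (max y z)"
  using assms by (auto simp: max_def min_def)

lemma ext_top_step:
  assumes "lft x \<le> rgt x"
  shows "1 + min (ext_top c x i j) (min (ext_top c x i (Suc j)) (ext_top c x (Suc i) j)) = ext_top c x (Suc i) (Suc j)"
proof -
  define X Y Z where "X = vv x + int i + 1" and "Y = bb x + c + int j + 1" and "Z = aa x - c - int j + int i"
  have "Y < X \<or> Z < X" using assms unfolding X_def Y_def Z_def lft_def rgt_def by linarith
  moreover have "1 + ext_top c x i j = max X (max Y (Z + 1))" "1 + ext_top c x i (Suc j) = max X (max (Y + 1) Z)"
      "1 + ext_top c x (Suc i) j = max (X + 1) (max Y (Z + 2))" "ext_top c x (Suc i) (Suc j) = max X (max Y Z)"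
    unfolding ext_top_def X_def Y_def Z_def by (simp_all add: max_add_distrib_right algebra_simps)
  ultimately show ?thesis using max_step[of Y X Z] by (simp only: min_add_distrib_right)
qed

lemma ext_left_step:
  assumes "lft x \<le> rgt x"
  shows "1 + min (ext_left c x i j) (min (ext_left c x (Suc i) j) (ext_left c x i (Suc j))) = ext_left c x (Suc i) (Suc j)"
proof -
  define X Y Z where "X = vv x + int j + 1" and "Y = aa x - c + int i + 1" and "Z = bb x + c + int j - int i"
  have "Y < X \<or> Z < X" using assms unfolding X_def Y_def Z_def lft_def rgt_def by linarith
  moreover have "1 + ext_left c x i j = max X (max Y (Z + 1))" "1 + ext_left c x i (Suc j) = max (X + 1) (max Y (Z + 2))"
      "1 + ext_left c x (Suc i) j = max X (max (Y + 1) Z)" "ext_left c x (Suc i) (Suc j) = max X (max Y Z)"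
    unfolding ext_left_def X_def Y_def Z_def by (simp_all add: max_add_distrib_right algebra_simps)
  ultimately show ?thesis using max_step[of Y X Z] by (simp only: min_add_distrib_right)
qed

text \<open>In a block of mismatching runs every cone, extended to the plane by the distance it stands for,
  satisfies the recurrence itself, hence so does the minimum of all cones.\<close>

lemma mismatch_block:
  fixes G :: "nat \<Rightarrow> nat \<Rightarrow> int"
  assumes step: "\<And>i j. G (Suc i) (Suc j) = 1 + min (G i j) (min (G i (Suc j)) (G (Suc i) j))"
    and lipL: "\<And>i. G i 0 \<le> G 0 0 + int i" and lipT: "\<And>j. G 0 j \<le> G 0 0 + int j"
    and L: "represents (c - int h) c (c - int h) c L (\<lambda>d. G (nat (c - d)) 0)"
    and T: "represents c (c + int w) c (c + int w) T (\<lambda>d. G 0 (nat (d - c)))"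
  shows "i \<le> h \<Longrightarrow> j \<le> w \<Longrightarrow>
    (\<forall>x \<in> set L. G i j \<le> ext_left c x i j) \<and> (\<forall>x \<in> set T. G i j \<le> ext_top c x i j) \<and>
    ((\<exists>x \<in> set L. ext_left c x i j = G i j) \<or> (\<exists>x \<in> set T. ext_top c x i j = G i j))"
proof (induction i arbitrary: j)
  case T0: 0
  have d: "c \<le> c + int j" "c + int j \<le> c + int w" using T0 by auto
  have eT: "ext_top c x 0 j = cone x (c + int j)" for x
    by (simp add: ext_top_def cone_def max_def)
  \<comment> \<open>A left cone has its plateau at or before the corner, so along the top side its
    continuation rises with slope 1 from its value at \<open>c\<close>, and by \<open>lipT\<close>
    the table rises no faster.\<close>
  have "G 0 j \<le> ext_left c x 0 j" if x: "x \<in> set L" for x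
  proof -
    have "G 0 0 \<le> cone x c" using L x unfolding represents_def by (metis diff_self nat_0 of_nat_0_le_iff order_refl diff_le_eq le_add_same_cancel1)
    moreover have "lft x \<le> c" "rgt x \<le> c" using L x by (force simp: represents_def)+
    ultimately show ?thesis using lipT[of j] by (simp add: ext_left_def cone_def lft_def rgt_def max_def split: if_splits)
  qed
  moreover have "(\<forall>x \<in> set T. G 0 j \<le> cone x (c + int j)) \<and> (\<exists>x \<in> set T. cone x (c + int j) = G 0 j)"
    using T d unfolding represents_def by (metis add_diff_cancel_left' nat_int)
  ultimately show ?case using eT by auto
next
  case (Suc i)
  note IHi = Suc.IH
  show ?case using Suc.prems
  proof (induction j)
    case 0
    have d: "c - int h \<le> c - int (Suc i)" "c - int (Suc i) \<le> c" using 0 by auto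
    have eL: "ext_left c x (Suc i) 0 = cone x (c - int (Suc i))" for x
      by (simp add: ext_left_def cone_def max_def)
    have "G (Suc i) 0 \<le> ext_top c x (Suc i) 0" if x: "x \<in> set T" for x
    proof -
      have "G 0 0 \<le> cone x c" using T x unfolding represents_def by (metis diff_self nat_0 of_nat_0_le_iff order_refl diff_le_eq le_add_same_cancel1)
      moreover have "c \<le> lft x" "c \<le> rgt x" using T x by (force simp: represents_def)+
      ultimately show ?thesis using lipL[of "Suc i"] by (simp add: ext_top_def cone_def lft_def rgt_def max_def split: if_splits)
    qed
    moreover have "(\<forall>x \<in> set L. G (Suc i) 0 \<le> cone x (c - int (Suc i))) \<and> (\<exists>x \<in> set L. cone x (c - int (Suc i)) = G (Suc i) 0)"
    proof -
      have "nat (c - (c - int (Suc i))) = Suc i" by simp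
      then show ?thesis using L d unfolding represents_def by metis
    qed
    ultimately show ?case using eL by auto
  next
    case (Suc j)
    have 1: "i \<le> h" "j \<le> w" "Suc j \<le> w" using Suc.prems by auto
    note A = IHi[OF 1(1,2)] and B = IHi[OF 1(1,3)] and C = Suc.IH[OF Suc.prems(1) 1(2)]
    have wf: "lft x \<le> rgt x" if "x \<in> set L \<or> x \<in> set T" for x using L T that by (force simp: represents_def)
    have L': "G (Suc i) (Suc j) \<le> ext_left c x (Suc i) (Suc j)" if "x \<in> set L" for x
      using A B C that step[of i j] ext_left_step[OF wf, of x c i j] by (smt (verit) min_def)
    have T': "G (Suc i) (Suc j) \<le> ext_top c x (Suc i) (Suc j)" if "x \<in> set T" for x
      using A B C that step[of i j] ext_top_step[OF wf, of x c i j] by (smt (verit) min_def)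
    \<comment> \<open>For the existence part: some predecessor attains the recurrence, and some cone
      attains the value there. By the step equation this cone grows by at most 1 up to the current
      cell, and as it is nowhere below \<open>G\<close>, equality holds.\<close>
    have "\<exists>i' j'. G (Suc i) (Suc j) = 1 + G i' j' \<and>
       ((\<exists>x \<in> set L. ext_left c x i' j' = G i' j') \<or> (\<exists>x \<in> set T. ext_top c x i' j' = G i' j')) \<and>
       (i', j') \<in> {(i, j), (i, Suc j), (Suc i, j)}"
    proof -
      consider "G (Suc i) (Suc j) = 1 + G i j" | "G (Suc i) (Suc j) = 1 + G i (Suc j)" | "G (Suc i) (Suc j) = 1 + G (Suc i) j"
        using step[of i j] by (auto simp: min_def split: if_splits)
      then show ?thesis using A B C by cases blast+
    qed
    then obtain i' j' where ij: "G (Suc i) (Suc j) = 1 + G i' j'"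
       "(\<exists>x \<in> set L. ext_left c x i' j' = G i' j') \<or> (\<exists>x \<in> set T. ext_top c x i' j' = G i' j')"
       "(i', j') \<in> {(i, j), (i, Suc j), (Suc i, j)}" by blast
    have lL: "ext_left c x (Suc i) (Suc j) \<le> 1 + ext_left c x i' j'" if "x \<in> set L" for x
      using ij(3) ext_left_step[OF wf, of x c i j] that by auto
    have lT: "ext_top c x (Suc i) (Suc j) \<le> 1 + ext_top c x i' j'" if "x \<in> set T" for x
      using ij(3) ext_top_step[OF wf, of x c i j] that by auto
    have "(\<exists>x \<in> set L. ext_left c x (Suc i) (Suc j) = G (Suc i) (Suc j)) \<or> (\<exists>x \<in> set T. ext_top c x (Suc i) (Suc j) = G (Suc i) (Suc j))"
      using ij(1,2) L' T' lL lT by (metis order_antisym)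
    then show ?case using L' T' by blast
  qed
qed

text \<open>In the row \<open>i = h\<close> the left arm of a left cone is constant, so it turns
  into the plateau and the former plateau into the right arm; the old right arm stays below that,
  since \<open>rgt x\<close> is at least \<open>c - h\<close>. A top cone has its plateau widened by
  \<open>h\<close> to the left.\<close>

lemma mismatch_bottom:
  fixes G :: "nat \<Rightarrow> nat \<Rightarrow> int"
  assumes step: "\<And>i j. G (Suc i) (Suc j) = 1 + min (G i j) (min (G i (Suc j)) (G (Suc i) j))"
    and lipL: "\<And>i. G i 0 \<le> G 0 0 + int i" and lipT: "\<And>j. G 0 j \<le> G 0 0 + int j"
    and L: "represents (c - int h) c (c - int h) c L (\<lambda>d. G (nat (c - d)) 0)"
    and T: "represents c (c + int w) c (c + int w) T (\<lambda>d. G 0 (nat (d - c)))"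
  shows "represents (c - int h) (c + int w) (c - int h) (c + int w - int h)
     (map (comp_map (left_to_bottom (c - int h))) L @ map (comp_map (top_to_bottom (int h))) T) (\<lambda>d. G h (nat (d - c + int h)))" (is "represents _ _ _ _ ?U _")
proof -
  have L1: "c - int h \<le> lft x \<and> lft x \<le> rgt x \<and> rgt x \<le> c" if "x \<in> set L" for x
    using L that by (auto simp: represents_def)
  have T1: "c \<le> lft x \<and> lft x \<le> rgt x \<and> rgt x \<le> c + int w" if "x \<in> set T" for x
    using T that by (auto simp: represents_def)
  have s4: "lft (comp_map (left_to_bottom a) x) = a" "rgt (comp_map (left_to_bottom a) x) = lft x" for x a by (simp_all add: lft_def rgt_def)
  have s1: "lft (comp_map (top_to_bottom a) x) = lft x - a" "rgt (comp_map (top_to_bottom a) x) = rgt x" for x a by (simp_all add: lft_def rgt_def)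
  have so: "sorted (map lft L)" "sorted (map rgt L)" "sorted (map lft T)" "sorted (map rgt T)"
    using L T by (auto simp: represents_def)
  have so2: "sorted (map (\<lambda>x. lft x - int h) T)" using so(3) by (simp add: sorted_wrt_map)
  have cL: "cone (comp_map (left_to_bottom (c - int h)) x) d = ext_left c x h (nat (d - c + int h))"
    if "x \<in> set L" "c - int h \<le> d" for x d
    using L1[OF that(1)] that(2) by (simp add: cone_def ext_left_def lft_def rgt_def max_def)
  have cT: "cone (comp_map (top_to_bottom (int h)) x) d = ext_top c x h (nat (d - c + int h))"
    if "c - int h \<le> d" for x d
    using that by (simp add: cone_def ext_top_def max_def)
  have *: "(\<forall>x \<in> set ?U. G h (nat (d - c + int h)) \<le> cone x d) \<and> (\<exists>x \<in> set ?U. cone x d = G h (nat (d - c + int h)))"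
    if d: "c - int h \<le> d" "d \<le> c + int w - int h" for d
  proof -
    have "nat (d - c + int h) \<le> w" using d by simp
    from mismatch_block[OF step lipL lipT L T order_refl this]
    show ?thesis using cL d(1) cT[OF d(1)] by (auto simp: bex_Un image_iff)
  qed
  have "c - int h \<le> lft x \<and> lft x \<le> c" if "x \<in> set L" for x using L1[OF that] by linarith
  moreover have "c \<le> lft x \<and> c \<le> rgt x" if "x \<in> set T" for x using T1[OF that] by linarith
  ultimately have "sorted (map lft ?U)" "sorted (map rgt ?U)"
    using so so2 by (force simp: s4 s1 sorted_append o_def map_replicate_const)+
  moreover have "\<forall>x \<in> set ?U. c - int h \<le> lft x \<and> lft x \<le> rgt x \<and> rgt x \<le> c + int w"
    using L1 T1 by (force simp: s4 s1)
  ultimately show ?thesis unfolding represents_def using * by blast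
qed

text \<open>In the last column a top cone turns its right arm into the plateau and its plateau into
  the left arm, while a left cone has its plateau widened by \<open>w\<close> to the right.\<close>

lemma mismatch_right:
  fixes G :: "nat \<Rightarrow> nat \<Rightarrow> int"
  assumes step: "\<And>i j. G (Suc i) (Suc j) = 1 + min (G i j) (min (G i (Suc j)) (G (Suc i) j))"
    and lipL: "\<And>i. G i 0 \<le> G 0 0 + int i" and lipT: "\<And>j. G 0 j \<le> G 0 0 + int j"
    and L: "represents (c - int h) c (c - int h) c L (\<lambda>d. G (nat (c - d)) 0)"
    and T: "represents c (c + int w) c (c + int w) T (\<lambda>d. G 0 (nat (d - c)))"
  shows "represents (c - int h) (c + int w) (c + int w - int h) (c + int w)
     (map (comp_map (left_to_right (int w))) L @ map (comp_map (top_to_right (c + int w))) T) (\<lambda>d. G (nat (c + int w - d)) w)" (is "represents _ _ _ _ ?U _")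
proof -
  have L1: "c - int h \<le> lft x \<and> lft x \<le> rgt x \<and> rgt x \<le> c" if "x \<in> set L" for x
    using L that by (auto simp: represents_def)
  have T1: "c \<le> lft x \<and> lft x \<le> rgt x \<and> rgt x \<le> c + int w" if "x \<in> set T" for x
    using T that by (auto simp: represents_def)
  have s3: "lft (comp_map (left_to_right a) x) = lft x" "rgt (comp_map (left_to_right a) x) = rgt x + a" for x a by (simp_all add: lft_def rgt_def)
  have s2: "lft (comp_map (top_to_right a) x) = rgt x" "rgt (comp_map (top_to_right a) x) = a" for x a by (simp_all add: lft_def rgt_def)
  have so: "sorted (map lft L)" "sorted (map rgt L)" "sorted (map lft T)" "sorted (map rgt T)"
    using L T by (auto simp: represents_def)
  have so2: "sorted (map (\<lambda>x. rgt x + int w) L)" using so(2) by (simp add: sorted_wrt_map)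
  have cL: "cone (comp_map (left_to_right (int w)) x) d = ext_left c x (nat (c + int w - d)) w"
    if "d \<le> c + int w" for x d
    using that by (simp add: cone_def ext_left_def max_def)
  have cT: "cone (comp_map (top_to_right (c + int w)) x) d = ext_top c x (nat (c + int w - d)) w"
    if "x \<in> set T" "d \<le> c + int w" for x d
    using T1[OF that(1)] that(2) by (simp add: cone_def ext_top_def lft_def rgt_def max_def)
  have *: "(\<forall>x \<in> set ?U. G (nat (c + int w - d)) w \<le> cone x d) \<and> (\<exists>x \<in> set ?U. cone x d = G (nat (c + int w - d)) w)"
    if d: "c + int w - int h \<le> d" "d \<le> c + int w" for d
  proof -
    have "nat (c + int w - d) \<le> h" using d by simp
    from mismatch_block[OF step lipL lipT L T this order_refl]
    show ?thesis using cL[OF d(2)] cT d(2) by (auto simp: bex_Un image_iff)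
  qed
  have "lft x \<le> c \<and> rgt x \<le> c" if "x \<in> set L" for x using L1[OF that] by linarith
  moreover have "c \<le> rgt x" if "x \<in> set T" for x using T1[OF that] by linarith
  ultimately have "sorted (map lft ?U)" "sorted (map rgt ?U)"
    using so so2 by (force simp: s3 s2 sorted_append o_def map_replicate_const)+
  moreover have "\<forall>x \<in> set ?U. c - int h \<le> lft x \<and> lft x \<le> rgt x \<and> rgt x \<le> c + int w"
    using L1 T1 by (force simp: s3 s2)
  ultimately show ?thesis unfolding represents_def using * by blast
qed

text \<open>Beyond \<open>c\<close> a cone of \<open>L\<close> rises with slope 1, because its
  plateau ends at or before \<open>c\<close>, and \<open>F\<close> rises no faster, so the cone
  stays above \<open>F\<close>. The cones of \<open>T\<close> behave symmetrically before
  \<open>c\<close>.\<close>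

lemma match_concat:
  fixes F :: "int \<Rightarrow> int"
  assumes L: "represents a c a c L F" and T: "represents c b c b T F"
    and lip: "\<And>d d'. a \<le> d \<Longrightarrow> d \<le> b \<Longrightarrow> a \<le> d' \<Longrightarrow> d' \<le> b \<Longrightarrow> F d \<le> F d' + \<bar>d - d'\<bar>" and "a \<le> c" "c \<le> b"
  shows "represents a b a b (L @ T) F"
proof -
  have L1: "a \<le> lft x \<and> lft x \<le> rgt x \<and> rgt x \<le> c" if "x \<in> set L" for x
    using L that by (auto simp: represents_def)
  have T1: "c \<le> lft x \<and> lft x \<le> rgt x \<and> rgt x \<le> b" if "x \<in> set T" for x
    using T that by (auto simp: represents_def)
  have so: "sorted (map lft L)" "sorted (map rgt L)" "sorted (map lft T)" "sorted (map rgt T)"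
    using L T by (auto simp: represents_def)
  have lbL: "F d \<le> cone x d" if "x \<in> set L" "a \<le> d" "d \<le> b" for x d
  proof (cases "d \<le> c")
    case False
    have "F c \<le> cone x c" using L that assms(4) by (auto simp: represents_def)
    moreover have "cone x d = cone x c + (d - c)"
      using L1[OF that(1)] False by (simp add: cone_def lft_def rgt_def max_def)
    ultimately show ?thesis using lip[of d c] that False assms(4,5) by simp
  qed (use L that in \<open>auto simp: represents_def\<close>)
  have lbT: "F d \<le> cone x d" if "x \<in> set T" "a \<le> d" "d \<le> b" for x d
  proof (cases "c \<le> d")
    case False
    have "F c \<le> cone x c" using T that assms(5) by (auto simp: represents_def)
    moreover have "cone x d = cone x c + (c - d)"
      using T1[OF that(1)] False by (simp add: cone_def lft_def rgt_def max_def)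
    ultimately show ?thesis using lip[of d c] that False assms(4,5) by simp
  qed (use T that in \<open>auto simp: represents_def\<close>)
  have "\<exists>x \<in> set (L @ T). cone x d = F d" if "a \<le> d" "d \<le> b" for d
    proof (cases "d \<le> c")
    case True
    then have "\<exists>x \<in> set L. cone x d = F d" using L that unfolding represents_def by blast
    then show ?thesis by auto
  next
    case False
    then have "\<exists>x \<in> set T. cone x d = F d" using T that unfolding represents_def by (meson linear)
    then show ?thesis by auto
  qed
  moreover have "\<forall>x \<in> set (L @ T). a \<le> lft x \<and> lft x \<le> rgt x \<and> rgt x \<le> b"
    using L1 T1 assms(4,5) by (auto intro: order_trans) 
  moreover have "lft x \<le> lft y \<and> rgt x \<le> rgt y" if "x \<in> set L" "y \<in> set T" for x y
    using L1[OF that(1)] T1[OF that(2)] by linarith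
  then have "sorted (map lft (L @ T))" "sorted (map rgt (L @ T))"
    using so by (auto simp: sorted_append)
  ultimately show ?thesis unfolding represents_def using lbL lbT by auto
qed

section \<open>A first-order language compiled to the RAM\<close>

datatype val = VI int | VP val val

datatype exp =
    Lc nat
  | Nm int
  | Rd exp
  | Hd exp
  | Tl exp
  | Pr exp exp
  | Ad exp exp
  | Sb exp exp
  | Lt exp exp
  | IfZ exp exp exp
  | IfEq exp exp exp exp
  | IfLess exp exp exp exp
  | Cl nat "exp list"

text \<open>Variables \<open>Lc i\<close> are de Bruijn levels: arguments come first, then the values bound by \<open>Lt\<close>.
  The last argument of \<open>ev\<close> bounds the number of machine steps up to a constant factor; looking up
  a variable walks down the environment.\<close>

inductive ev :: "(nat \<times> exp) list \<Rightarrow> int list \<Rightarrow> int \<Rightarrow> val list \<Rightarrow> exp \<Rightarrow> val \<Rightarrow> nat \<Rightarrow> bool"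
  and evs :: "(nat \<times> exp) list \<Rightarrow> int list \<Rightarrow> int \<Rightarrow> val list \<Rightarrow> exp list \<Rightarrow> val list \<Rightarrow> nat \<Rightarrow> bool"
  for \<Phi> :: "(nat \<times> exp) list" and inp :: "int list" and B :: int where
  "i < length env \<Longrightarrow> ev \<Phi> inp B env (Lc i) (env ! i) (1 + length env)"
| "\<bar>c\<bar> \<le> B \<Longrightarrow> ev \<Phi> inp B env (Nm c) (VI c) 1"
| "ev \<Phi> inp B env e (VI x) t \<Longrightarrow> 0 \<le> x \<Longrightarrow> nat x < length inp \<Longrightarrow>
    ev \<Phi> inp B env (Rd e) (VI (inp ! nat x)) (t + 1)"
| "ev \<Phi> inp B env e (VP a b) t \<Longrightarrow> ev \<Phi> inp B env (Hd e) a (t + 1)"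
| "ev \<Phi> inp B env e (VP a b) t \<Longrightarrow> ev \<Phi> inp B env (Tl e) b (t + 1)"
| "ev \<Phi> inp B env e1 v1 t1 \<Longrightarrow> ev \<Phi> inp B env e2 v2 t2 \<Longrightarrow>
    ev \<Phi> inp B env (Pr e1 e2) (VP v1 v2) (t1 + t2 + 1)"
| "ev \<Phi> inp B env e1 (VI x) t1 \<Longrightarrow> ev \<Phi> inp B env e2 (VI y) t2 \<Longrightarrow> \<bar>x + y\<bar> \<le> B \<Longrightarrow>
    ev \<Phi> inp B env (Ad e1 e2) (VI (x + y)) (t1 + t2 + 1)"
| "ev \<Phi> inp B env e1 (VI x) t1 \<Longrightarrow> ev \<Phi> inp B env e2 (VI y) t2 \<Longrightarrow> \<bar>x - y\<bar> \<le> B \<Longrightarrow>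
    ev \<Phi> inp B env (Sb e1 e2) (VI (x - y)) (t1 + t2 + 1)"
| "ev \<Phi> inp B env e1 v1 t1 \<Longrightarrow> ev \<Phi> inp B (env @ [v1]) e2 v2 t2 \<Longrightarrow>
    ev \<Phi> inp B env (Lt e1 e2) v2 (t1 + t2 + 1)"
| "ev \<Phi> inp B env e v t \<Longrightarrow> ev \<Phi> inp B env (if v = VI 0 then e1 else e2) w s \<Longrightarrow>
    ev \<Phi> inp B env (IfZ e e1 e2) w (t + s + 1)"
| "ev \<Phi> inp B env a (VI x) t1 \<Longrightarrow> ev \<Phi> inp B env b (VI y) t2 \<Longrightarrow>
    ev \<Phi> inp B env (if x = y then e1 else e2) w s \<Longrightarrow>
    ev \<Phi> inp B env (IfEq a b e1 e2) w (t1 + t2 + s + 1)"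
| "ev \<Phi> inp B env a (VI x) t1 \<Longrightarrow> ev \<Phi> inp B env b (VI y) t2 \<Longrightarrow>
    ev \<Phi> inp B env (if x < y then e1 else e2) w s \<Longrightarrow>
    ev \<Phi> inp B env (IfLess a b e1 e2) w (t1 + t2 + s + 1)"
| "evs \<Phi> inp B env es vs t \<Longrightarrow> f < length \<Phi> \<Longrightarrow> fst (\<Phi> ! f) = length vs \<Longrightarrow>
    ev \<Phi> inp B vs (snd (\<Phi> ! f)) v s \<Longrightarrow> ev \<Phi> inp B env (Cl f es) v (t + s + 1)"
| "evs \<Phi> inp B env [] [] 0"
| "ev \<Phi> inp B env e v t \<Longrightarrow> evs \<Phi> inp B env es vs s \<Longrightarrow>
    evs \<Phi> inp B env (e # es) (v # vs) (t + s + 1)"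

text \<open>Registers of compiled code: 0 holds values, 1 the environment and 2 the continuation (linked
  lists), 3 the end of the heap, 5 and 6 the constants 0 and 1; 4 and 7 are scratch registers.\<close>

definition ccons :: "reg \<Rightarrow> reg \<Rightarrow> reg \<Rightarrow> instr list" where
  "ccons d a b = [Store 3 a, Arith Plus 4 3 6, Store 4 b, Copy d 3, Arith Plus 3 4 6]"

definition cpop :: "reg \<Rightarrow> instr list" where
  "cpop r = [Load r 2, Arith Plus 4 2 6, Load 2 4]"

fun cwalk :: "nat \<Rightarrow> instr list" where
  "cwalk 0 = [Load 0 4]"
| "cwalk (Suc k) = Arith Plus 4 4 6 # Load 4 4 # cwalk k"

text \<open>Moving the arguments reverses them: the last one ends at the head of the new
  environment, in the place where \<open>Lt\<close> would put the most recent value.\<close>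

fun cargs :: "nat \<Rightarrow> instr list" where
  "cargs 0 = []"
| "cargs (Suc k) = cpop 0 @ ccons 1 0 1 @ cargs k"

text \<open>Jumps are absolute, so \<open>p\<close> is the address where the code will stand and
  \<open>adr\<close> gives the addresses of the functions; \<open>d\<close> is the length of the
  environment, which turns a level into a number of links to follow. Arguments are evaluated last to
  first, so that the first one ends on top of the continuation.\<close>

fun comp_exp :: "(nat \<Rightarrow> nat) \<Rightarrow> nat \<Rightarrow> nat \<Rightarrow> exp \<Rightarrow> instr list"
  and comp_exps :: "(nat \<Rightarrow> nat) \<Rightarrow> nat \<Rightarrow> nat \<Rightarrow> exp list \<Rightarrow> instr list" where
  "comp_exp adr p d (Lc i) = Copy 4 1 # cwalk (d - 1 - i)"
| "comp_exp adr p d (Nm c) = [Const 0 c]"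
| "comp_exp adr p d (Rd e) = comp_exp adr p d e @ [Load 0 0]"
| "comp_exp adr p d (Hd e) = comp_exp adr p d e @ [Load 0 0]"
| "comp_exp adr p d (Tl e) = comp_exp adr p d e @ [Arith Plus 0 0 6, Load 0 0]"
| "comp_exp adr p d (Pr e1 e2) =
    (let c1 = comp_exp adr p d e1 @ ccons 2 0 2; c2 = comp_exp adr (p + length c1) d e2
     in c1 @ c2 @ cpop 7 @ ccons 0 7 0)"
| "comp_exp adr p d (Ad e1 e2) =
    (let c1 = comp_exp adr p d e1 @ ccons 2 0 2; c2 = comp_exp adr (p + length c1) d e2
     in c1 @ c2 @ cpop 7 @ [Arith Plus 0 7 0])"
| "comp_exp adr p d (Sb e1 e2) =
    (let c1 = comp_exp adr p d e1 @ ccons 2 0 2; c2 = comp_exp adr (p + length c1) d e2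
     in c1 @ c2 @ cpop 7 @ [Arith Minus 0 7 0])"
| "comp_exp adr p d (Lt e1 e2) =
    (let c1 = comp_exp adr p d e1 @ ccons 1 0 1; c2 = comp_exp adr (p + length c1) (Suc d) e2
     in c1 @ c2 @ [Arith Plus 4 1 6, Load 1 4])"
| "comp_exp adr p d (IfZ e e1 e2) =
    (let c0 = comp_exp adr p d e; c2 = comp_exp adr (p + length c0 + 1) d e2;
         l = p + length c0 + 1 + length c2 + 1; c1 = comp_exp adr l d e1
     in c0 @ [JumpEq 0 5 l] @ c2 @ [Jump (l + length c1)] @ c1)"
| "comp_exp adr p d (IfEq a b e1 e2) =
    (let ca = comp_exp adr p d a @ ccons 2 0 2; c0 = ca @ comp_exp adr (p + length ca) d b @ cpop 7;
         c2 = comp_exp adr (p + length c0 + 1) d e2;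
         l = p + length c0 + 1 + length c2 + 1; c1 = comp_exp adr l d e1
     in c0 @ [JumpEq 7 0 l] @ c2 @ [Jump (l + length c1)] @ c1)"
| "comp_exp adr p d (IfLess a b e1 e2) =
    (let ca = comp_exp adr p d a @ ccons 2 0 2; c0 = ca @ comp_exp adr (p + length ca) d b @ cpop 7;
         c2 = comp_exp adr (p + length c0 + 1) d e2;
         l = p + length c0 + 1 + length c2 + 1; c1 = comp_exp adr l d e1
     in c0 @ [JumpLess 7 0 l] @ c2 @ [Jump (l + length c1)] @ c1)"
| "comp_exp adr p d (Cl f es) =
    (let c0 = ccons 2 1 2 @ comp_exps adr (p + 5) d es @ [Const 1 0] @ cargs (length es);
         ret = p + length c0 + 7
     in c0 @ [Const 7 (int ret)] @ ccons 2 7 2 @ [Jump (adr f)] @ cpop 1)"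
| "comp_exps adr p d [] = []"
| "comp_exps adr p d (e # es) =
    (let c0 = comp_exps adr p d es in c0 @ comp_exp adr (p + length c0) d e @ ccons 2 0 2)"

text \<open>The machine cannot jump to an address held in a register. A return therefore compares
  register 7 with every address below the dispatcher, which takes constant time for a fixed
  program.\<close>

fun cdisp :: "nat \<Rightarrow> instr list" where
  "cdisp 0 = []"
| "cdisp (Suc k) = [Const 4 (int k), JumpEq 7 4 k] @ cdisp k"

section \<open>Representation of values in memory and execution of code fragments\<close>

definition code_at :: "program \<Rightarrow> nat \<Rightarrow> instr list \<Rightarrow> bool" where
  "code_at P p cs \<longleftrightarrow> (\<forall>i < length cs. p + i < length P \<and> P ! (p + i) = cs ! i)"

lemma code_at_Nil [simp]: "code_at P p []"
  by (simp add: code_at_def)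

lemma code_at_Cons: "code_at P p (i # is) \<longleftrightarrow> p < length P \<and> P ! p = i \<and> code_at P (Suc p) is"
  by (auto simp: code_at_def All_less_Suc2)

lemma code_at_append:
  "code_at P p (a @ b) \<longleftrightarrow> code_at P p a \<and> code_at P (p + length a) b"
  by (induction a arbitrary: p) (auto simp: code_at_Cons)

lemma length_ccons [simp]: "length (ccons d a b) = 5" and length_cpop [simp]: "length (cpop r) = 3"
  by (simp_all add: ccons_def cpop_def)

text \<open>Cells below \<open>lo\<close> are reserved for the input, the heap lies from
  \<open>lo\<close> on. As \<open>lo\<close> is positive, no pair has address 0, so a comparison
  with 0 tells \<open>VI 0\<close> from every pair.\<close>

locale heap =
  fixes W :: int and P :: program and lo :: int
  assumes lo_pos: "0 < lo"
begin

fun vrep :: "int \<Rightarrow> (nat \<Rightarrow> word) \<Rightarrow> word \<Rightarrow> val \<Rightarrow> bool" where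
  "vrep hp m w (VI i) \<longleftrightarrow> w = i \<and> \<bar>i\<bar> \<le> W"
| "vrep hp m w (VP a b) \<longleftrightarrow> lo \<le> w \<and> w + 1 < hp \<and> vrep hp m (m (nat w)) a \<and> vrep hp m (m (nat (w + 1))) b"

text \<open>The segment ends at a given pointer \<open>k\<close> rather than at a null pointer, so
  that it can describe the top part of a continuation whose rest belongs to the caller.\<close>

fun lrep :: "int \<Rightarrow> (nat \<Rightarrow> word) \<Rightarrow> word \<Rightarrow> word \<Rightarrow> val list \<Rightarrow> bool" where
  "lrep hp m k w [] \<longleftrightarrow> w = k"
| "lrep hp m k w (v # vs) \<longleftrightarrow>
    lo \<le> w \<and> w + 1 < hp \<and> vrep hp m (m (nat w)) v \<and> lrep hp m k (m (nat (w + 1))) vs"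

abbreviation vr :: "config \<Rightarrow> word \<Rightarrow> val \<Rightarrow> bool" where
  "vr c \<equiv> vrep (regs c 3) (mem c)"

abbreviation lr :: "config \<Rightarrow> word \<Rightarrow> word \<Rightarrow> val list \<Rightarrow> bool" where
  "lr c \<equiv> lrep (regs c 3) (mem c)"

definition same :: "int \<Rightarrow> (nat \<Rightarrow> word) \<Rightarrow> (nat \<Rightarrow> word) \<Rightarrow> bool" where
  "same hp m m' \<longleftrightarrow> (\<forall>a. int a < hp \<longrightarrow> m' a = m a)"

lemma same_refl [simp]: "same hp m m" by (simp add: same_def)

lemma same_trans: "same hp m m' \<Longrightarrow> same hp' m' m'' \<Longrightarrow> hp \<le> hp' \<Longrightarrow> same hp m m''"
  by (simp add: same_def)

lemma vrep_mono:
  assumes "vrep hp m w v" "same hp m m'" "hp \<le> hp'"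
  shows "vrep hp' m' w v"
  using assms
proof (induction v arbitrary: w)
  case (VP a b)
  then have "m' (nat w) = m (nat w)" "m' (nat (w + 1)) = m (nat (w + 1))"
    using lo_pos by (auto simp: same_def)
  then show ?case using VP by auto
qed auto

lemma lrep_mono:
  assumes "lrep hp m k w vs" "same hp m m'" "hp \<le> hp'"
  shows "lrep hp' m' k w vs"
  using assms
proof (induction vs arbitrary: w)
  case (Cons v vs)
  then have "m' (nat w) = m (nat w)" "m' (nat (w + 1)) = m (nat (w + 1))"
    using lo_pos by (auto simp: same_def)
  then show ?case using Cons by (auto intro: vrep_mono)
qed auto

lemma vrep_bound: "vrep hp m w v \<Longrightarrow> hp \<le> W \<Longrightarrow> \<bar>w\<bar> \<le> W"
  using lo_pos by (cases v) auto

lemma lrep_bound: "lrep hp m k w vs \<Longrightarrow> hp \<le> W \<Longrightarrow> \<bar>k\<bar> \<le> W \<Longrightarrow> \<bar>w\<bar> \<le> W"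
  using lo_pos by (cases vs) auto

lemma vrep_zero: "vrep hp m w v \<Longrightarrow> w = 0 \<longleftrightarrow> v = VI 0"
  using lo_pos by (cases v) auto

definition exec :: "nat \<Rightarrow> config \<Rightarrow> config \<Rightarrow> bool" where
  "exec n c c' \<longleftrightarrow> (step W P ^^ n) c c'"

lemma exec_0 [simp]: "exec 0 c c' \<longleftrightarrow> c = c'" by (auto simp: exec_def)

lemma exec_trans: "exec n c c' \<Longrightarrow> exec k c' c'' \<Longrightarrow> exec (n + k) c c''"
  unfolding exec_def by (auto simp: relpowp_add)

lemma exec_Suc:
  "exec (Suc n) c c'' \<longleftrightarrow>
    pc c < length P \<and> (\<exists>c'. exec_instr W (P ! pc c) c = Some c' \<and> exec n c' c'')"
  unfolding exec_def relpowp_Suc_left by (auto simp: step_def)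

text \<open>\<open>g\<close> bounds the growth of the heap. Cells below its old end keep their
  contents, which is why every value represented before remains represented.\<close>

definition pres :: "config \<Rightarrow> config \<Rightarrow> nat \<Rightarrow> bool" where
  "pres c c' g \<longleftrightarrow> regs c' 5 = regs c 5 \<and> regs c' 6 = regs c 6 \<and>
     regs c 3 \<le> regs c' 3 \<and> regs c' 3 \<le> regs c 3 + int g \<and> same (regs c 3) (mem c) (mem c')"

lemma pres_trans: "pres c c' g \<Longrightarrow> pres c' c'' g' \<Longrightarrow> pres c c'' (g + g')"
  unfolding pres_def by (auto intro: same_trans)

lemma pres_mono: "pres c c' g \<Longrightarrow> g \<le> g' \<Longrightarrow> pres c c' g'"
  unfolding pres_def by auto

definition ok :: "config \<Rightarrow> bool" where
  "ok c \<longleftrightarrow> regs c 5 = 0 \<and> regs c 6 = 1 \<and> lo \<le> regs c 3 \<and> \<bar>regs c 1\<bar> \<le> W \<and> \<bar>regs c 2\<bar> \<le> W"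

lemma exec_ccons:
  assumes code: "code_at P (pc c) (ccons d a b)" and ok: "ok c" and hp: "regs c 3 + 2 \<le> W"
    and reg: "d \<notin> {3, 4, 5, 6}" "a \<noteq> 4" "b \<noteq> 4"
  obtains c' where "exec 5 c c'" "pc c' = pc c + 5" "pres c c' 2" "regs c' d = regs c 3"
    "regs c' 3 = regs c 3 + 2" "\<And>r. r \<notin> {d, 3, 4} \<Longrightarrow> regs c' r = regs c r"
    "mem c' (nat (regs c 3)) = regs c a" "mem c' (nat (regs c 3 + 1)) = regs c b"
proof -
  define h where "h = regs c 3"
  have h: "0 < h" "h + 2 \<le> W" "regs c 6 = 1" using ok hp lo_pos by (auto simp: h_def ok_def)
  define c' where "c' = c\<lparr>mem := (mem c)(nat h := regs c a, nat (h + 1) := regs c b),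
      regs := (regs c)(4 := h + 1, d := h, 3 := 2 + h), pc := Suc (Suc (Suc (Suc (Suc (pc c)))))\<rparr>"
  have code': "pc c < length P" "P ! pc c = Store 3 a"
    "Suc (pc c) < length P" "P ! Suc (pc c) = Arith Plus 4 3 6"
    "Suc (Suc (pc c)) < length P" "P ! Suc (Suc (pc c)) = Store 4 b"
    "Suc (Suc (Suc (pc c))) < length P" "P ! Suc (Suc (Suc (pc c))) = Copy d 3"
    "Suc (Suc (Suc (Suc (pc c)))) < length P" "P ! Suc (Suc (Suc (Suc (pc c)))) = Arith Plus 3 4 6"
    using code by (auto simp: ccons_def code_at_Cons)
  have "exec (Suc (Suc (Suc (Suc (Suc 0))))) c c'"
    using h reg by (simp add: exec_Suc code' set_reg_def advance_def goto_def h_def[symmetric] c'_def)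
  then have "exec 5 c c'" by (simp add: numeral_eq_Suc)
  moreover have "pres c c' 2"
    using h reg by (auto simp: pres_def c'_def h_def[symmetric] same_def)
  ultimately show ?thesis using h reg by (intro that[of c']) (auto simp: c'_def h_def[symmetric])
qed

lemma exec_cpop:
  assumes code: "code_at P (pc c) (cpop r)" and ok: "ok c"
    and b: "lo \<le> regs c 2" "regs c 2 + 1 < regs c 3" "regs c 3 \<le> W"
      "\<bar>mem c (nat (regs c 2))\<bar> \<le> W" "\<bar>mem c (nat (regs c 2 + 1))\<bar> \<le> W"
    and reg: "r \<notin> {2, 3, 4, 5, 6}"
  obtains c' where "exec 3 c c'" "pc c' = pc c + 3" "pres c c' 0" "regs c' r = mem c (nat (regs c 2))"
    "regs c' 2 = mem c (nat (regs c 2 + 1))" "\<And>q. q \<notin> {r, 2, 4} \<Longrightarrow> regs c' q = regs c q" "mem c' = mem c"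
proof -
  define h where "h = regs c 2"
  have h: "0 < h" "h + 1 \<le> W" "regs c 6 = 1" using ok b lo_pos by (auto simp: h_def ok_def)
  define c' where "c' = c\<lparr>pc := pc c + 3, regs := (regs c)(r := mem c (nat h), 4 := h + 1, 2 := mem c (nat (h + 1)))\<rparr>"
  have code': "pc c < length P" "P ! pc c = Load r 2"
    "Suc (pc c) < length P" "P ! Suc (pc c) = Arith Plus 4 2 6"
    "Suc (Suc (pc c)) < length P" "P ! Suc (Suc (pc c)) = Load 2 4"
    using code by (auto simp: cpop_def code_at_Cons)
  have "exec (Suc (Suc (Suc 0))) c c'"
    using h reg b by (simp add: exec_Suc code' set_reg_def advance_def goto_def h_def[symmetric] c'_def)
  then have "exec 3 c c'" by (simp add: numeral_eq_Suc)
  moreover have "pres c c' 0"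
    using h reg by (auto simp: pres_def c'_def h_def[symmetric] same_def)
  ultimately show ?thesis using h reg by (intro that[of c']) (auto simp: c'_def h_def[symmetric])
qed

lemma exec_cwalk:
  assumes "code_at P (pc c) (cwalk k)" "ok c" "regs c 3 \<le> W" "\<bar>z\<bar> \<le> W"
    "lr c z (regs c 4) vs" "k < length vs"
  shows "\<exists>c'. exec (2 * k + 1) c c' \<and> pc c' = pc c + 2 * k + 1 \<and> pres c c' 0 \<and> mem c' = mem c \<and>
    (\<forall>r. r \<notin> {0, 4} \<longrightarrow> regs c' r = regs c r) \<and> vr c' (regs c' 0) (vs ! k)"
  using assms
proof (induction k arbitrary: c vs)
  case 0
  then obtain v vs' where vs: "vs = v # vs'" by (cases vs) auto
  define w where "w = regs c 4"
  have w: "lo \<le> w" "w + 1 < regs c 3" "vr c (mem c (nat w)) v" using 0 vs by (auto simp: w_def)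
  then have "\<bar>mem c (nat w)\<bar> \<le> W" using 0 vrep_bound by blast
  then have "exec (Suc 0) c (c\<lparr>pc := pc c + 1, regs := (regs c)(0 := mem c (nat w))\<rparr>)"
    using 0 w lo_pos by (simp add: exec_Suc code_at_Cons set_reg_def advance_def goto_def w_def[symmetric])
  then show ?case using w vs
    by (intro exI[of _ "c\<lparr>pc := pc c + 1, regs := (regs c)(0 := mem c (nat w))\<rparr>"]) (auto simp: pres_def)
next
  case (Suc k)
  then obtain v vs' where vs: "vs = v # vs'" by (cases vs) auto
  define w where "w = regs c 4"
  define u where "u = mem c (nat (w + 1))"
  have w: "lo \<le> w" "w + 1 < regs c 3" "lr c z u vs'" using Suc vs by (auto simp: w_def u_def)
  have u: "\<bar>u\<bar> \<le> W" using lrep_bound[OF w(3) Suc.prems(3,4)] .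
  define c1 where "c1 = c\<lparr>pc := pc c + 2, regs := (regs c)(4 := u)\<rparr>"
  have "exec (Suc (Suc 0)) c c1"
    using Suc.prems w lo_pos u
    by (simp add: exec_Suc code_at_Cons set_reg_def advance_def goto_def w_def[symmetric] c1_def u_def[symmetric] ok_def)
  moreover have "ok c1" using Suc.prems u by (auto simp: ok_def c1_def)
  moreover have "\<exists>c'. exec (2 * k + 1) c1 c' \<and> pc c' = pc c1 + 2 * k + 1 \<and> pres c1 c' 0 \<and> mem c' = mem c1 \<and>
    (\<forall>r. r \<notin> {0, 4} \<longrightarrow> regs c' r = regs c1 r) \<and> vr c' (regs c' 0) (vs' ! k)"
    by (rule Suc.IH) (use Suc.prems w vs \<open>ok c1\<close> in \<open>auto simp: c1_def code_at_Cons\<close>)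
  ultimately obtain c' where c': "exec (Suc (Suc 0)) c c1" "exec (2 * k + 1) c1 c'" "pc c' = pc c1 + 2 * k + 1" "pres c1 c' 0"
    "mem c' = mem c1" "\<forall>r. r \<notin> {0, 4} \<longrightarrow> regs c' r = regs c1 r" "vr c' (regs c' 0) (vs' ! k)" by blast
  have "exec (2 * Suc k + 1) c c'" using exec_trans[OF c'(1,2)] by simp
  then show ?case using c' vs by (intro exI[of _ c']) (auto simp: c1_def pres_def)
qed

definition res :: "config \<Rightarrow> config \<Rightarrow> nat \<Rightarrow> bool" where
  "res c c' g \<longleftrightarrow> pres c c' g \<and> regs c' 1 = regs c 1 \<and> regs c' 2 = regs c 2"

lemma res_ok: "res c c' g \<Longrightarrow> ok c \<Longrightarrow> ok c'"
  by (auto simp: res_def pres_def ok_def)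

lemma pres_lrep: "pres c c' g \<Longrightarrow> lr c k w vs \<Longrightarrow> lr c' k w vs"
  by (auto simp: pres_def intro: lrep_mono)

lemma pres_vrep: "pres c c' g \<Longrightarrow> vr c w v \<Longrightarrow> vr c' w v"
  by (auto simp: pres_def intro: vrep_mono)

lemma pres_hp: "pres c c' g \<Longrightarrow> regs c 3 \<le> regs c' 3 \<and> regs c' 3 \<le> regs c 3 + int g"
  by (auto simp: pres_def)

end

text \<open>\<open>C\<close> is charged per unit of cost in \<open>ev\<close>, both in steps and in
  heap cells. A return may take \<open>2 * disp\<close> steps in the dispatcher, and 40 covers the
  fixed instructions around any construct. All code of expressions lies below \<open>disp\<close>,
  so every return address is among those that the dispatcher tries.\<close>

locale compiled = heap +
  fixes \<Phi> :: "(nat \<times> exp) list" and inp :: "int list" and adr :: "nat \<Rightarrow> nat" and disp :: nat and C :: nat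
  assumes bodies: "\<And>f. f < length \<Phi> \<Longrightarrow>
      code_at P (adr f) (comp_exp adr (adr f) (fst (\<Phi> ! f)) (snd (\<Phi> ! f)) @ [Jump disp])"
    and bodies_disp: "\<And>f. f < length \<Phi> \<Longrightarrow> adr f + length (comp_exp adr (adr f) (fst (\<Phi> ! f)) (snd (\<Phi> ! f))) \<le> disp"
    and dispatch: "code_at P disp (cpop 7 @ cdisp disp)"
    and PW: "int disp \<le> W"
    and inp: "int (length inp) \<le> lo" "\<And>x. x \<in> set inp \<Longrightarrow> \<bar>x\<bar> \<le> W"
    and C: "2 * disp + 40 \<le> C"
begin

definition inpok :: "config \<Rightarrow> bool" where
  "inpok c \<longleftrightarrow> (\<forall>i < length inp. mem c i = inp ! i)"

lemma inpok_pres: "pres c c' g \<Longrightarrow> ok c \<Longrightarrow> inpok c \<Longrightarrow> inpok c'"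
  using inp(1) by (auto simp: inpok_def pres_def same_def ok_def)

abbreviation ce :: "val list \<Rightarrow> nat \<Rightarrow> exp \<Rightarrow> instr list" where
  "ce env p \<equiv> comp_exp adr p (length env)"

abbreviation ces :: "val list \<Rightarrow> nat \<Rightarrow> exp list \<Rightarrow> instr list" where
  "ces env p \<equiv> comp_exps adr p (length env)"

abbreviation reach :: "config \<Rightarrow> instr list \<Rightarrow> val \<Rightarrow> nat \<Rightarrow> bool" where
  "reach c is v t \<equiv> \<exists>n c'. n \<le> C * t \<and> exec n c c' \<and> pc c' = pc c + length is \<and>
     res c c' (C * t) \<and> vr c' (regs c' 0) v"

definition start :: "config \<Rightarrow> word \<Rightarrow> val list \<Rightarrow> instr list \<Rightarrow> nat \<Rightarrow> bool" where
  "start c z env is t \<longleftrightarrow> code_at P (pc c) is \<and> pc c + length is \<le> disp \<and> ok c \<and> inpok c \<and>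
     regs c 3 + int (C * t) \<le> W \<and> \<bar>z\<bar> \<le> W \<and> lr c z (regs c 1) (rev env)"

lemma startD:
  assumes "start c z env is t"
  shows "code_at P (pc c) is" "pc c + length is \<le> disp" "ok c" "inpok c" "regs c 3 + int (C * t) \<le> W"
    "\<bar>z\<bar> \<le> W" "lr c z (regs c 1) (rev env)"
  using assms by (simp_all add: start_def)

definition good :: "val list \<Rightarrow> exp \<Rightarrow> val \<Rightarrow> nat \<Rightarrow> bool" where
  "good env e v t \<longleftrightarrow> (\<forall>c z. start c z env (ce env (pc c) e) t \<longrightarrow> reach c (ce env (pc c) e) v t)"

lemma goodI: "(\<And>c z. start c z env (ce env (pc c) e) t \<Longrightarrow> reach c (ce env (pc c) e) v t) \<Longrightarrow> good env e v t"
  by (simp add: good_def)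

text \<open>A reserve of 8 per argument is set aside in time and space. It pays for
  \<open>cargs\<close>, which later moves the arguments into the new environment and whose length
  depends on their number.\<close>

definition goods :: "val list \<Rightarrow> exp list \<Rightarrow> val list \<Rightarrow> nat \<Rightarrow> bool" where
  "goods env es vs t \<longleftrightarrow> length es = length vs \<and> (\<forall>c z. code_at P (pc c) (ces env (pc c) es) \<longrightarrow>
     pc c + length (ces env (pc c) es) \<le> disp \<longrightarrow> ok c \<longrightarrow> inpok c \<longrightarrow>
     regs c 3 + int (C * t) \<le> W \<longrightarrow> \<bar>z\<bar> \<le> W \<longrightarrow> lr c z (regs c 1) (rev env) \<longrightarrow>
     (\<exists>n c'. n + 8 * length es \<le> C * t \<and> exec n c c' \<and> pc c' = pc c + length (ces env (pc c) es) \<and>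
        pres c c' (C * t - 8 * length es) \<and> regs c' 1 = regs c 1 \<and>
        lr c' (regs c 2) (regs c' 2) vs))"

lemma goodD:
  assumes "good env e v t" "code_at P (pc c) (ce env (pc c) e)"
     "pc c + length (ce env (pc c) e) \<le> disp" "ok c" "inpok c"
     "regs c 3 + int (C * t) \<le> W" "\<bar>z\<bar> \<le> W" "lr c z (regs c 1) (rev env)"
   obtains n c' where "n \<le> C * t" "exec n c c'" "pc c' = pc c + length (ce env (pc c) e)"
        "res c c' (C * t)" "vr c' (regs c' 0) v"
  using assms unfolding good_def start_def by blast

lemma goodsD:
  assumes "goods env es vs t" "code_at P (pc c) (ces env (pc c) es)"
     "pc c + length (ces env (pc c) es) \<le> disp" "ok c" "inpok c"
     "regs c 3 + int (C * t) \<le> W" "\<bar>z\<bar> \<le> W" "lr c z (regs c 1) (rev env)"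
   obtains n c' where "n + 8 * length es \<le> C * t" "exec n c c'" "pc c' = pc c + length (ces env (pc c) es)"
        "pres c c' (C * t - 8 * length es)" "regs c' 1 = regs c 1" "lr c' (regs c 2) (regs c' 2) vs"
  using assms unfolding goods_def by blast

text \<open>Shared by all constructs that evaluate two operands to combine or compare them: the
  first result waits on the continuation while the second is computed and is then popped into
  register 7.\<close>

lemma binary:
  assumes a: "good env e1 v1 t1" and b: "good env e2 v2 t2"
    and c1: "c1 = ce env (pc c) e1 @ ccons 2 0 2"
    and c2: "c2 = ce env (pc c + length c1) e2"
    and code: "code_at P (pc c) (c1 @ c2 @ cpop 7)" and disp: "pc c + length c1 + length c2 \<le> disp"
    and ok: "ok c" "inpok c" and hp: "regs c 3 + int (C * (t1 + t2) + 2) \<le> W"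
    and env: "\<bar>z\<bar> \<le> W" "lr c z (regs c 1) (rev env)"
  obtains n c' where "n \<le> C * (t1 + t2) + 8" "exec n c c'" "pc c' = pc c + length c1 + length c2 + 3"
    "res c c' (C * (t1 + t2) + 2)" "vr c' (regs c' 7) v1" "vr c' (regs c' 0) v2"
proof -
  have hp1: "regs c 3 + int (C * t1) \<le> W" using hp by (simp add: distrib_left del: of_nat_mult)
  obtain n1 d1 where d1: "n1 \<le> C * t1" "exec n1 c d1" "pc d1 = pc c + length (ce env (pc c) e1)"
    "res c d1 (C * t1)" "vr d1 (regs d1 0) v1"
    using goodD[OF a _ _ ok hp1 env] code disp by (auto simp: c1 code_at_append)
  have ok1: "ok d1" "inpok d1" using res_ok inpok_pres d1 ok by (auto simp: res_def)
  have hd1: "regs c 3 \<le> regs d1 3" "regs d1 3 \<le> regs c 3 + int (C * t1)" using pres_hp[of c d1] d1(4) by (force simp: res_def)+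
  have hp2: "regs d1 3 + 2 \<le> W" using hd1 hp by (simp add: distrib_left del: of_nat_mult)
  have code1: "code_at P (pc d1) (ccons 2 0 2)" using code d1(3) by (simp add: c1 code_at_append)
  obtain d2 where d2: "exec 5 d1 d2" "pc d2 = pc d1 + 5" "pres d1 d2 2" "regs d2 2 = regs d1 3"
    "regs d2 3 = regs d1 3 + 2" "\<And>r. r \<notin> {2, 3, 4} \<Longrightarrow> regs d2 r = regs d1 r"
    "mem d2 (nat (regs d1 3)) = regs d1 0" "mem d2 (nat (regs d1 3 + 1)) = regs d1 2"
    using exec_ccons[OF code1 ok1(1) hp2] by auto
  have hW: "0 < regs d1 3" using hd1 ok lo_pos by (auto simp: ok_def)
  have ok2: "ok d2" using ok1 d2 hp2 hW by (auto simp: ok_def)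
  have in2: "inpok d2" using inpok_pres d2(3) ok1 by blast
  have pc2: "pc d2 = pc c + length c1" using d1(3) d2(2) by (simp add: c1)
  have hp3: "regs d2 3 + int (C * t2) \<le> W" using hd1 d2(5) hp by (simp add: distrib_left del: of_nat_mult)
  have env1: "lr d1 z (regs d1 1) (rev env)"
    using d1(4) env pres_lrep by (auto simp: res_def)
  have env2: "lr d2 z (regs d2 1) (rev env)"
    using pres_lrep[OF d2(3) env1] d2(6)[of 1] by simp
  obtain n2 d3 where d3: "n2 \<le> C * t2" "exec n2 d2 d3" "pc d3 = pc d2 + length c2"
    "res d2 d3 (C * t2)" "vr d3 (regs d3 0) v2"
    using goodD[OF b _ _ ok2 in2 hp3 env(1) env2] code disp by (auto simp: pc2 c2 code_at_append)
  have ok3: "ok d3" using res_ok d3(4) ok2 by blast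
  have hd3: "regs d2 3 \<le> regs d3 3" "regs d3 3 \<le> regs d2 3 + int (C * t2)" "same (regs d2 3) (mem d2) (mem d3)"
    using d3(4) by (auto simp: res_def pres_def)
  have m3: "mem d3 (nat (regs d1 3)) = regs d1 0" "mem d3 (nat (regs d1 3 + 1)) = regs d1 2"
    using hd3(3) d2 hW by (auto simp: same_def)
  have r32: "regs d3 2 = regs d1 3" using d3(4) d2 by (auto simp: res_def)
  have v1W: "\<bar>regs d1 0\<bar> \<le> W" using vrep_bound[OF d1(5)] hp2 by simp
  have k1: "regs d1 2 = regs c 2" "\<bar>regs c 2\<bar> \<le> W" using d1(4) ok by (auto simp: res_def ok_def)
  have code3: "code_at P (pc d3) (cpop 7)" using code d3(3) pc2 by (simp add: code_at_append add.assoc)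
  obtain d4 where d4: "exec 3 d3 d4" "pc d4 = pc d3 + 3" "pres d3 d4 0" "regs d4 7 = mem d3 (nat (regs d3 2))"
    "regs d4 2 = mem d3 (nat (regs d3 2 + 1))" "\<And>q. q \<notin> {7, 2, 4} \<Longrightarrow> regs d4 q = regs d3 q" "mem d4 = mem d3"
    using exec_cpop[OF code3 ok3] m3 r32 v1W k1 hd3 hd1 d2(5) ok hp3 by (auto simp: ok_def)
  have p2: "pres c d2 (C * t1 + 2)" using pres_trans[OF _ d2(3)] d1(4) by (auto simp: res_def)
  have p3: "pres c d3 (C * t1 + 2 + C * t2)" using pres_trans[OF p2] d3(4) by (auto simp: res_def)
  have p4: "pres c d4 (C * (t1 + t2) + 2)" using pres_trans[OF p3 d4(3)] by (simp add: algebra_simps)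
  have "exec (n1 + 5 + n2 + 3) c d4" using d1(2) d2(1) d3(2) d4(1) exec_trans by blast
  moreover have "n1 + 5 + n2 + 3 \<le> C * (t1 + t2) + 8" using d1(1) d3(1) by (simp add: distrib_left del: of_nat_mult)
  moreover have "res c d4 (C * (t1 + t2) + 2)"
    using p4 d4 m3 r32 k1 d3(4) d2(6)[of 1] d1(4) by (simp add: res_def)
  moreover have "vr d4 (regs d4 7) v1"
    using d4 m3 r32 pres_vrep[OF _ d1(5)] pres_trans[OF d2(3) pres_trans[OF _ d4(3)]] d3(4) by (metis res_def)
  moreover have "vr d4 (regs d4 0) v2" using d4 d3(5) by simp
  moreover have "pc d4 = pc c + length c1 + length c2 + 3" using d4(2) d3(3) pc2 by simp
  ultimately show ?thesis using that by blast
qed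

lemma exec_cargs:
  assumes "code_at P (pc c) (cargs (length vs))" "ok c" "regs c 3 + 2 * int (length vs) \<le> W"
    "lr c k (regs c 2) vs" "\<bar>k\<bar> \<le> W" "lr c 0 (regs c 1) us"
  shows "\<exists>c'. exec (8 * length vs) c c' \<and> pc c' = pc c + 8 * length vs \<and> pres c c' (2 * length vs) \<and>
    regs c' 2 = k \<and> lr c' 0 (regs c' 1) (rev vs @ us)"
  using assms
proof (induction vs arbitrary: c us)
  case Nil
  then show ?case by (intro exI[of _ c]) (auto simp: pres_def)
next
  case (Cons v vs)
  have l: "lo \<le> regs c 2" "regs c 2 + 1 < regs c 3" "vr c (mem c (nat (regs c 2))) v"
    "lr c k (mem c (nat (regs c 2 + 1))) vs" using Cons.prems by auto
  have code: "code_at P (pc c) (cpop 0)" using Cons.prems(1) by (simp add: code_at_append)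
  have W3: "regs c 3 \<le> W" using Cons.prems(3) by simp
  obtain d1 where d1: "exec 3 c d1" "pc d1 = pc c + 3" "pres c d1 0" "regs d1 0 = mem c (nat (regs c 2))"
    "regs d1 2 = mem c (nat (regs c 2 + 1))" "\<And>q. q \<notin> {0, 2, 4} \<Longrightarrow> regs d1 q = regs c q" "mem d1 = mem c"
    using exec_cpop[OF code Cons.prems(2) l(1,2) W3] vrep_bound[OF l(3) W3] lrep_bound[OF l(4) W3 Cons.prems(5)] by auto
  have ok1: "ok d1" using Cons.prems(2) d1 lrep_bound[OF l(4) W3 Cons.prems(5)] by (auto simp: ok_def)
  have code1: "code_at P (pc d1) (ccons 1 0 1)" using Cons.prems(1) d1(2) by (simp add: code_at_append)
  have hp1: "regs d1 3 + 2 \<le> W" using d1(6)[of 3] Cons.prems(3) by simp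
  obtain d2 where d2: "exec 5 d1 d2" "pc d2 = pc d1 + 5" "pres d1 d2 2" "regs d2 1 = regs d1 3"
    "regs d2 3 = regs d1 3 + 2" "\<And>r. r \<notin> {1, 3, 4} \<Longrightarrow> regs d2 r = regs d1 r"
    "mem d2 (nat (regs d1 3)) = regs d1 0" "mem d2 (nat (regs d1 3 + 1)) = regs d1 1"
    using exec_ccons[OF code1 ok1 hp1] by auto
  have h0: "lo \<le> regs d1 3" using ok1 by (simp add: ok_def)
  have ok2: "ok d2" using ok1 d2 hp1 h0 lo_pos by (auto simp: ok_def)
  have p2: "pres c d2 2" using pres_trans[OF d1(3) d2(3)] by (simp only: add_0)
  have e2: "lr d2 0 (regs d2 1) (v # us)"
    using d2 d1 h0 pres_lrep[OF p2 Cons.prems(6)] pres_vrep[OF p2 l(3)] by simp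
  have "\<exists>c'. exec (8 * length vs) d2 c' \<and> pc c' = pc d2 + 8 * length vs \<and> pres d2 c' (2 * length vs) \<and>
    regs c' 2 = k \<and> lr c' 0 (regs c' 1) (rev vs @ v # us)"
  proof (rule Cons.IH[OF _ ok2 _ _ Cons.prems(5) e2])
    show "code_at P (pc d2) (cargs (length vs))" using Cons.prems(1) d1(2) d2(2) by (simp add: code_at_append add.assoc)
    show "regs d2 3 + 2 * int (length vs) \<le> W" using Cons.prems(3) d2(5) d1(6)[of 3] by simp
    show "lr d2 k (regs d2 2) vs" using pres_lrep[OF p2 l(4)] d2(6)[of 2] d1(5) by simp
  qed
  then obtain c' where c': "exec (8 * length vs) d2 c'" "pc c' = pc d2 + 8 * length vs" "pres d2 c' (2 * length vs)"
    "regs c' 2 = k" "lr c' 0 (regs c' 1) (rev vs @ v # us)" by blast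
  have "exec (3 + 5 + 8 * length vs) c c'" using d1(1) d2(1) c'(1) exec_trans by blast
  moreover have "pres c c' (2 + 2 * length vs)" using pres_trans[OF p2 c'(3)] .
  ultimately show ?case using c' d1(2) d2(2) by (intro exI[of _ c']) (simp add: algebra_simps)
qed

lemma exec_cdisp:
  assumes "code_at P (pc c) (cdisp k)" "r < k" "regs c 7 = int r" "int k \<le> W"
  shows "\<exists>n c'. n \<le> 2 * k \<and> exec n c c' \<and> pc c' = r \<and> pres c c' 0 \<and> mem c' = mem c \<and> (\<forall>q. q \<noteq> 4 \<longrightarrow> regs c' q = regs c q)"
  using assms
proof (induction k arbitrary: c)
  case (Suc k)
  show ?case
  proof (cases "r = k")
    case True
    define c' where "c' = c\<lparr>regs := (regs c)(4 := int k), pc := k\<rparr>"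
    have "exec (Suc (Suc 0)) c c'"
      using Suc.prems True by (simp add: exec_Suc code_at_Cons set_reg_def advance_def goto_def c'_def)
    then show ?thesis using True by (intro exI[of _ "Suc (Suc 0)"] exI[of _ c']) (auto simp: c'_def pres_def)
  next
    case False
    define d where "d = c\<lparr>regs := (regs c)(4 := int k), pc := Suc (Suc (pc c))\<rparr>"
    have e: "exec (Suc (Suc 0)) c d"
      using Suc.prems False by (simp add: exec_Suc code_at_Cons set_reg_def advance_def goto_def d_def)
    have "\<exists>n c'. n \<le> 2 * k \<and> exec n d c' \<and> pc c' = r \<and> pres d c' 0 \<and> mem c' = mem d \<and> (\<forall>q. q \<noteq> 4 \<longrightarrow> regs c' q = regs d q)"
      by (rule Suc.IH) (use Suc.prems False in \<open>auto simp: d_def code_at_Cons\<close>)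
    then obtain n c' where "n \<le> 2 * k" "exec n d c'" "pc c' = r" "pres d c' 0" "mem c' = mem d" "\<forall>q. q \<noteq> 4 \<longrightarrow> regs c' q = regs d q"
      by blast
    then show ?thesis using exec_trans[OF e] by (intro exI[of _ "Suc (Suc 0) + n"] exI[of _ c']) (auto simp: d_def pres_def)
  qed
qed simp

lemma branch:
  assumes g: "good env (if b then e1 else e2) w s"
    and code: "code_at P (pc c) (j # c2 @ [Jump (l + length c1)] @ c1)"
    and c2: "c2 = ce env (pc c + 1) e2" and l: "l = pc c + 1 + length c2 + 1"
    and c1: "c1 = ce env l e1"
    and j: "exec_instr W j c = Some (if b then goto l c else advance c)"
    and disp: "l + length c1 \<le> disp" and ok: "ok c" "inpok c" and hp: "regs c 3 + int (C * s) \<le> W"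
    and env: "\<bar>z\<bar> \<le> W" "lr c z (regs c 1) (rev env)"
  obtains n c' where "n \<le> C * s + 2" "exec n c c'" "pc c' = l + length c1" "res c c' (C * s)"
    "vr c' (regs c' 0) w"
proof -
  define d where "d = (if b then goto l c else advance c)"
  have e1: "exec (Suc 0) c d" using code j by (simp add: exec_Suc code_at_Cons d_def)
  have d: "mem d = mem c" "regs d = regs c" by (auto simp: d_def goto_def advance_def)
  have ok': "ok d" "inpok d" using ok d by (auto simp: ok_def inpok_def)
  have hp': "regs d 3 + int (C * s) \<le> W" using hp d by simp
  have env': "lr d z (regs d 1) (rev env)" using env d by simp
  show ?thesis
  proof (cases b)
    case True
    have pc: "pc d = l" using True by (simp add: d_def goto_def)
    obtain n c' where "n \<le> C * s" "exec n d c'" "pc c' = l + length c1"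
      "res d c' (C * s)" "vr c' (regs c' 0) w"
      using goodD[OF g _ _ ok' hp' env(1) env'] True code disp
      by (auto simp: pc c1 l code_at_append code_at_Cons)
    then show ?thesis using exec_trans[OF e1] d by (intro that[of "Suc 0 + n" c']) (auto simp: res_def pres_def)
  next
    case False
    have pc: "pc d = pc c + 1" using False by (simp add: d_def goto_def advance_def)
    obtain n d' where d': "n \<le> C * s" "exec n d d'" "pc d' = pc d + length c2"
      "res d d' (C * s)" "vr d' (regs d' 0) w"
      using goodD[OF g _ _ ok' hp' env(1) env'] False code disp l
      by (auto simp: pc c2 code_at_append code_at_Cons)
    have "exec (Suc 0) d' (d'\<lparr>pc := l + length c1\<rparr>)"
      using code d'(3) pc by (simp add: exec_Suc code_at_Cons code_at_append goto_def)
    then have "exec (Suc 0 + n + Suc 0) c (d'\<lparr>pc := l + length c1\<rparr>)"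
      using exec_trans[OF exec_trans[OF e1 d'(2)]] by blast
    then show ?thesis using d' d
      by (intro that[of "Suc 0 + n + Suc 0" "d'\<lparr>pc := l + length c1\<rparr>"]) (auto simp: res_def pres_def)
  qed
qed

text \<open>\<open>Rd\<close> and \<open>Hd\<close> end in the same load instruction, because an
  input index and a pair are both addresses; \<open>m\<close> collects what the two cases have in
  common.\<close>

lemma good_load:
  assumes g: "good env e v t" and m: "\<And>d. ok d \<Longrightarrow> inpok d \<Longrightarrow> regs d 3 \<le> W \<Longrightarrow> vr d (regs d 0) v \<Longrightarrow>
     0 \<le> regs d 0 \<and> vr d (mem d (nat (regs d 0))) w"
    and e': "\<And>p. ce env p e' = ce env p e @ [Load 0 0]"
  shows "good env e' w (t + 1)"
proof (rule goodI)
  fix c z assume st: "start c z env (ce env (pc c) e') (t + 1)"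
  note code = startD(1)[OF st] and disp = startD(2)[OF st] and ok = startD(3,4)[OF st] and hp = startD(5)[OF st] and env = startD(6,7)[OF st]
  have hp': "regs c 3 + int (C * t) \<le> W" using hp by (simp add: distrib_left del: of_nat_mult)
  obtain n d where d: "n \<le> C * t" "exec n c d" "pc d = pc c + length (ce env (pc c) e)"
    "res c d (C * t)" "vr d (regs d 0) v"
    using goodD[OF g _ _ ok hp' env] code disp by (auto simp: e' code_at_append)
  have okd: "ok d" "inpok d" using res_ok d ok inpok_pres by (auto simp: res_def)
  have h3: "regs d 3 \<le> W" using d(4) pres_hp[of c d] hp' by (force simp: res_def)
  note w = m[OF okd h3 d(5)]
  define c' where "c' = d\<lparr>regs := (regs d)(0 := mem d (nat (regs d 0))), pc := Suc (pc d)\<rparr>"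
  have "exec (Suc 0) d c'"
    using code d(3) w vrep_bound[OF conjunct2[OF w] h3]
    by (simp add: e' exec_Suc code_at_append code_at_Cons set_reg_def advance_def goto_def c'_def)
  then have "exec (n + Suc 0) c c'" using exec_trans d(2) by blast
  moreover have "n + Suc 0 \<le> C * (t + 1)" using d(1) C by simp
  moreover have "res c c' (C * (t + 1))" using d(4) by (auto simp: res_def pres_def c'_def)
  ultimately show "reach c (ce env (pc c) e') w (t + 1)"
    using d(3) w by (intro exI[of _ "n + Suc 0"] exI[of _ c']) (auto simp: e' c'_def)
qed

lemma good_Tl:
  assumes g: "good env e (VP a b) t"
  shows "good env (Tl e) b (t + 1)"
proof (rule goodI)
  fix c z assume st: "start c z env (ce env (pc c) (Tl e)) (t + 1)"
  note code = startD(1)[OF st] and disp = startD(2)[OF st] and ok = startD(3,4)[OF st] and hp = startD(5)[OF st] and env = startD(6,7)[OF st]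
  have hp': "regs c 3 + int (C * t) \<le> W" using hp by (simp add: distrib_left del: of_nat_mult)
  obtain n d where d: "n \<le> C * t" "exec n c d" "pc d = pc c + length (ce env (pc c) e)"
    "res c d (C * t)" "vr d (regs d 0) (VP a b)"
    using goodD[OF g _ _ ok hp' env] code disp by (auto simp: code_at_append)
  have okd: "ok d" "inpok d" using res_ok d ok inpok_pres by (auto simp: res_def)
  have h3: "regs d 3 \<le> W" using d(4) pres_hp[of c d] hp' by (force simp: res_def)
  define u where "u = mem d (nat (regs d 0 + 1))"
  have w: "lo \<le> regs d 0" "regs d 0 + 1 < regs d 3" "vr d u b" using d(5) by (auto simp: u_def)
  define c' where "c' = d\<lparr>regs := (regs d)(0 := u), pc := Suc (Suc (pc d))\<rparr>"
  have "exec (Suc (Suc 0)) d c'"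
    using code d(3) w vrep_bound[OF w(3) h3] okd h3 lo_pos
    by (simp add: exec_Suc code_at_append code_at_Cons set_reg_def advance_def goto_def c'_def ok_def u_def)
  then have "exec (n + Suc (Suc 0)) c c'" using exec_trans d(2) by blast
  moreover have "n + Suc (Suc 0) \<le> C * (t + 1)" using d(1) C by simp
  moreover have "res c c' (C * (t + 1))" using d(4) by (auto simp: res_def pres_def c'_def)
  ultimately show "reach c (ce env (pc c) (Tl e)) b (t + 1)"
    using d(3) w by (intro exI[of _ "n + Suc (Suc 0)"] exI[of _ c']) (auto simp: c'_def)
qed

lemma good_arith:
  assumes g1: "good env e1 (VI x) t1" and g2: "good env e2 (VI y) t2" and r: "arith f x y = Some r" "\<bar>r\<bar> \<le> W"
    and e': "\<And>p. ce env p e' =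
      (let c1 = ce env p e1 @ ccons 2 0 2; c2 = comp_exp adr (p + length c1) (length env) e2
       in c1 @ c2 @ cpop 7 @ [Arith f 0 7 0])"
  shows "good env e' (VI r) (t1 + t2 + 1)"
proof (rule goodI)
  fix c z assume st: "start c z env (ce env (pc c) e') (t1 + t2 + 1)"
  note code = startD(1)[OF st] and disp = startD(2)[OF st] and ok = startD(3,4)[OF st] and hp = startD(5)[OF st] and env = startD(6,7)[OF st]
  define c1 where "c1 = ce env (pc c) e1 @ ccons 2 0 2"
  define c2 where "c2 = ce env (pc c + length c1) e2"
  have hp': "regs c 3 + int (C * (t1 + t2) + 2) \<le> W" using hp C by (simp add: distrib_left del: of_nat_mult)
  have e'': "ce env (pc c) e' = (c1 @ c2 @ cpop 7) @ [Arith f 0 7 0]"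
    by (simp add: e' Let_def c1_def c2_def)
  have code': "code_at P (pc c) (c1 @ c2 @ cpop 7)" "code_at P (pc c + length c1 + length c2 + 3) [Arith f 0 7 0]"
    using code unfolding e'' code_at_append[of _ _ "c1 @ c2 @ cpop 7"] by (simp_all add: add.assoc)
  have disp': "pc c + length c1 + length c2 \<le> disp" using disp unfolding e'' by simp
  obtain n d where d: "n \<le> C * (t1 + t2) + 8" "exec n c d" "pc d = pc c + length c1 + length c2 + 3"
    "res c d (C * (t1 + t2) + 2)" "vr d (regs d 7) (VI x)" "vr d (regs d 0) (VI y)"
    using binary[OF g1 g2 c1_def c2_def code'(1) disp' ok hp' env] .
  define c' where "c' = d\<lparr>regs := (regs d)(0 := r), pc := Suc (pc d)\<rparr>"
  have "exec (Suc 0) d c'"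
    using code'(2) d(3,5,6) r
    by (simp add: exec_Suc code_at_Cons set_reg_def advance_def goto_def c'_def)
  then have "exec (n + Suc 0) c c'" using exec_trans d(2) by blast
  moreover have "n + Suc 0 \<le> C * (t1 + t2 + 1)" using d(1) C by (simp add: distrib_left)
  moreover have "res c c' (C * (t1 + t2 + 1))"
  proof -
    have "pres c d (C * (t1 + t2 + 1))" by (rule pres_mono[of _ _ "C * (t1 + t2) + 2"]) (use d(4) C in \<open>auto simp: res_def\<close>)
    then show ?thesis using d(4) by (auto simp: res_def pres_def c'_def)
  qed
  ultimately show "reach c (ce env (pc c) e') (VI r) (t1 + t2 + 1)"
    using d(3) r by (intro exI[of _ "n + Suc 0"] exI[of _ c']) (auto simp: e'' c'_def)
qed

lemma good_Pr:
  assumes g1: "good env e1 v1 t1" and g2: "good env e2 v2 t2"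
  shows "good env (Pr e1 e2) (VP v1 v2) (t1 + t2 + 1)"
proof (rule goodI)
  fix c z assume st: "start c z env (ce env (pc c) (Pr e1 e2)) (t1 + t2 + 1)"
  note code = startD(1)[OF st] and disp = startD(2)[OF st] and ok = startD(3,4)[OF st] and hp = startD(5)[OF st] and env = startD(6,7)[OF st]
  define c1 where "c1 = ce env (pc c) e1 @ ccons 2 0 2"
  define c2 where "c2 = ce env (pc c + length c1) e2"
  have hp': "regs c 3 + int (C * (t1 + t2) + 2) \<le> W" using hp C by (simp add: distrib_left del: of_nat_mult)
  have e'': "ce env (pc c) (Pr e1 e2) = (c1 @ c2 @ cpop 7) @ ccons 0 7 0"
    by (simp add: Let_def c1_def c2_def)
  have code': "code_at P (pc c) (c1 @ c2 @ cpop 7)" "code_at P (pc c + length c1 + length c2 + 3) (ccons 0 7 0)"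
    using code unfolding e'' code_at_append[of _ _ "c1 @ c2 @ cpop 7"] by (simp_all add: add.assoc)
  have disp': "pc c + length c1 + length c2 \<le> disp" using disp unfolding e'' by simp
  obtain n d where d: "n \<le> C * (t1 + t2) + 8" "exec n c d" "pc d = pc c + length c1 + length c2 + 3"
    "res c d (C * (t1 + t2) + 2)" "vr d (regs d 7) v1" "vr d (regs d 0) v2"
    using binary[OF g1 g2 c1_def c2_def code'(1) disp' ok hp' env] .
  have okd: "ok d" using res_ok d(4) ok by blast
  have h3: "regs d 3 + 2 \<le> W" using d(4) pres_hp[of c d] hp C by (force simp: res_def distrib_left)
  have code2: "code_at P (pc d) (ccons 0 7 0)" using code'(2) d(3) by simp
  obtain c' where c': "exec 5 d c'" "pc c' = pc d + 5" "pres d c' 2" "regs c' 0 = regs d 3"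
    "regs c' 3 = regs d 3 + 2" "\<And>r. r \<notin> {0, 3, 4} \<Longrightarrow> regs c' r = regs d r"
    "mem c' (nat (regs d 3)) = regs d 7" "mem c' (nat (regs d 3 + 1)) = regs d 0"
    using exec_ccons[OF code2 okd h3] by auto
  have "exec (n + 5) c c'" using exec_trans d(2) c'(1) by blast
  moreover have "n + 5 \<le> C * (t1 + t2 + 1)" using d(1) C by (simp add: distrib_left)
  moreover have "pres c c' (C * (t1 + t2 + 1))"
    by (rule pres_mono[OF pres_trans[OF _ c'(3)], of _ "C * (t1 + t2) + 2"]) (use d(4) C in \<open>auto simp: res_def distrib_left\<close>)
  then have "res c c' (C * (t1 + t2 + 1))" using d(4) c'(6) by (simp add: res_def)
  moreover have "vr c' (regs c' 0) (VP v1 v2)"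
    using c' pres_vrep[OF c'(3) d(5)] pres_vrep[OF c'(3) d(6)] okd by (simp add: ok_def)
  ultimately show "reach c (ce env (pc c) (Pr e1 e2)) (VP v1 v2) (t1 + t2 + 1)"
    using d(3) c'(2) unfolding e'' by (intro exI[of _ "n + 5"] exI[of _ c']) simp
qed

lemma good_Lc:
  assumes i: "i < length env"
  shows "good env (Lc i) (env ! i) (1 + length env)"
proof (rule goodI)
  fix c z assume st: "start c z env (ce env (pc c) (Lc i)) (1 + length env)"
  note code = startD(1)[OF st] and ok = startD(3,4)[OF st] and hp = startD(5)[OF st] and env = startD(6,7)[OF st]
  define k where "k = length env - 1 - i"
  define d where "d = c\<lparr>regs := (regs c)(4 := regs c 1), pc := Suc (pc c)\<rparr>"
  have e1: "exec (Suc 0) c d"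
    using code ok by (simp add: exec_Suc code_at_Cons set_reg_def advance_def goto_def d_def ok_def)
  have "\<exists>c'. exec (2 * k + 1) d c' \<and> pc c' = pc d + 2 * k + 1 \<and> pres d c' 0 \<and> mem c' = mem d \<and>
    (\<forall>r. r \<notin> {0, 4} \<longrightarrow> regs c' r = regs d r) \<and> vr c' (regs c' 0) (rev env ! k)"
  proof (rule exec_cwalk[OF _ _ _ env(1)])
    show "code_at P (pc d) (cwalk k)" using code by (simp add: d_def code_at_Cons k_def)
    show "ok d" using ok by (simp add: d_def ok_def)
    have "0 \<le> int (C * (1 + length env))" by (rule of_nat_0_le_iff)
    moreover have "regs d 3 = regs c 3" by (simp add: d_def)
    ultimately show "regs d 3 \<le> W" using hp by linarith
  qed (use env i in \<open>auto simp: d_def k_def\<close>)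
  then obtain c' where c': "exec (2 * k + 1) d c'" "pc c' = pc d + 2 * k + 1" "pres d c' 0" "mem c' = mem d"
    "\<forall>r. r \<notin> {0, 4} \<longrightarrow> regs c' r = regs d r" "vr c' (regs c' 0) (rev env ! k)" by blast
  have "rev env ! k = env ! i" using i by (simp add: k_def rev_nth)
  moreover have "exec (Suc 0 + (2 * k + 1)) c c'" using exec_trans e1 c'(1) by blast
  moreover have "Suc 0 + (2 * k + 1) \<le> C * (1 + length env)"
  proof -
    have "2 * (1 + length env) \<le> C * (1 + length env)" using C by (intro mult_le_mono1) simp
    then show ?thesis using i by (simp add: k_def)
  qed
  moreover have "res c c' (C * (1 + length env))" using c' by (auto simp: res_def pres_def d_def)
  moreover have "length (cwalk k) = 2 * k + 1" by (induction k) auto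
  ultimately show "reach c (ce env (pc c) (Lc i)) (env ! i) (1 + length env)"
    using c' by (intro exI[of _ "Suc 0 + (2 * k + 1)"] exI[of _ c']) (simp add: d_def k_def)
qed

lemma good_Nm:
  assumes "\<bar>x\<bar> \<le> W"
  shows "good env (Nm x) (VI x) 1"
proof (rule goodI)
  fix c z assume st: "start c z env (ce env (pc c) (Nm x)) 1"
  note code = startD(1)[OF st]
  define d where "d = c\<lparr>regs := (regs c)(0 := x), pc := Suc (pc c)\<rparr>"
  have "exec (Suc 0) c d"
    using code assms by (simp add: exec_Suc code_at_Cons set_reg_def advance_def goto_def d_def)
  then show "reach c (ce env (pc c) (Nm x)) (VI x) 1"
    using assms C by (intro exI[of _ "Suc 0"] exI[of _ d]) (auto simp: d_def res_def pres_def)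
qed

lemma good_Lt:
  assumes g1: "good env e1 v1 t1" and g2: "good (env @ [v1]) e2 v2 t2"
  shows "good env (Lt e1 e2) v2 (t1 + t2 + 1)"
proof (rule goodI)
  fix c z assume st: "start c z env (ce env (pc c) (Lt e1 e2)) (t1 + t2 + 1)"
  note code = startD(1)[OF st] and disp = startD(2)[OF st] and ok = startD(3,4)[OF st] and hp = startD(5)[OF st] and env = startD(6,7)[OF st]
  define c1 where "c1 = ce env (pc c) e1 @ ccons 1 0 1"
  define c2 where "c2 = comp_exp adr (pc c + length c1) (length (env @ [v1])) e2"
  have CC: "int (C * (t1 + t2 + 1)) = int (C * t1) + int (C * t2) + int C" "40 \<le> int C" using C by (simp_all add: algebra_simps)
  have e'': "ce env (pc c) (Lt e1 e2) = c1 @ c2 @ [Arith Plus 4 1 6, Load 1 4]"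
    by (simp add: Let_def c1_def c2_def)
  have hp1: "regs c 3 + int (C * t1) \<le> W" using hp CC by linarith
  obtain n1 d1 where d1: "n1 \<le> C * t1" "exec n1 c d1" "pc d1 = pc c + length (ce env (pc c) e1)"
    "res c d1 (C * t1)" "vr d1 (regs d1 0) v1"
    using goodD[OF g1 _ _ ok hp1 env] code disp unfolding e'' by (auto simp: c1_def code_at_append)
  have ok1: "ok d1" "inpok d1" using res_ok inpok_pres d1 ok by (auto simp: res_def)
  have hd1: "regs c 3 \<le> regs d1 3" "regs d1 3 \<le> regs c 3 + int (C * t1)" using pres_hp[of c d1] d1(4) by (force simp: res_def)+
  have hp2: "regs d1 3 + 2 \<le> W" using hd1 hp CC by linarith
  have code1: "code_at P (pc d1) (ccons 1 0 1)" using code d1(3) unfolding e'' by (simp add: c1_def code_at_append)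
  obtain d2 where d2: "exec 5 d1 d2" "pc d2 = pc d1 + 5" "pres d1 d2 2" "regs d2 1 = regs d1 3"
    "regs d2 3 = regs d1 3 + 2" "\<And>r. r \<notin> {1, 3, 4} \<Longrightarrow> regs d2 r = regs d1 r"
    "mem d2 (nat (regs d1 3)) = regs d1 0" "mem d2 (nat (regs d1 3 + 1)) = regs d1 1"
    using exec_ccons[OF code1 ok1(1) hp2] by auto
  have hW: "lo \<le> regs d1 3" using ok1 by (auto simp: ok_def)
  have ok2: "ok d2" using ok1 d2 hp2 hW lo_pos by (auto simp: ok_def)
  have in2: "inpok d2" using inpok_pres d2(3) ok1 by blast
  have pc2: "pc d2 = pc c + length c1" using d1(3) d2(2) by (simp add: c1_def)
  have hp3: "regs d2 3 + int (C * t2) \<le> W" using hd1 d2(5) hp CC by linarith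
  have p2: "pres c d2 (C * t1 + 2)" using pres_trans[OF _ d2(3)] d1(4) by (auto simp: res_def)
  have e2: "lr d2 z (regs d2 1) (rev (env @ [v1]))"
    using d2 d1(4) hW pres_lrep[OF p2 env(2)] pres_vrep[OF d2(3) d1(5)] by (simp add: res_def)
  obtain n2 d3 where d3: "n2 \<le> C * t2" "exec n2 d2 d3" "pc d3 = pc d2 + length c2"
    "res d2 d3 (C * t2)" "vr d3 (regs d3 0) v2"
    using goodD[OF g2 _ _ ok2 in2 hp3 env(1) e2] code disp unfolding e'' by (auto simp: pc2 c2_def code_at_append)
  have ok3: "ok d3" using res_ok d3(4) ok2 by blast
  have hd3: "regs d2 3 \<le> regs d3 3" "regs d3 3 \<le> regs d2 3 + int (C * t2)" "same (regs d2 3) (mem d2) (mem d3)"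
    using d3(4) by (auto simp: res_def pres_def)
  have m3: "mem d3 (nat (regs d1 3 + 1)) = regs c 1" "regs d3 1 = regs d1 3"
    using hd3(3) d2 hW lo_pos d1(4) d3(4) by (auto simp: same_def res_def)
  define c' where "c' = d3\<lparr>regs := (regs d3)(4 := regs d1 3 + 1, 1 := regs c 1), pc := Suc (Suc (pc d3))\<rparr>"
  have "code_at P (pc d3) [Arith Plus 4 1 6, Load 1 4]" using code d3(3) pc2 unfolding e'' by (simp add: code_at_append add.assoc)
  then have "exec (Suc (Suc 0)) d3 c'"
    using m3 ok3 hp2 hW lo_pos ok
    by (simp add: exec_Suc code_at_Cons set_reg_def advance_def goto_def c'_def ok_def)
  then have "exec (n1 + 5 + n2 + Suc (Suc 0)) c c'" using d1(2) d2(1) d3(2) exec_trans by blast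
  moreover have "n1 + 5 + n2 + Suc (Suc 0) \<le> C * (t1 + t2 + 1)" using d1(1) d3(1) C by (simp add: distrib_left)
  moreover have "pres c d3 (C * t1 + 2 + C * t2)" using pres_trans[OF p2] d3(4) by (auto simp: res_def)
  then have "pres c d3 (C * (t1 + t2 + 1))" by (rule pres_mono) (use C in \<open>simp add: distrib_left\<close>)
  then have "res c c' (C * (t1 + t2 + 1))"
    using d1(4) d2(6)[of 2] d3(4) by (auto simp: res_def pres_def c'_def)
  ultimately show "reach c (ce env (pc c) (Lt e1 e2)) v2 (t1 + t2 + 1)"
    using d3(3,5) pc2 unfolding e'' by (intro exI[of _ "n1 + 5 + n2 + Suc (Suc 0)"] exI[of _ c']) (simp add: c'_def)
qed

lemma good_IfZ:
  assumes g0: "good env e v t" and g: "good env (if v = VI 0 then e1 else e2) w s"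
  shows "good env (IfZ e e1 e2) w (t + s + 1)"
proof (rule goodI)
  fix c z assume st: "start c z env (ce env (pc c) (IfZ e e1 e2)) (t + s + 1)"
  note code = startD(1)[OF st] and disp = startD(2)[OF st] and ok = startD(3,4)[OF st] and hp = startD(5)[OF st] and env = startD(6,7)[OF st]
  define c0 where "c0 = ce env (pc c) e"
  define q where "q = pc c + length c0"
  define c2 where "c2 = ce env (q + 1) e2"
  define l where "l = q + 1 + length c2 + 1"
  define c1 where "c1 = ce env l e1"
  have e'': "ce env (pc c) (IfZ e e1 e2) = c0 @ JumpEq 0 5 l # c2 @ [Jump (l + length c1)] @ c1"
    by (simp add: Let_def c0_def c1_def c2_def l_def q_def)
  have CC: "int (C * (t + s + 1)) = int (C * t) + int (C * s) + int C" "40 \<le> int C" using C by (simp_all add: algebra_simps)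
  have hp1: "regs c 3 + int (C * t) \<le> W" using hp CC by linarith
  obtain n d where d: "n \<le> C * t" "exec n c d" "pc d = q"
    "res c d (C * t)" "vr d (regs d 0) v"
    using goodD[OF g0 _ _ ok hp1 env] code disp unfolding e'' by (auto simp: c0_def q_def code_at_append)
  have ok1: "ok d" "inpok d" using res_ok inpok_pres d ok by (auto simp: res_def)
  have hd1: "regs c 3 \<le> regs d 3" "regs d 3 \<le> regs c 3 + int (C * t)" using pres_hp[of c d] d(4) by (force simp: res_def)+
  have hp2: "regs d 3 + int (C * s) \<le> W" using hd1 hp CC by linarith
  have env2: "lr d z (regs d 1) (rev env)" using d(4) pres_lrep[OF _ env(2)] by (auto simp: res_def)
  have j: "exec_instr W (JumpEq 0 5 l) d = Some (if v = VI 0 then goto l d else advance d)"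
    using ok1 vrep_zero[OF d(5)] by (simp add: ok_def)
  have code2: "code_at P (pc d) (JumpEq 0 5 l # c2 @ [Jump (l + length c1)] @ c1)"
    using code d(3) unfolding e'' code_at_append[of _ _ c0] by (simp add: q_def)
  have disp2: "l + length c1 \<le> disp" using disp unfolding e'' by (simp add: l_def q_def)
  obtain k c' where c': "k \<le> C * s + 2" "exec k d c'" "pc c' = l + length c1" "res d c' (C * s)"
    "vr c' (regs c' 0) w"
    by (rule branch[OF g code2 _ _ _ j disp2 ok1 hp2 env(1) env2]) (auto simp: c2_def l_def c1_def d(3))
  have "exec (n + k) c c'" using exec_trans d(2) c'(2) by blast
  moreover have "n + k \<le> C * (t + s + 1)" using d(1) c'(1) C by (simp add: distrib_left)
  moreover have "pres c c' (C * (t + s + 1))"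
    by (rule pres_mono[OF pres_trans[of c d "C * t" c' "C * s"]]) (use d(4) c'(4) in \<open>auto simp: res_def distrib_left\<close>)
  then have "res c c' (C * (t + s + 1))" using d(4) c'(4) by (simp add: res_def)
  ultimately show "reach c (ce env (pc c) (IfZ e e1 e2)) w (t + s + 1)"
    using c'(3,5) unfolding e'' by (intro exI[of _ "n + k"] exI[of _ c']) (simp add: l_def q_def)
qed

lemma good_compare:
  assumes g1: "good env a (VI x) t1" and g2: "good env b (VI y) t2"
    and g: "good env (if R x y then e1 else e2) w s"
    and J: "\<And>l d. exec_instr W (J l) d = Some (if R (regs d 7) (regs d 0) then goto l d else advance d)"
    and e': "\<And>p. ce env p e' =
    (let ca = ce env p a @ ccons 2 0 2; c0 = ca @ comp_exp adr (p + length ca) (length env) b @ cpop 7;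
         c2 = comp_exp adr (p + length c0 + 1) (length env) e2;
         l = p + length c0 + 1 + length c2 + 1; c1 = ce env l e1
     in c0 @ [J l] @ c2 @ [Jump (l + length c1)] @ c1)"
  shows "good env e' w (t1 + t2 + s + 1)"
proof (rule goodI)
  fix c z assume st: "start c z env (ce env (pc c) e') (t1 + t2 + s + 1)"
  note code = startD(1)[OF st] and disp = startD(2)[OF st] and ok = startD(3,4)[OF st] and hp = startD(5)[OF st] and env = startD(6,7)[OF st]
  define ca where "ca = ce env (pc c) a @ ccons 2 0 2"
  define cb where "cb = ce env (pc c + length ca) b"
  define c0 where "c0 = ca @ cb @ cpop 7"
  define q where "q = pc c + length c0"
  define c2 where "c2 = ce env (q + 1) e2"
  define l where "l = q + 1 + length c2 + 1"
  define c1 where "c1 = ce env l e1"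
  have e'': "ce env (pc c) e' = c0 @ J l # c2 @ [Jump (l + length c1)] @ c1"
    by (simp add: e' Let_def c0_def ca_def cb_def c1_def c2_def l_def q_def)
  have CC: "int (C * (t1 + t2 + s + 1)) = int (C * t1) + int (C * t2) + int (C * s) + int C" "40 \<le> int C"
    "int (C * (t1 + t2)) = int (C * t1) + int (C * t2)" using C by (simp_all add: algebra_simps)
  have hp1: "regs c 3 + int (C * (t1 + t2) + 2) \<le> W"
    using hp CC of_nat_0_le_iff[of "C * s"] unfolding of_nat_add of_nat_numeral by linarith
  have code1: "code_at P (pc c) (ca @ cb @ cpop 7)" using code unfolding e'' code_at_append[of _ _ c0] by (simp add: c0_def)
  have disp1: "pc c + length ca + length cb \<le> disp" using disp unfolding e'' by (simp add: c0_def)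
  obtain n d where d: "n \<le> C * (t1 + t2) + 8" "exec n c d" "pc d = pc c + length ca + length cb + 3"
    "res c d (C * (t1 + t2) + 2)" "vr d (regs d 7) (VI x)" "vr d (regs d 0) (VI y)"
    using binary[OF g1 g2 ca_def cb_def code1 disp1 ok hp1 env] .
  have pcd: "pc d = q" using d(3) by (simp add: q_def c0_def)
  have ok1: "ok d" "inpok d" using res_ok inpok_pres d ok by (auto simp: res_def)
  have hd1: "regs c 3 \<le> regs d 3" "regs d 3 \<le> regs c 3 + int (C * (t1 + t2) + 2)" using pres_hp[of c d] d(4) by (force simp: res_def)+
  have hp2: "regs d 3 + int (C * s) \<le> W" using hd1 hp CC unfolding of_nat_add of_nat_numeral by linarith
  have env2: "lr d z (regs d 1) (rev env)" using d(4) pres_lrep[OF _ env(2)] by (auto simp: res_def)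
  have j: "exec_instr W (J l) d = Some (if R x y then goto l d else advance d)"
    using d(5,6) by (simp add: J)
  have code2: "code_at P (pc d) (J l # c2 @ [Jump (l + length c1)] @ c1)"
    using code pcd unfolding e'' code_at_append[of _ _ c0] by (simp add: q_def)
  have disp2: "l + length c1 \<le> disp" using disp unfolding e'' by (simp add: l_def q_def)
  obtain k c' where c': "k \<le> C * s + 2" "exec k d c'" "pc c' = l + length c1" "res d c' (C * s)"
    "vr c' (regs c' 0) w"
    by (rule branch[OF g code2 _ _ _ j disp2 ok1 hp2 env(1) env2]) (auto simp: c2_def l_def c1_def pcd)
  have "exec (n + k) c c'" using exec_trans d(2) c'(2) by blast
  moreover have "n + k \<le> C * (t1 + t2 + s + 1)" using d(1) c'(1) C by (simp add: distrib_left)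
  moreover have "pres c c' (C * (t1 + t2 + s + 1))"
    by (rule pres_mono[OF pres_trans[of c d "C * (t1 + t2) + 2" c' "C * s"]]) (use d(4) c'(4) C in \<open>auto simp: res_def distrib_left\<close>)
  then have "res c c' (C * (t1 + t2 + s + 1))" using d(4) c'(4) by (simp add: res_def)
  ultimately show "reach c (ce env (pc c) e') w (t1 + t2 + s + 1)"
    using c'(3,5) unfolding e'' by (intro exI[of _ "n + k"] exI[of _ c']) (simp add: l_def q_def)
qed

lemma goods_Cons:
  assumes g: "good env e v t" and gs: "goods env es vs s"
  shows "goods env (e # es) (v # vs) (t + s + 1)"
  unfolding goods_def
proof (intro conjI allI impI)
  show "length (e # es) = length (v # vs)" using gs by (simp add: goods_def)
  fix c z
  assume code: "code_at P (pc c) (ces env (pc c) (e # es))"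
    and disp: "pc c + length (ces env (pc c) (e # es)) \<le> disp" and ok: "ok c" "inpok c"
    and hp: "regs c 3 + int (C * (t + s + 1)) \<le> W" and env: "\<bar>z\<bar> \<le> W" "lr c z (regs c 1) (rev env)"
  define c0 where "c0 = ces env (pc c) es"
  define c1 where "c1 = ce env (pc c + length c0) e"
  have e'': "ces env (pc c) (e # es) = c0 @ c1 @ ccons 2 0 2" by (simp add: Let_def c0_def c1_def)
  have CC: "int (C * (t + s + 1)) = int (C * t) + int (C * s) + int C" "40 \<le> int C" using C by (simp_all add: algebra_simps)
  have hp1: "regs c 3 + int (C * s) \<le> W" using hp CC of_nat_0_le_iff[of "C * t"] by linarith
  obtain n d where d: "n + 8 * length es \<le> C * s" "exec n c d" "pc d = pc c + length c0"
    "pres c d (C * s - 8 * length es)" "regs d 1 = regs c 1" "lr d (regs c 2) (regs d 2) vs"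
    by (rule goodsD[OF gs _ _ ok hp1 env]) (use code disp e'' in \<open>auto simp: c0_def code_at_append\<close>)
  have hd: "regs c 3 \<le> regs d 3" "regs d 3 \<le> regs c 3 + int (C * s)" using pres_hp[OF pres_mono[OF d(4)], of "C * s"] by auto
  have "regs d 3 \<le> W" using hd hp1 by linarith
  then have ok1: "ok d" using lrep_bound[OF d(6)] d ok by (auto simp: ok_def pres_def)
  have in1: "inpok d" using inpok_pres[OF d(4) ok] .
  have hp2: "regs d 3 + int (C * t) \<le> W" using hd hp CC by linarith
  have env2: "lr d z (regs d 1) (rev env)" using d(5) pres_lrep[OF d(4) env(2)] by simp
  obtain n2 d2 where d2: "n2 \<le> C * t" "exec n2 d d2" "pc d2 = pc d + length c1"
    "res d d2 (C * t)" "vr d2 (regs d2 0) v"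
    using goodD[OF g _ _ ok1 in1 hp2 env(1) env2] code disp d(3) unfolding e'' by (auto simp: c1_def code_at_append)
  have ok2: "ok d2" using res_ok d2(4) ok1 by blast
  have hd2: "regs d 3 \<le> regs d2 3" "regs d2 3 \<le> regs d 3 + int (C * t)" using pres_hp[of d d2] d2(4) by (force simp: res_def)+
  have hp3: "regs d2 3 + 2 \<le> W" using hd hd2 hp CC by linarith
  have code2: "code_at P (pc d2) (ccons 2 0 2)" using code d(3) d2(3) unfolding e'' by (simp add: code_at_append add.assoc)
  obtain c' where c': "exec 5 d2 c'" "pc c' = pc d2 + 5" "pres d2 c' 2" "regs c' 2 = regs d2 3"
    "regs c' 3 = regs d2 3 + 2" "\<And>r. r \<notin> {2, 3, 4} \<Longrightarrow> regs c' r = regs d2 r"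
    "mem c' (nat (regs d2 3)) = regs d2 0" "mem c' (nat (regs d2 3 + 1)) = regs d2 2"
    using exec_ccons[OF code2 ok2 hp3] by auto
  have p: "pres d c' (C * t + 2)" using pres_trans[OF _ c'(3)] d2(4) by (auto simp: res_def)
  have "exec (n + n2 + 5) c c'" using exec_trans d(2) d2(2) c'(1) by blast
  moreover have le: "n + n2 + 5 + 8 * length (e # es) \<le> C * (t + s + 1)" "8 * length es \<le> C * s"
    using d(1) d2(1) C by (simp_all add: distrib_left)
  moreover have "pres c c' (C * (t + s + 1) - 8 * length (e # es))"
  proof (rule pres_mono[OF pres_trans[OF d(4) p]])
    show "C * s - 8 * length es + (C * t + 2) \<le> C * (t + s + 1) - 8 * length (e # es)"
      using le C by (simp add: distrib_left)
  qed
  moreover have "lr c' (regs c 2) (regs c' 2) (v # vs)"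
    using c' pres_lrep[OF p d(6)] d2(4) pres_vrep[OF c'(3) d2(5)] ok2 by (simp add: res_def ok_def)
  ultimately show "\<exists>n c'. n + 8 * length (e # es) \<le> C * (t + s + 1) \<and> exec n c c' \<and>
        pc c' = pc c + length (ces env (pc c) (e # es)) \<and>
        pres c c' (C * (t + s + 1) - 8 * length (e # es)) \<and> regs c' 1 = regs c 1 \<and>
        lr c' (regs c 2) (regs c' 2) (v # vs)"
    using d(3) d2(3,4) c'(2,6) d(5) unfolding e''
    by (intro exI[of _ "n + n2 + 5"] exI[of _ c']) (simp add: res_def)
qed

text \<open>The caller pushes its environment before the arguments and, once \<open>cargs\<close>
  has removed those, the return address. The body ends in a jump to the dispatcher, which pops the
  address; the pop of the environment is the first thing after the return.\<close>

lemma good_Cl: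
  assumes gs: "goods env es vs t" and f: "f < length \<Phi>" "fst (\<Phi> ! f) = length vs"
    and g: "good vs (snd (\<Phi> ! f)) v s"
  shows "good env (Cl f es) v (t + s + 1)"
proof (rule goodI)
  fix c z assume st: "start c z env (ce env (pc c) (Cl f es)) (t + s + 1)"
  note code = startD(1)[OF st] and disp = startD(2)[OF st] and ok = startD(3,4)[OF st] and hp = startD(5)[OF st] and env = startD(6,7)[OF st]
  define c0 where "c0 = comp_exps adr (pc c + 5) (length env) es"
  \<comment> \<open>The 5 is the push of the environment, the 1 the reset of register 1, and
    \<open>cargs\<close> takes 8 per argument. The 7 is made of the constant, the five instructions
    of \<open>ccons\<close> and the jump, so the code at \<open>ret\<close> is
    \<open>cpop 1\<close>.\<close>
  define ret where "ret = pc c + 5 + length c0 + 1 + 8 * length es + 7"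
  have lenargs: "length (cargs k) = 8 * k" for k by (induction k) auto
  have e'': "ce env (pc c) (Cl f es) = ccons 2 1 2 @ c0 @ Const 1 0 # cargs (length es) @
     Const 7 (int ret) # ccons 2 7 2 @ Jump (adr f) # cpop 1"
    by (simp add: Let_def c0_def ret_def lenargs add.assoc)
  have len: "length es = length vs" using gs by (simp add: goods_def)
  have CC: "int (C * (t + s + 1)) = int (C * t) + int (C * s) + int C" "40 \<le> int C" using C by (simp_all add: algebra_simps)
  have hp1: "regs c 3 + 2 \<le> W" using hp CC of_nat_0_le_iff[of "C * s"] of_nat_0_le_iff[of "C * t"] by linarith
  have code1: "code_at P (pc c) (ccons 2 1 2)" using code unfolding e'' by (simp add: code_at_append)
  obtain d1 where d1: "exec 5 c d1" "pc d1 = pc c + 5" "pres c d1 2" "regs d1 2 = regs c 3"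
    "regs d1 3 = regs c 3 + 2" "\<And>r. r \<notin> {2, 3, 4} \<Longrightarrow> regs d1 r = regs c r"
    "mem d1 (nat (regs c 3)) = regs c 1" "mem d1 (nat (regs c 3 + 1)) = regs c 2"
    using exec_ccons[OF code1 ok(1) hp1] by auto
  have h0: "lo \<le> regs c 3" using ok by (simp add: ok_def)
  have ok1: "ok d1" "inpok d1" using ok d1 hp1 h0 lo_pos inpok_pres by (auto simp: ok_def)
  have hp2: "regs d1 3 + int (C * t) \<le> W" using hp CC d1(5) of_nat_0_le_iff[of "C * s"] by linarith
  have env1: "lr d1 z (regs d1 1) (rev env)" using d1(6)[of 1] pres_lrep[OF d1(3) env(2)] by simp
  obtain n d2 where d2: "n + 8 * length es \<le> C * t" "exec n d1 d2" "pc d2 = pc d1 + length c0"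
    "pres d1 d2 (C * t - 8 * length es)" "regs d2 1 = regs d1 1" "lr d2 (regs d1 2) (regs d2 2) vs"
    by (rule goodsD[OF gs _ _ ok1 hp2 env(1) env1]) (use code disp d1(2) e'' in \<open>auto simp: c0_def code_at_append\<close>)
  have hd2: "regs d1 3 \<le> regs d2 3" "regs d2 3 + 8 * int (length vs) \<le> regs d1 3 + int (C * t)"
    using pres_hp[OF d2(4)] d2(1) len by (simp_all add: of_nat_diff)
  have W2: "regs d2 3 \<le> W" "\<bar>regs d1 2\<bar> \<le> W" using hd2 hp2 ok1 by (auto simp: ok_def)
  define d3 where "d3 = d2\<lparr>regs := (regs d2)(1 := 0), pc := Suc (pc d2)\<rparr>"
  have e3: "exec (Suc 0) d2 d3" using code d1(2) d2(3) W2 h0 lo_pos hp1 unfolding e''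
    by (simp add: exec_Suc code_at_append code_at_Cons set_reg_def advance_def goto_def d3_def add.assoc)
  have ok3: "ok d3" using ok1 d2 W2 lrep_bound[OF d2(6) W2] h0 lo_pos hp1 by (auto simp: ok_def d3_def pres_def)
  have code3: "code_at P (pc d3) (cargs (length vs))" using code d1(2) d2(3) unfolding e''
    by (simp add: d3_def code_at_append code_at_Cons len[symmetric] add.assoc)
  have hp3: "regs d3 3 + 2 * int (length vs) \<le> W" using hd2 hp2 by (simp add: d3_def del: of_nat_mult)
  have l3: "lr d3 (regs d1 2) (regs d3 2) vs" "lr d3 0 (regs d3 1) []"
    using d2(6) by (simp_all add: d3_def)
  obtain d4 where d4: "exec (8 * length vs) d3 d4" "pc d4 = pc d3 + 8 * length vs" "pres d3 d4 (2 * length vs)"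
    "regs d4 2 = regs d1 2" "lr d4 0 (regs d4 1) (rev vs @ [])"
    using exec_cargs[OF code3 ok3 hp3 l3(1) W2(2) l3(2)] by blast
  have hd4: "regs d2 3 \<le> regs d4 3" "regs d4 3 \<le> regs d1 3 + int (C * t)"
    using pres_hp[OF d4(3)] hd2 by (simp_all add: d3_def del: of_nat_mult)
  have W4: "regs d4 3 \<le> W" using hd4 hp2 by linarith
  have ok4: "ok d4" using ok3 d4 W2 lrep_bound[OF d4(5) W4] lo_pos hp1 h0 by (auto simp: ok_def pres_def)
  define d5 where "d5 = d4\<lparr>regs := (regs d4)(7 := int ret), pc := Suc (pc d4)\<rparr>"
  have retd: "ret < disp" using disp unfolding e'' by (simp add: ret_def lenargs)
  have pc4: "pc d4 = pc c + 5 + length c0 + 1 + 8 * length vs" using d4(2) d2(3) d1(2) by (simp add: d3_def)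
  have codeB: "code_at P (pc d4) (Const 7 (int ret) # ccons 2 7 2 @ Jump (adr f) # cpop 1)"
    using code unfolding e'' by (simp add: pc4 code_at_append code_at_Cons[of _ _ "Const (Suc 0) 0"] lenargs len add.assoc)
  have e5: "exec (Suc 0) d4 d5" using codeB retd PW
    by (simp add: exec_Suc code_at_Cons set_reg_def advance_def goto_def d5_def)
  have ok5: "ok d5" using ok4 by (simp add: ok_def d5_def)
  have hp5: "regs d5 3 + 2 \<le> W" using hd4 d1(5) hp CC of_nat_0_le_iff[of "C * s"] by (simp add: d5_def del: of_nat_mult)
  have code5: "code_at P (pc d5) (ccons 2 7 2)" using codeB by (simp add: d5_def code_at_Cons code_at_append)
  obtain d6 where d6: "exec 5 d5 d6" "pc d6 = pc d5 + 5" "pres d5 d6 2" "regs d6 2 = regs d5 3"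
    "regs d6 3 = regs d5 3 + 2" "\<And>r. r \<notin> {2, 3, 4} \<Longrightarrow> regs d6 r = regs d5 r"
    "mem d6 (nat (regs d5 3)) = regs d5 7" "mem d6 (nat (regs d5 3 + 1)) = regs d5 2"
    using exec_ccons[OF code5 ok5 hp5] by auto
  define d7 where "d7 = goto (adr f) d6"
  have e7: "exec (Suc 0) d6 d7" using codeB d6(2) by (simp add: exec_Suc code_at_append code_at_Cons d5_def d7_def)
  have h5: "lo \<le> regs d5 3" using ok5 by (simp add: ok_def)
  have ok7: "ok d7" using ok5 d6 hp5 h5 lo_pos by (auto simp: ok_def d7_def goto_def)
  have p24: "pres d1 d3 (C * t - 8 * length es)" using d2(4) by (simp add: pres_def d3_def)
  have p4: "pres c d4 (2 + (C * t - 8 * length es + 2 * length vs))"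
    using pres_trans[OF d1(3) pres_trans[OF p24 d4(3)]] .
  have p5: "pres c d5 (2 + (C * t - 8 * length es + 2 * length vs))" using p4 by (simp add: pres_def d5_def)
  have p6: "pres c d6 (C * t + 4)"
    by (rule pres_mono[OF pres_trans[OF p5 d6(3)]]) (use d2(1) len in simp)
  have p7: "pres c d7 (C * t + 4)" using p6 by (simp add: pres_def d7_def goto_def)
  have in7: "inpok d7" using inpok_pres[OF p7 ok] .
  have hp7: "regs d7 3 + int (C * s) \<le> W" using pres_hp[OF p7] hp CC unfolding of_nat_add of_nat_numeral by linarith
  have env7: "lr d7 0 (regs d7 1) (rev vs)"
    using d4(5) d6(6)[of 1] pres_lrep[OF d6(3), of 0 "regs d5 1" "rev vs"] by (simp add: d5_def d7_def goto_def)
  define fb where "fb = comp_exp adr (adr f) (length vs) (snd (\<Phi> ! f))"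
  have codef: "code_at P (adr f) (fb @ [Jump disp])" and dispf: "adr f + length fb \<le> disp"
    using bodies[OF f(1)] bodies_disp[OF f(1)] f(2) by (simp_all add: fb_def)
  have W0: "\<bar>0 :: int\<bar> \<le> W" using hp1 h0 lo_pos by simp
  obtain n8 d8 where d8: "n8 \<le> C * s" "exec n8 d7 d8" "pc d8 = adr f + length fb"
    "res d7 d8 (C * s)" "vr d8 (regs d8 0) v"
    using goodD[OF g _ _ ok7 in7 hp7 W0 env7] codef dispf
    by (auto simp: d7_def goto_def fb_def code_at_append)
  define d9 where "d9 = goto disp d8"
  have e9: "exec (Suc 0) d8 d9" using codef d8(3) by (simp add: exec_Suc code_at_append code_at_Cons d9_def)
  have ok9: "ok d9" using res_ok[OF d8(4) ok7] by (simp add: ok_def d9_def goto_def)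
  have hd8: "regs d7 3 \<le> regs d8 3" "regs d8 3 \<le> regs d7 3 + int (C * s)" "same (regs d7 3) (mem d7) (mem d8)"
    using d8(4) by (auto simp: res_def pres_def)
  have m9: "mem d9 (nat (regs d5 3)) = int ret" "mem d9 (nat (regs d5 3 + 1)) = regs d1 2" "regs d9 2 = regs d5 3"
    "regs d5 3 + 1 < regs d9 3" "regs d9 3 \<le> W"
    using hd8 d6 h5 lo_pos d8(4) d4(4) hp7 unfolding same_def
    by (auto simp: d9_def d7_def goto_def d5_def res_def simp del: of_nat_mult)
  have code9: "code_at P (pc d9) (cpop 7)" "code_at P (pc d9 + 3) (cdisp disp)"
    using dispatch by (simp_all add: d9_def goto_def code_at_append)
  obtain d10 where d10: "exec 3 d9 d10" "pc d10 = pc d9 + 3" "pres d9 d10 0" "regs d10 7 = mem d9 (nat (regs d9 2))"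
    "regs d10 2 = mem d9 (nat (regs d9 2 + 1))" "\<And>q. q \<notin> {7, 2, 4} \<Longrightarrow> regs d10 q = regs d9 q" "mem d10 = mem d9"
    using exec_cpop[OF code9(1) ok9] m9 h5 retd PW W2 by auto
  have "regs d10 7 = int ret" using d10(4) m9 by simp
  from exec_cdisp[OF _ retd this PW] code9(2) d10(2)
  obtain n11 d11 where d11: "n11 \<le> 2 * disp" "exec n11 d10 d11" "pc d11 = ret" "pres d10 d11 0" "mem d11 = mem d10"
    "\<forall>q. q \<noteq> 4 \<longrightarrow> regs d11 q = regs d10 q" by auto
  have code11: "code_at P (pc d11) (cpop 1)"
    using codeB d11(3) by (simp add: pc4 ret_def len code_at_append code_at_Cons add.assoc numeral_eq_Suc)
  have r11: "regs d11 2 = regs c 3" "regs d11 3 = regs d8 3" "mem d11 = mem d8" "regs d11 0 = regs d8 0"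
    using d11(5,6) d10 m9 d1(4) by (simp_all add: d9_def goto_def)
  have ok11: "ok d11" using ok9 d10 d11 m9 W2 by (auto simp: ok_def)
  \<comment> \<open>The saved environment has been below the end of the heap ever since the push, so
    evaluating the arguments and the body has left it intact.\<close>
  have m11: "mem d11 (nat (regs c 3)) = regs c 1" "mem d11 (nat (regs c 3 + 1)) = regs c 2"
  proof -
    have "pres d1 d6 (C * t - 8 * length es + 2 * length vs + 2)"
      using pres_trans[OF pres_trans[OF p24 d4(3)], of d6 2] d6(3) by (simp add: pres_def d5_def)
    then have "same (regs d1 3) (mem d1) (mem d7)" by (simp add: pres_def d7_def goto_def)
    then show "mem d11 (nat (regs c 3)) = regs c 1" "mem d11 (nat (regs c 3 + 1)) = regs c 2"
      using hd8(3) pres_hp[OF p7] d1(5,7,8) h0 lo_pos pres_hp[OF d6(3)] hd4 hd2 unfolding same_def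
      by (simp_all add: r11 d7_def d5_def goto_def del: of_nat_mult)
  qed
  have b11: "regs c 3 + 1 < regs d8 3" using hd8 hd4 hd2 d1(5) d6(5) by (simp add: d7_def d5_def goto_def)
  obtain c' where c': "exec 3 d11 c'" "pc c' = pc d11 + 3" "pres d11 c' 0" "regs c' 1 = mem d11 (nat (regs d11 2))"
    "regs c' 2 = mem d11 (nat (regs d11 2 + 1))" "\<And>q. q \<notin> {1, 2, 4} \<Longrightarrow> regs c' q = regs d11 q" "mem c' = mem d11"
    using exec_cpop[OF code11 ok11] m11 r11 h0 b11 m9(5) ok by (auto simp: ok_def d9_def goto_def)
  have "exec (5 + n + Suc 0 + 8 * length vs + Suc 0 + 5 + Suc 0 + n8 + Suc 0 + 3 + n11 + 3) c c'"
    by (rule exec_trans[OF exec_trans[OF exec_trans[OF exec_trans[OF exec_trans[OF exec_trans[OF exec_trans[OF exec_trans[OF exec_trans[OF exec_trans[OF exec_trans[OF d1(1) d2(2)] e3] d4(1)] e5] d6(1)] e7] d8(2)] e9] d10(1)] d11(2)] c'(1)])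
  moreover have "5 + n + Suc 0 + 8 * length vs + Suc 0 + 5 + Suc 0 + n8 + Suc 0 + 3 + n11 + 3 \<le> C * (t + s + 1)"
    using d2(1) d8(1) d11(1) C len by (simp add: distrib_left)
  moreover have "pres c d8 (C * t + 4 + C * s)" using pres_trans[OF p7] d8(4) by (auto simp: res_def)
  then have "pres c d8 (C * (t + s + 1))" by (rule pres_mono) (use C in \<open>simp add: distrib_left\<close>)
  then have "res c c' (C * (t + s + 1))"
    using c' r11 m11 d10 d11(6) by (auto simp: res_def pres_def d9_def goto_def)
  moreover have "pc c' = pc c + length (ce env (pc c) (Cl f es))"
    unfolding e'' using c'(2) d11(3) by (simp add: ret_def lenargs)
  moreover have "vr c' (regs c' 0) v" using c' r11 d8(5) by simp
  ultimately show "reach c (ce env (pc c) (Cl f es)) v (t + s + 1)"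
    by blast
qed

lemma good_ev:
  "ev \<Phi> inp W env e v t \<Longrightarrow> good env e v t"
  "evs \<Phi> inp W env es vs t \<Longrightarrow> goods env es vs t"
proof (induction rule: ev_evs.inducts)
  case (3 env e x t)
  have "\<bar>inp ! nat x\<bar> \<le> W" using 3 inp(2)[of "inp ! nat x"] by simp
  then show ?case by (intro good_load[OF 3(2)]) (use 3 in \<open>auto simp: inpok_def\<close>)
next
  case (4 env e a b t)
  then show ?case by (intro good_load[OF 4(2)]) (use lo_pos in auto)
next
  case (7 env e1 x t1 e2 y t2)
  show ?case by (rule good_arith[OF 7(2,4), where f = Plus]) (use 7 in auto)
next
  case (8 env e1 x t1 e2 y t2)
  show ?case by (rule good_arith[OF 8(2,4), where f = Minus]) (use 8 in auto)
next
  case (11 env a x t1 b y t2 e1 e2 w s)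
  show ?case by (rule good_compare[where R = "(=)", OF 11(2,4,6), where J = "JumpEq 7 0"]) (auto simp: Let_def)
next
  case (12 env a x t1 b y t2 e1 e2 w s)
  show ?case by (rule good_compare[where R = "(<)", OF 12(2,4,6), where J = "JumpLess 7 0"]) (auto simp: Let_def)
next
  case (14 env)
  show ?case unfolding goods_def by (auto intro!: exI[of _ 0] simp: pres_def)
qed (blast intro: good_Lc good_Nm good_Tl good_Pr good_Lt good_IfZ good_Cl goods_Cons)+

end

section \<open>Assembling the complete program\<close>

definition clen :: "nat \<Rightarrow> exp \<Rightarrow> nat" where
  "clen d e = length (comp_exp (\<lambda>_. 0) 0 d e)"

text \<open>Addresses occur only as operands and never influence the number of instructions. This
  breaks a circle: function addresses are computed from code lengths, although the code mentions
  these addresses.\<close>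

lemma length_comp_exp: "length (comp_exp adr p d e) = length (comp_exp adr' p' d e)"
  and length_comp_exps: "length (comp_exps adr p d es) = length (comp_exps adr' p' d es)"
proof (induction adr p d e and adr p d es arbitrary: p' and p' rule: comp_exp_comp_exps.induct)
  case (6 adr p d e1 e2)
  show ?case using 6(1)[of p'] 6(2)[OF refl] by (simp add: Let_def)
next
  case (7 adr p d e1 e2)
  show ?case using 7(1)[of p'] 7(2)[OF refl] by (simp add: Let_def)
next
  case (8 adr p d e1 e2)
  show ?case using 8(1)[of p'] 8(2)[OF refl] by (simp add: Let_def)
next
  case (9 adr p d e1 e2)
  show ?case using 9(1)[of p'] 9(2)[OF refl] by (simp add: Let_def)
next
  case (10 adr p d e e1 e2)
  show ?case using 10(1)[of p'] 10(2)[OF refl] 10(3)[OF refl refl refl] by (simp add: Let_def)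
next
  case (11 adr p d a b e1 e2)
  show ?case using 11(1)[of p'] 11(2)[OF refl] 11(3)[OF refl refl] 11(4)[OF refl refl refl refl] by (simp add: Let_def)
next
  case (12 adr p d a b e1 e2)
  show ?case using 12(1)[of p'] 12(2)[OF refl] 12(3)[OF refl refl] 12(4)[OF refl refl refl refl] by (simp add: Let_def)
next
  case (13 adr p d f es)
  show ?case using 13(1)[of "p' + 5"] by (simp add: Let_def)
next
  case (15 adr p d e es)
  show ?case using 15(1)[of p'] 15(2)[OF refl] by (simp add: Let_def)
qed (simp_all add: Let_def)

lemma length_comp_exp_clen: "length (comp_exp adr p d e) = clen d e"
  unfolding clen_def by (rule length_comp_exp)

text \<open>The heap starts at twice the number of runs, just behind the input. Register 1 initially
  holds the second count but is to hold the environment, so the count is first saved in register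
  7.\<close>

definition prelude :: "instr list" where
  "prelude = [Const 6 1, Arith Plus 3 0 1, Arith Plus 3 3 3, Copy 7 1] @ ccons 1 0 5 @ ccons 1 7 1"

text \<open>15 is the length of \<open>prelude\<close> plus the \<open>Halt\<close> behind the main
  expression; \<open>Suc\<close> counts the jump to the dispatcher that follows each body.\<close>

definition entry :: "(nat \<times> exp) list \<Rightarrow> exp \<Rightarrow> nat \<Rightarrow> nat" where
  "entry \<Phi> e f = 15 + clen 2 e + (\<Sum>g<f. Suc (clen (fst (\<Phi> ! g)) (snd (\<Phi> ! g))))"

definition compile :: "(nat \<times> exp) list \<Rightarrow> exp \<Rightarrow> program" where
  "compile \<Phi> e = (let adr = entry \<Phi> e; d = adr (length \<Phi>) in
    prelude @ comp_exp adr 14 2 e @ [Halt] @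
    concat (map (\<lambda>f. comp_exp adr (adr f) (fst (\<Phi> ! f)) (snd (\<Phi> ! f)) @ [Jump d]) [0..<length \<Phi>]) @
    cpop 7 @ cdisp d)"

lemma code_at_concat:
  assumes "code_at P (g 0) (concat (map F [0..<n]))" "\<And>f. f < n \<Longrightarrow> g (Suc f) = g f + length (F f)"
  shows "(\<forall>f < n. code_at P (g f) (F f)) \<and> length (concat (map F [0..<n])) + g 0 = g n"
  using assms
proof (induction n)
  case (Suc n)
  have "code_at P (g 0) (concat (map F [0..<n]))" using Suc.prems(1) by (simp add: code_at_append)
  then have IH: "(\<forall>f < n. code_at P (g f) (F f)) \<and> length (concat (map F [0..<n])) + g 0 = g n"
    using Suc by simp
  then have "code_at P (g n) (F n)" using Suc.prems(1) by (simp add: code_at_append add.commute)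
  then show ?case using IH Suc.prems(2)[of n] by (auto simp: less_Suc_eq)
qed simp

lemma code_at_self: "code_at P 0 P" by (simp add: code_at_def)

text \<open>Nothing is ever freed, so a word must hold all addresses of the input, of four cells for
  the initial environment and of \<open>C\<close> cells per unit of cost. A nonempty first list
  makes the heap start at a positive address.\<close>

theorem compile_correct:
  fixes r s :: "(word \<times> nat) list" and \<Phi> :: "(nat \<times> exp) list" and e :: exp
  defines "inp \<equiv> encode_runs r @ encode_runs s" and "P \<equiv> compile \<Phi> e"
  defines "C \<equiv> 2 * length P + 40"
  assumes ev: "ev \<Phi> inp W [VI (int (length r)), VI (int (length s))] e (VI x) t"
    and ne: "r \<noteq> []" and inp: "\<And>x. x \<in> set inp \<Longrightarrow> \<bar>x\<bar> \<le> W"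
    and W: "2 * int (length r + length s) + 4 + int (C * t) \<le> W" "int (length P) \<le> W"
  shows "\<exists>T. halts_with W P (initial_config r s) T x \<and> T \<le> C * (t + 1)"
proof -
  define adr where "adr = entry \<Phi> e"
  define d where "d = adr (length \<Phi>)"
  define F where "F f = comp_exp adr (adr f) (fst (\<Phi> ! f)) (snd (\<Phi> ! f)) @ [Jump d]" for f
  have Peq: "P = prelude @ comp_exp adr 14 2 e @ [Halt] @ concat (map F [0..<length \<Phi>]) @ cpop 7 @ cdisp d"
    unfolding P_def compile_def Let_def adr_def[symmetric] d_def[symmetric] F_def ..
  have lpre: "length prelude = 14" by (simp add: prelude_def)
  have adr0: "adr 0 = 15 + clen 2 e" by (simp add: adr_def entry_def)
  have "code_at P 0 (prelude @ comp_exp adr 14 2 e @ [Halt] @ concat (map F [0..<length \<Phi>]) @ cpop 7 @ cdisp d)"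
    using code_at_self[of P] Peq by simp
  then have codes: "code_at P 0 prelude" "code_at P 14 (comp_exp adr 14 2 e)" "code_at P (14 + clen 2 e) [Halt]"
    "code_at P (adr 0) (concat (map F [0..<length \<Phi>]))"
    "code_at P (adr 0 + length (concat (map F [0..<length \<Phi>]))) (cpop 7 @ cdisp d)"
    unfolding code_at_append lpre length_comp_exp_clen by (simp_all add: adr0 add.assoc)
  have suc: "adr (Suc f) = adr f + length (F f)" if "f < length \<Phi>" for f
    by (simp add: adr_def entry_def F_def length_comp_exp_clen)
  from code_at_concat[of P adr F "length \<Phi>", OF codes(4) suc]
  have bod: "\<And>f. f < length \<Phi> \<Longrightarrow> code_at P (adr f) (F f)"
    and len: "length (concat (map F [0..<length \<Phi>])) + adr 0 = d" by (auto simp: d_def)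
  have dP: "d \<le> length P" using len unfolding Peq by (simp add: lpre length_comp_exp_clen adr0)
  have adr_mono: "adr (Suc f) \<le> d" if "f < length \<Phi>" for f
    unfolding adr_def d_def entry_def using that by (intro add_left_mono sum_mono2) auto
  have linp: "length inp = 2 * (length r + length s)"
  proof -
    have "length (encode_runs q) = 2 * length q" for q
      by (induction q) (auto simp: encode_runs_def)
    then show ?thesis by (simp add: inp_def)
  qed
  define lo where "lo = int (length inp)"
  interpret compiled W P lo \<Phi> inp adr d C
  proof
    show "0 < lo" using ne by (cases r) (auto simp: lo_def linp)
    show "code_at P (adr f) (comp_exp adr (adr f) (fst (\<Phi> ! f)) (snd (\<Phi> ! f)) @ [Jump d])" if "f < length \<Phi>" for f
      using bod[OF that] by (simp add: F_def)
    show "adr f + length (comp_exp adr (adr f) (fst (\<Phi> ! f)) (snd (\<Phi> ! f))) \<le> d" if "f < length \<Phi>" for f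
      using suc[OF that] adr_mono[OF that] by (simp add: F_def)
    show "code_at P d (cpop 7 @ cdisp d)" using codes(5) len by (simp add: add.commute)
    show "int d \<le> W" using dP W(2) by simp
    show "int (length inp) \<le> lo" by (simp add: lo_def)
    show "2 * d + 40 \<le> C" using dP by (simp add: C_def)
  qed (use inp in auto)
  define c0 where "c0 = initial_config r s"
  define n where "n = int (length r)"
  define m where "m = int (length s)"
  have nm: "0 < n" "0 \<le> m" "lo = 2 * (n + m)" using ne by (simp_all add: n_def m_def lo_def linp)
  have hW: "lo + 4 + int (C * t) \<le> W" using W(1) by (simp add: lo_def linp del: of_nat_mult)
  have hW4: "lo + 4 \<le> W" using hW of_nat_0_le_iff[of "C * t"] by linarith
  define c1 where "c1 = c0\<lparr>regs := (regs c0)(6 := 1, 3 := n + m, 3 := 2 * (n + m), 7 := m), pc := 4\<rparr>"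
  have r0: "regs c0 0 = n" "regs c0 (Suc 0) = m" "pc c0 = 0" "\<And>q. 1 < q \<Longrightarrow> regs c0 q = 0"
    "\<And>i. i < length inp \<Longrightarrow> mem c0 i = inp ! i"
    by (simp_all add: c0_def initial_config_def n_def m_def inp_def Let_def)
  have e1: "exec (Suc (Suc (Suc (Suc 0)))) c0 c1"
    using codes(1) r0 hW4 nm
    by (simp add: exec_Suc prelude_def code_at_append code_at_Cons set_reg_def advance_def goto_def c1_def)
  have ok1: "ok c1" unfolding ok_def using r0 nm hW4 by (simp add: c1_def)
  have in1: "inpok c1" using r0 by (simp add: inpok_def c1_def)
  have code1: "code_at P (pc c1) (ccons 1 0 5)" "code_at P (pc c1 + 5) (ccons 1 7 1)"
    using codes(1) by (simp_all add: prelude_def code_at_append code_at_Cons c1_def numeral_eq_Suc)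
  have h1: "regs c1 3 = lo" using nm by (simp add: c1_def)
  have hp1: "regs c1 3 + 2 \<le> W" using h1 hW4 by simp
  obtain c2 where c2: "exec 5 c1 c2" "pc c2 = pc c1 + 5" "pres c1 c2 2" "regs c2 1 = regs c1 3"
    "regs c2 3 = regs c1 3 + 2" "\<And>r. r \<notin> {1, 3, 4} \<Longrightarrow> regs c2 r = regs c1 r"
    "mem c2 (nat (regs c1 3)) = regs c1 0" "mem c2 (nat (regs c1 3 + 1)) = regs c1 5"
    using exec_ccons[OF code1(1) ok1 hp1] by auto
  have ok2: "ok c2" using ok1 c2 h1 hW4 lo_pos by (auto simp: ok_def)
  have hp2: "regs c2 3 + 2 \<le> W" using h1 c2 hW4 by simp
  have code2: "code_at P (pc c2) (ccons 1 7 1)" using code1 c2(2) by simp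
  obtain c3 where c3: "exec 5 c2 c3" "pc c3 = pc c2 + 5" "pres c2 c3 2" "regs c3 1 = regs c2 3"
    "regs c3 3 = regs c2 3 + 2" "\<And>r. r \<notin> {1, 3, 4} \<Longrightarrow> regs c3 r = regs c2 r"
    "mem c3 (nat (regs c2 3)) = regs c2 7" "mem c3 (nat (regs c2 3 + 1)) = regs c2 1"
    using exec_ccons[OF code2 ok2 hp2] by auto
  have ok3: "ok c3" using ok2 c3 c2 h1 hW4 lo_pos by (auto simp: ok_def)
  have in3: "inpok c3" using inpok_pres[OF c3(3) ok2 inpok_pres[OF c2(3) ok1 in1]] .
  have pc3: "pc c3 = 14" using c2(2) c3(2) by (simp add: c1_def)
  have r1: "regs c1 0 = n" "regs c1 5 = 0" "regs c1 7 = m" using r0 by (simp_all add: c1_def)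
  have nW: "n \<le> W" "m \<le> W" using nm hW4 by simp_all
  have env1: "lr c2 0 (regs c2 1) [VI n]"
    using c2(4,5,7,8) h1 r1 nW nm(1) by simp
  have env: "lr c3 0 (regs c3 1) (rev [VI n, VI m])"
    using pres_lrep[OF c3(3) env1] c3(4,5,7,8) c2(5) c2(6)[of 7] h1 r1 nW nm(2) by simp
  have hp3: "regs c3 3 + int (C * t) \<le> W" using c3(5) c2(5) h1 hW by linarith
  have g: "good [VI n, VI m] e (VI x) t" using good_ev(1)[OF ev] by (simp add: n_def m_def)
  have d14: "14 + clen 2 e \<le> d" using len adr0 by simp
  have W0: "\<bar>0 :: int\<bar> \<le> W" using hW4 lo_pos by simp
  obtain k c4 where c4: "k \<le> C * t" "exec k c3 c4" "pc c4 = 14 + clen 2 e"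
     "res c3 c4 (C * t)" "vr c4 (regs c4 0) (VI x)"
    using goodD[OF g _ _ ok3 in3 hp3 W0 env] codes(2) d14 by (auto simp: pc3 length_comp_exp_clen numeral_2_eq_2)
  have "exec (Suc (Suc (Suc (Suc 0))) + 5 + 5 + k) c0 c4"
    by (rule exec_trans[OF exec_trans[OF exec_trans[OF e1 c2(1)] c3(1)] c4(2)])
  then have "halts_with W P c0 (Suc (Suc (Suc (Suc 0))) + 5 + 5 + k) x"
    using codes(3) c4(3,5) unfolding halts_with_def exec_def by (auto simp: code_at_Cons)
  moreover have "Suc (Suc (Suc (Suc 0))) + 5 + 5 + k \<le> C * (t + 1)" using c4(1) by (simp add: C_def)
  ultimately show ?thesis unfolding c0_def by blast
qed

section \<open>Trees with lazy maps\<close>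

lemma comp_map_assoc: "comp_map \<mu> (comp_map \<nu> m) = comp_map (comp_map \<mu> \<nu>) m"
  by (simp add: comp_map_def select_def get_def)

definition id_map :: trip where "id_map = Trip (0, 0) (1, 0) (2, 0)"

lemma comp_map_id_map [simp]: "comp_map id_map m = m"
  by (cases m) (simp add: comp_map_def select_def get_def id_map_def)

lemma map_comp_map_id_map [simp]: "map (comp_map id_map) xs = xs"
  by (induction xs) simp_all

definition comp_min :: "comp \<Rightarrow> comp \<Rightarrow> comp" where
  "comp_min x y = (0, if snd x < snd y then snd x else snd y)"

definition trip_min :: "trip \<Rightarrow> trip \<Rightarrow> trip" where
  "trip_min x y = Trip (comp_min (tv x) (tv y)) (comp_min (ta x) (ta y)) (comp_min (tb x) (tb y))"

text \<open>2-3 trees with the data at the leaves.  Every tree carries a map that is to be applied to all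
  its leaves; inner nodes also store their height, the componentwise minimum of the leaves and the
  last leaf, all before the map is applied.\<close>

datatype tree =
    Lf trip
  | N2 trip int trip trip tree tree
  | N3 trip int trip trip tree tree tree

fun leaves :: "tree \<Rightarrow> trip list" where
  "leaves (Lf m) = [m]"
| "leaves (N2 m h g l a b) = map (comp_map m) (leaves a @ leaves b)"
| "leaves (N3 m h g l a b c) = map (comp_map m) (leaves a @ leaves b @ leaves c)"

fun apply_map :: "trip \<Rightarrow> tree \<Rightarrow> tree" where
  "apply_map \<mu> (Lf m) = Lf (comp_map \<mu> m)"
| "apply_map \<mu> (N2 m h g l a b) = N2 (comp_map \<mu> m) h g l a b"
| "apply_map \<mu> (N3 m h g l a b c) = N3 (comp_map \<mu> m) h g l a b c"

fun height :: "tree \<Rightarrow> int" where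
  "height (Lf m) = 0"
| "height (N2 m h g l a b) = h"
| "height (N3 m h g l a b c) = h"

fun tree_min :: "tree \<Rightarrow> trip" where
  "tree_min (Lf m) = m"
| "tree_min (N2 m h g l a b) = comp_map m g"
| "tree_min (N3 m h g l a b c) = comp_map m g"

fun last_leaf :: "tree \<Rightarrow> trip" where
  "last_leaf (Lf m) = m"
| "last_leaf (N2 m h g l a b) = comp_map m l"
| "last_leaf (N3 m h g l a b c) = comp_map m l"

definition node2 :: "tree \<Rightarrow> tree \<Rightarrow> tree" where
  "node2 a b = N2 id_map (height a + 1) (trip_min (tree_min a) (tree_min b)) (last_leaf b) a b"

definition node3 :: "tree \<Rightarrow> tree \<Rightarrow> tree \<Rightarrow> tree" where
  "node3 a b c = N3 id_map (height a + 1) (trip_min (tree_min a) (trip_min (tree_min b) (tree_min c))) (last_leaf c) a b c"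

fun wf_tree :: "tree \<Rightarrow> bool" where
  "wf_tree (Lf m) \<longleftrightarrow> True"
| "wf_tree (N2 m h g l a b) \<longleftrightarrow> wf_tree a \<and> wf_tree b \<and> height b = height a \<and> h = height a + 1 \<and> g = trip_min (tree_min a) (tree_min b) \<and> l = last_leaf b"
| "wf_tree (N3 m h g l a b c) \<longleftrightarrow> wf_tree a \<and> wf_tree b \<and> wf_tree c \<and> height b = height a \<and> height c = height a \<and> h = height a + 1 \<and>
     g = trip_min (tree_min a) (trip_min (tree_min b) (tree_min c)) \<and> l = last_leaf c"

lemma leaves_apply_map [simp]: "leaves (apply_map \<mu> t) = map (comp_map \<mu>) (leaves t)"
  by (cases t) (simp_all add: comp_map_assoc)

lemma height_apply_map [simp]: "height (apply_map \<mu> t) = height t" by (cases t) simp_all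
lemma wf_tree_apply_map [simp]: "wf_tree (apply_map \<mu> t) = wf_tree t" by (cases t) simp_all
lemma size_apply_map [simp]: "size (apply_map \<mu> t) = size t" by (cases t) simp_all

lemma leaves_nd [simp]: "leaves (node2 a b) = leaves a @ leaves b" "leaves (node3 a b c) = leaves a @ leaves b @ leaves c"
  by (simp_all add: node2_def node3_def)

lemma height_nd [simp]: "height (node2 a b) = height a + 1" "height (node3 a b c) = height a + 1"
  by (simp_all add: node2_def node3_def)

lemma wf_tree_nd: "wf_tree a \<Longrightarrow> wf_tree b \<Longrightarrow> height b = height a \<Longrightarrow> wf_tree (node2 a b)"
  "wf_tree a \<Longrightarrow> wf_tree b \<Longrightarrow> wf_tree c \<Longrightarrow> height b = height a \<Longrightarrow> height c = height a \<Longrightarrow> wf_tree (node3 a b c)"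
  by (simp_all add: node2_def node3_def)

lemma leaves_ne [simp]: "leaves t \<noteq> []"
  by (induction t) simp_all

lemma height_nonneg: "wf_tree t \<Longrightarrow> 0 \<le> height t"
  by (induction t) auto

text \<open>The source of all logarithms: every inner node has at least two children of equal
  height.\<close>

lemma height_length: "wf_tree t \<Longrightarrow> 2 ^ nat (height t) \<le> length (leaves t)"
proof (induction t)
  case (N2 m h g l a b)
  then have "nat h = Suc (nat (height a))" using height_nonneg[of a] by (simp add: nat_add_distrib)
  then show ?case using N2 by simp
next
  case (N3 m h g l a b c)
  then have "nat h = Suc (nat (height a))" using height_nonneg[of a] by (simp add: nat_add_distrib)
  then show ?case using N3 by simp
qed simp

lemma last_leaf_last: "wf_tree t \<Longrightarrow> last_leaf t = last (leaves t)"
  by (induction t) (simp_all add: last_map)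

lemma get_comp_map: "get (comp_map m x) s = select x (get m s)"
  by (simp add: get_def comp_map_def)

lemma get_trip_min: "snd (get (trip_min x y) s) = min (snd (get x s)) (snd (get y s))"
  by (simp add: get_def trip_min_def comp_min_def)

lemma Min_image_add:
  fixes f :: "'a \<Rightarrow> int"
  assumes "finite A" "A \<noteq> {}"
  shows "Min ((\<lambda>x. f x + k) ` A) = Min (f ` A) + k"
proof (rule Min_eqI)
  have "Min (f ` A) \<in> f ` A" using assms by (intro Min_in) auto
  then obtain y where "y \<in> A" "Min (f ` A) = f y" by blast
  then show "Min (f ` A) + k \<in> (\<lambda>x. f x + k) ` A" by auto
qed (use assms in auto)

text \<open>Component \<open>s\<close> of a mapped leaf is component \<open>fst (get m s)\<close> of
  the leaf plus a constant, and adding a constant commutes with the minimum. So the minima stored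
  before the map determine those after it. All three are kept, as a map may select any of
  them.\<close>

lemma tree_min_Min: "wf_tree t \<Longrightarrow> snd (get (tree_min t) s) = Min ((\<lambda>x. snd (get x s)) ` set (leaves t))"
proof (induction t arbitrary: s)
  case (N2 m h g l a b)
  have "snd (get (tree_min (N2 m h g l a b)) s) = min (snd (get (tree_min a) (fst (get m s)))) (snd (get (tree_min b) (fst (get m s)))) + snd (get m s)"
    using N2.prems by (simp add: get_comp_map select_def get_trip_min)
  also have "\<dots> = Min ((\<lambda>x. snd (get x (fst (get m s)))) ` (set (leaves a) \<union> set (leaves b))) + snd (get m s)"
    using N2 by (simp add: image_Un Min_Un)
  also have "\<dots> = Min ((\<lambda>x. snd (get x (fst (get m s))) + snd (get m s)) ` (set (leaves a) \<union> set (leaves b)))"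
    by (rule Min_image_add[symmetric]) auto
  finally show ?case by (simp add: image_image get_comp_map select_def image_Un)
next
  case (N3 m h g l a b c)
  have "snd (get (tree_min (N3 m h g l a b c)) s) = min (snd (get (tree_min a) (fst (get m s)))) (min (snd (get (tree_min b) (fst (get m s)))) (snd (get (tree_min c) (fst (get m s))))) + snd (get m s)"
    using N3.prems by (simp add: get_comp_map select_def get_trip_min)
  also have "\<dots> = Min ((\<lambda>x. snd (get x (fst (get m s)))) ` (set (leaves a) \<union> (set (leaves b) \<union> set (leaves c)))) + snd (get m s)"
    using N3 by (simp add: image_Un Min_Un)
  also have "\<dots> = Min ((\<lambda>x. snd (get x (fst (get m s))) + snd (get m s)) ` (set (leaves a) \<union> (set (leaves b) \<union> set (leaves c))))"
    by (rule Min_image_add[symmetric]) auto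
  finally show ?case by (simp add: image_image get_comp_map select_def image_Un)
qed simp

section \<open>Bounds on the integers in a tree\<close>

definition trip_bound :: "int \<Rightarrow> trip \<Rightarrow> bool" where
  "trip_bound K m \<longleftrightarrow> \<bar>snd (tv m)\<bar> \<le> K \<and> \<bar>snd (ta m)\<bar> \<le> K \<and> \<bar>snd (tb m)\<bar> \<le> K"

lemma trip_bound_get: "trip_bound K m \<Longrightarrow> \<bar>snd (get m s)\<bar> \<le> K" by (simp add: trip_bound_def get_def)

lemma trip_bound_comp_map: "trip_bound J \<mu> \<Longrightarrow> trip_bound K m \<Longrightarrow> trip_bound (J + K) (comp_map \<mu> m)"
  using trip_bound_get[of K m] by (simp add: trip_bound_def[of "J + K"] comp_map_def select_def trip_bound_def[of J]) (smt (verit))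

lemma trip_bound_mono: "trip_bound K m \<Longrightarrow> K \<le> K' \<Longrightarrow> trip_bound K' m" by (auto simp: trip_bound_def)

lemma trip_bound_trip_min: "trip_bound K x \<Longrightarrow> trip_bound K y \<Longrightarrow> trip_bound K (trip_min x y)" by (simp add: trip_bound_def trip_min_def comp_min_def)

lemma trip_bound_id_map: "trip_bound 0 id_map" by (simp add: trip_bound_def id_map_def)

text \<open>All integers that arise from the tree by pushing maps towards the leaves are at most \<open>K\<close>.\<close>

fun tree_bound :: "int \<Rightarrow> tree \<Rightarrow> bool" where
  "tree_bound K (Lf m) \<longleftrightarrow> trip_bound K m"
| "tree_bound K (N2 m h g l a b) \<longleftrightarrow> (\<exists>k. trip_bound k m \<and> trip_bound (K - k) g \<and> trip_bound (K - k) l \<and> tree_bound (K - k) a \<and> tree_bound (K - k) b)"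
| "tree_bound K (N3 m h g l a b c) \<longleftrightarrow> (\<exists>k. trip_bound k m \<and> trip_bound (K - k) g \<and> trip_bound (K - k) l \<and> tree_bound (K - k) a \<and> tree_bound (K - k) b \<and> tree_bound (K - k) c)"

lemma tree_bound_mono: "tree_bound K t \<Longrightarrow> K \<le> K' \<Longrightarrow> tree_bound K' t"
proof (induction t arbitrary: K K')
  case (N2 m h g l a b)
  then obtain k where "trip_bound k m \<and> trip_bound (K - k) g \<and> trip_bound (K - k) l \<and> tree_bound (K - k) a \<and> tree_bound (K - k) b" by auto
  then show ?case using N2.IH(1)[of "K - k" "K' - k"] N2.IH(2)[of "K - k" "K' - k"] trip_bound_mono N2.prems(2)
    by (fastforce intro!: exI[of _ k])
next
  case (N3 m h g l a b c)
  then obtain k where "trip_bound k m \<and> trip_bound (K - k) g \<and> trip_bound (K - k) l \<and> tree_bound (K - k) a \<and> tree_bound (K - k) b \<and> tree_bound (K - k) c" by auto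
  then show ?case using N3.IH(1)[of "K - k" "K' - k"] N3.IH(2)[of "K - k" "K' - k"] N3.IH(3)[of "K - k" "K' - k"] trip_bound_mono N3.prems(2)
    by (fastforce intro!: exI[of _ k])
qed (auto intro: trip_bound_mono)

lemma tree_bound_apply_map: "trip_bound J \<mu> \<Longrightarrow> tree_bound K t \<Longrightarrow> tree_bound (J + K) (apply_map \<mu> t)"
proof (cases t)
  case (N2 m h g l a b)
  assume "trip_bound J \<mu>" "tree_bound K t"
  then obtain k where "trip_bound k m \<and> trip_bound (K - k) g \<and> trip_bound (K - k) l \<and> tree_bound (K - k) a \<and> tree_bound (K - k) b" using N2 by auto
  then show ?thesis using N2 trip_bound_comp_map[OF \<open>trip_bound J \<mu>\<close>, of k m] by (auto intro!: exI[of _ "J + k"])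
next
  case (N3 m h g l a b c)
  assume "trip_bound J \<mu>" "tree_bound K t"
  then obtain k where "trip_bound k m \<and> trip_bound (K - k) g \<and> trip_bound (K - k) l \<and> tree_bound (K - k) a \<and> tree_bound (K - k) b \<and> tree_bound (K - k) c" using N3 by auto
  then show ?thesis using N3 trip_bound_comp_map[OF \<open>trip_bound J \<mu>\<close>, of k m] by (auto intro!: exI[of _ "J + k"])
qed (auto intro: trip_bound_comp_map)

text \<open>In \<open>tree_bound\<close> the share \<open>k\<close> of the pending map is deducted
  before descending, so pushing the map down to a child restores exactly the bound of the
  parent.\<close>

lemma tree_bound_kids:
  "tree_bound K (N2 m h g l a b) \<Longrightarrow> tree_bound K (apply_map m a) \<and> tree_bound K (apply_map m b)"
  "tree_bound K (N3 m h g l a b c) \<Longrightarrow> tree_bound K (apply_map m a) \<and> tree_bound K (apply_map m b) \<and> tree_bound K (apply_map m c)"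
  using tree_bound_apply_map[of _ m "K - _"] by fastforce+

lemma tree_bound_tree_min: "tree_bound K t \<Longrightarrow> trip_bound K (tree_min t)"
  using trip_bound_comp_map[of _ _ "K - _"] by (cases t) fastforce+

lemma tree_bound_last_leaf: "tree_bound K t \<Longrightarrow> trip_bound K (last_leaf t)"
  using trip_bound_comp_map[of _ _ "K - _"] by (cases t) fastforce+

lemma tree_bound_nd:
  "tree_bound K a \<Longrightarrow> tree_bound K b \<Longrightarrow> tree_bound K (node2 a b)"
  "tree_bound K a \<Longrightarrow> tree_bound K b \<Longrightarrow> tree_bound K c \<Longrightarrow> tree_bound K (node3 a b c)"
  by (auto simp: node2_def node3_def intro!: exI[of _ 0] trip_bound_id_map trip_bound_trip_min tree_bound_tree_min tree_bound_last_leaf)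

section \<open>Weakest preconditions\<close>

fun isP :: "val \<Rightarrow> bool" where "isP (VP a b) = True" | "isP (VI i) = False"
fun vhd :: "val \<Rightarrow> val" where "vhd (VP a b) = a" | "vhd (VI i) = VI i"
fun vtl :: "val \<Rightarrow> val" where "vtl (VP a b) = b" | "vtl (VI i) = VI i"
fun unI :: "val \<Rightarrow> int" where "unI (VI i) = i" | "unI (VP a b) = 0"

lemma isP_iff: "isP v \<longleftrightarrow> v = VP (vhd v) (vtl v)" by (cases v) auto

locale lisp =
  fixes \<Phi> :: "(nat \<times> exp) list" and inp :: "int list" and W :: int
begin

text \<open>Costs are doubled because the simplifier would turn increments by 1 into successors.\<close>

definition wp :: "val list \<Rightarrow> exp \<Rightarrow> (val \<Rightarrow> nat \<Rightarrow> bool) \<Rightarrow> bool" where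
  "wp env e Q \<longleftrightarrow> (\<exists>v t. ev \<Phi> inp W env e v t \<and> Q v (2 * t))"

definition wps :: "val list \<Rightarrow> exp list \<Rightarrow> (val list \<Rightarrow> nat \<Rightarrow> bool) \<Rightarrow> bool" where
  "wps env es Q \<longleftrightarrow> (\<exists>vs t. evs \<Phi> inp W env es vs t \<and> Q vs (2 * t))"

definition wpc :: "nat \<Rightarrow> val list \<Rightarrow> (val \<Rightarrow> nat \<Rightarrow> bool) \<Rightarrow> bool" where
  "wpc f vs Q \<longleftrightarrow> f < length \<Phi> \<and> fst (\<Phi> ! f) = length vs \<and> wp vs (snd (\<Phi> ! f)) Q"

lemma double_cost:
  "2 * (t + 1) = 2 * t + (2::nat)" "2 * (t + s + 1) = 2 * t + 2 * s + (2::nat)"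
  "2 * (t + s + r + 1) = 2 * t + 2 * s + 2 * r + (2::nat)" "2 * (1 + t) = 2 + 2 * (t::nat)"
  by simp_all

lemma wp_Lc: "i < length env \<Longrightarrow> Q (env ! i) (2 + 2 * length env) \<Longrightarrow> wp env (Lc i) Q"
  unfolding wp_def by (metis ev_evs.intros(1) double_cost(4) mult_1_right)

lemma wp_Nm: "\<bar>c\<bar> \<le> W \<Longrightarrow> Q (VI c) 2 \<Longrightarrow> wp env (Nm c) Q"
  unfolding wp_def by (metis ev_evs.intros(2) double_cost(4) mult_1_right)

lemma wp_Rd:
  assumes "wp env e (\<lambda>v t. \<not> isP v \<and> 0 \<le> unI v \<and> nat (unI v) < length inp \<and> Q (VI (inp ! nat (unI v))) (t + 2))"
  shows "wp env (Rd e) Q"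
proof -
  obtain v t where 1: "ev \<Phi> inp W env e v t" "\<not> isP v" "0 \<le> unI v" "nat (unI v) < length inp"
    "Q (VI (inp ! nat (unI v))) (2 * t + 2)" using assms by (auto simp: wp_def)
  then obtain x where "v = VI x" by (cases v) auto
  then show ?thesis using 1 ev_evs.intros(3)[of \<Phi> inp W env e x t] unfolding wp_def
    by (intro exI[of _ "VI (inp ! nat x)"] exI[of _ "t + 1"]) simp
qed

lemma wp_Hd: "wp env e (\<lambda>v t. isP v \<and> Q (vhd v) (t + 2)) \<Longrightarrow> wp env (Hd e) Q"
  unfolding wp_def wps_def wpc_def isP_iff by (metis ev_evs.intros(4) double_cost)

lemma wp_Tl: "wp env e (\<lambda>v t. isP v \<and> Q (vtl v) (t + 2)) \<Longrightarrow> wp env (Tl e) Q"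
  unfolding wp_def wps_def wpc_def isP_iff by (metis ev_evs.intros(5) double_cost)

lemma wp_Pr: "wp env a (\<lambda>v t. wp env b (\<lambda>w s. Q (VP v w) (t + s + 2))) \<Longrightarrow> wp env (Pr a b) Q"
  unfolding wp_def wps_def wpc_def isP_iff by (metis ev_evs.intros(6) double_cost)

lemma wp_Ad:
  assumes "wp env a (\<lambda>v t. wp env b (\<lambda>w s. \<not> isP v \<and> \<not> isP w \<and> \<bar>unI v + unI w\<bar> \<le> W \<and>
    Q (VI (unI v + unI w)) (t + s + 2)))"
  shows "wp env (Ad a b) Q"
proof -
  obtain v t w s where 1: "ev \<Phi> inp W env a v t" "ev \<Phi> inp W env b w s" "\<not> isP v" "\<not> isP w"
    "\<bar>unI v + unI w\<bar> \<le> W" "Q (VI (unI v + unI w)) (2 * t + 2 * s + 2)" using assms by (auto simp: wp_def)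
  then obtain x y where "v = VI x" "w = VI y" by (cases v; cases w) auto
  then show ?thesis using 1 ev_evs.intros(7)[of \<Phi> inp W env a x t b y s] unfolding wp_def
    by (intro exI[of _ "VI (x + y)"] exI[of _ "t + s + 1"]) simp
qed

lemma wp_Sb:
  assumes "wp env a (\<lambda>v t. wp env b (\<lambda>w s. \<not> isP v \<and> \<not> isP w \<and> \<bar>unI v - unI w\<bar> \<le> W \<and>
    Q (VI (unI v - unI w)) (t + s + 2)))"
  shows "wp env (Sb a b) Q"
proof -
  obtain v t w s where 1: "ev \<Phi> inp W env a v t" "ev \<Phi> inp W env b w s" "\<not> isP v" "\<not> isP w"
    "\<bar>unI v - unI w\<bar> \<le> W" "Q (VI (unI v - unI w)) (2 * t + 2 * s + 2)" using assms by (auto simp: wp_def)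
  then obtain x y where "v = VI x" "w = VI y" by (cases v; cases w) auto
  then show ?thesis using 1 ev_evs.intros(8)[of \<Phi> inp W env a x t b y s] unfolding wp_def
    by (intro exI[of _ "VI (x - y)"] exI[of _ "t + s + 1"]) simp
qed

lemma wp_Lt: "wp env a (\<lambda>v t. wp (env @ [v]) b (\<lambda>w s. Q w (t + s + 2))) \<Longrightarrow> wp env (Lt a b) Q"
  unfolding wp_def wps_def wpc_def isP_iff by (metis ev_evs.intros(9) double_cost)

lemma wp_IfZ: "wp env e (\<lambda>v t. wp env (if v = VI 0 then a else b) (\<lambda>w s. Q w (t + s + 2))) \<Longrightarrow> wp env (IfZ e a b) Q"
  unfolding wp_def wps_def wpc_def isP_iff by (metis ev_evs.intros(10) double_cost)

lemma wp_IfEq: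
  assumes "wp env x (\<lambda>v t. wp env y (\<lambda>w s. \<not> isP v \<and> \<not> isP w \<and>
   wp env (if unI v = unI w then a else b) (\<lambda>u r. Q u (t + s + r + 2))))"
  shows "wp env (IfEq x y a b) Q"
proof -
  obtain v t w s u r where 1: "ev \<Phi> inp W env x v t" "ev \<Phi> inp W env y w s" "\<not> isP v" "\<not> isP w"
    "ev \<Phi> inp W env (if unI v = unI w then a else b) u r" "Q u (2 * t + 2 * s + 2 * r + 2)"
    using assms unfolding wp_def by blast
  then obtain p q where "v = VI p" "w = VI q" by (cases v; cases w) auto
  then show ?thesis using 1 ev_evs.intros(11)[of \<Phi> inp W env x p t y q s a b u r] unfolding wp_def
    by (intro exI[of _ u] exI[of _ "t + s + r + 1"]) simp
qed

lemma wp_IfLess: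
  assumes "wp env x (\<lambda>v t. wp env y (\<lambda>w s. \<not> isP v \<and> \<not> isP w \<and>
   wp env (if unI v < unI w then a else b) (\<lambda>u r. Q u (t + s + r + 2))))"
  shows "wp env (IfLess x y a b) Q"
proof -
  obtain v t w s u r where 1: "ev \<Phi> inp W env x v t" "ev \<Phi> inp W env y w s" "\<not> isP v" "\<not> isP w"
    "ev \<Phi> inp W env (if unI v < unI w then a else b) u r" "Q u (2 * t + 2 * s + 2 * r + 2)"
    using assms unfolding wp_def by blast
  then obtain p q where "v = VI p" "w = VI q" by (cases v; cases w) auto
  then show ?thesis using 1 ev_evs.intros(12)[of \<Phi> inp W env x p t y q s a b u r] unfolding wp_def
    by (intro exI[of _ u] exI[of _ "t + s + r + 1"]) simp
qed

lemma wps_Nil: "Q [] 0 \<Longrightarrow> wps env [] Q"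
  unfolding wps_def by (metis ev_evs.intros(14) mult_0_right)

lemma wps_Cons: "wp env e (\<lambda>v t. wps env es (\<lambda>vs s. Q (v # vs) (t + s + 2))) \<Longrightarrow> wps env (e # es) Q"
  unfolding wp_def wps_def wpc_def isP_iff by (metis ev_evs.intros(15) double_cost)

lemma wp_Cl: "wps env es (\<lambda>vs t. wpc f vs (\<lambda>v s. Q v (t + s + 2))) \<Longrightarrow> wp env (Cl f es) Q"
  unfolding wp_def wps_def wpc_def isP_iff by (metis ev_evs.intros(13) double_cost)

lemmas wp_intros = wp_Lc wp_Nm wp_Rd wp_Hd wp_Tl wp_Pr wp_Ad wp_Sb wp_Lt wp_IfZ wp_IfEq wp_IfLess
  wps_Nil wps_Cons wp_Cl

end

section \<open>The program\<close>

text \<open>Function numbers, i.e. positions in \<open>program_funs\<close>.\<close>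

abbreviation (input) "cGET \<equiv> 0::nat"
abbreviation (input) "cGK \<equiv> 33::nat"
abbreviation (input) "cCMP \<equiv> 2::nat"
abbreviation (input) "cAPP \<equiv> 3::nat"
abbreviation (input) "cHT \<equiv> 4::nat"
abbreviation (input) "cAG \<equiv> 5::nat"
abbreviation (input) "cLS \<equiv> 6::nat"
abbreviation (input) "cMNC \<equiv> 7::nat"
abbreviation (input) "cMN \<equiv> 8::nat"
abbreviation (input) "cND2 \<equiv> 9::nat"
abbreviation (input) "cND3 \<equiv> 10::nat"
abbreviation (input) "cJN \<equiv> 11::nat"
abbreviation (input) "cJOIN \<equiv> 12::nat"
abbreviation (input) "cSAT \<equiv> 13::nat"
abbreviation (input) "cSPL \<equiv> 14::nat"
abbreviation (input) "cSPLO \<equiv> 15::nat"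
abbreviation (input) "cAPPO \<equiv> 16::nat"
abbreviation (input) "cFLF \<equiv> 17::nat"
abbreviation (input) "cMV \<equiv> 18::nat"
abbreviation (input) "cMIN \<equiv> 19::nat"
abbreviation (input) "cCRN \<equiv> 20::nat"
abbreviation (input) "cMCL \<equiv> 21::nat"
abbreviation (input) "cMCR \<equiv> 22::nat"
abbreviation (input) "cCUT1 \<equiv> 23::nat"
abbreviation (input) "cCUT2 \<equiv> 24::nat"
abbreviation (input) "cCUT3 \<equiv> 25::nat"
abbreviation (input) "cCUT \<equiv> 26::nat"
abbreviation (input) "cBLK \<equiv> 27::nat"
abbreviation (input) "cROWF \<equiv> 28::nat"
abbreviation (input) "cROWS \<equiv> 29::nat"
abbreviation (input) "cINITC \<equiv> 30::nat"
abbreviation (input) "cFIN \<equiv> 31::nat"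
abbreviation (input) "cRD \<equiv> 32::nat"
abbreviation (input) "cLEN \<equiv> Suc 0"

text \<open>\<open>Ka\<close>, \<open>Kb\<close> and \<open>Kc\<close> are the children of a node
  with its pending map pushed down; \<open>xV\<close>, \<open>xA\<close> and \<open>xB\<close> read
  the parameters of a cone.\<close>

abbreviation (input) "Ka x \<equiv> Cl cAPP [Hd x, Hd (Tl (Tl x))]"
abbreviation (input) "Kb x \<equiv> Cl cAPP [Hd x, Hd (Tl (Tl (Tl x)))]"
abbreviation (input) "Kc x \<equiv> Cl cAPP [Hd x, Tl (Tl (Tl (Tl x)))]"
abbreviation (input) "xV x \<equiv> Tl (Hd x)"
abbreviation (input) "xA x \<equiv> Tl (Hd (Tl x))"
abbreviation (input) "xB x \<equiv> Tl (Tl (Tl x))"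
abbreviation (input) "eM a b c d e f \<equiv> Pr (Pr a b) (Pr (Pr c d) (Pr e f))"

definition "bGET = IfZ (Lc 1) (Hd (Lc 0)) (IfEq (Lc 1) (Nm 1) (Hd (Tl (Lc 0))) (Tl (Tl (Lc 0))))"
definition "bGK = Lt (Cl cGET [Lc 0, Hd (Lc 1)]) (Pr (Hd (Lc 2)) (Ad (Tl (Lc 2)) (Tl (Lc 1))))"
definition "bCMP = Pr (Cl cGK [Lc 1, Hd (Lc 0)])
  (Pr (Cl cGK [Lc 1, Hd (Tl (Lc 0))]) (Cl cGK [Lc 1, Tl (Tl (Lc 0))]))"
definition "bAPP = Pr (Cl cCMP [Lc 0, Hd (Lc 1)]) (Tl (Lc 1))"
definition "bHT = IfZ (Tl (Lc 0)) (Nm 0) (Hd (Hd (Tl (Lc 0))))"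
definition "bAG = IfZ (Tl (Lc 0)) (Hd (Lc 0)) (Cl cCMP [Hd (Lc 0), Hd (Tl (Hd (Tl (Lc 0))))])"
definition "bLS = IfZ (Tl (Lc 0)) (Hd (Lc 0)) (Cl cCMP [Hd (Lc 0), Tl (Tl (Hd (Tl (Lc 0))))])"
definition "bMNC = Pr (Nm 0) (IfLess (Tl (Lc 0)) (Tl (Lc 1)) (Tl (Lc 0)) (Tl (Lc 1)))"
definition "bMN = Pr (Cl cMNC [Hd (Lc 0), Hd (Lc 1)])
  (Pr (Cl cMNC [Hd (Tl (Lc 0)), Hd (Tl (Lc 1))]) (Cl cMNC [Tl (Tl (Lc 0)), Tl (Tl (Lc 1))]))"
definition "eIDM = eM (Nm 0) (Nm 0) (Nm 1) (Nm 0) (Nm 2) (Nm 0)"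
definition "bND2 = Pr eIDM (Pr (Pr (Ad (Cl cHT [Lc 0]) (Nm 1))
    (Pr (Cl cMN [Cl cAG [Lc 0], Cl cAG [Lc 1]]) (Cl cLS [Lc 1]))) (Pr (Lc 0) (Pr (Lc 1) (Nm 0))))"
definition "bND3 = Pr eIDM (Pr (Pr (Ad (Cl cHT [Lc 0]) (Nm 1))
    (Pr (Cl cMN [Cl cAG [Lc 0], Cl cMN [Cl cAG [Lc 1], Cl cAG [Lc 2]]]) (Cl cLS [Lc 2]))) (Pr (Lc 0) (Pr (Lc 1) (Lc 2))))"
text \<open>Joins trees of arbitrary heights by descending that spine of the higher one which faces
  the other tree. The result is one tree, marked by a second component 0, or two trees of the height
  of the higher one if even the root overflows.\<close>

definition "bJN = IfEq (Cl cHT [Lc 0]) (Cl cHT [Lc 1]) (Pr (Lc 0) (Lc 1))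
  (IfLess (Cl cHT [Lc 1]) (Cl cHT [Lc 0])
    (IfZ (Tl (Tl (Tl (Tl (Lc 0)))))
      (Lt (Cl cJN [Kb (Lc 0), Lc 1])
        (IfZ (Tl (Lc 2)) (Pr (Cl cND2 [Ka (Lc 0), Hd (Lc 2)]) (Nm 0))
          (Pr (Cl cND3 [Ka (Lc 0), Hd (Lc 2), Tl (Lc 2)]) (Nm 0))))
      (Lt (Cl cJN [Kc (Lc 0), Lc 1])
        (IfZ (Tl (Lc 2)) (Pr (Cl cND3 [Ka (Lc 0), Kb (Lc 0), Hd (Lc 2)]) (Nm 0))
          (Pr (Cl cND2 [Ka (Lc 0), Kb (Lc 0)]) (Cl cND2 [Hd (Lc 2), Tl (Lc 2)])))))
    (IfZ (Tl (Tl (Tl (Tl (Lc 1)))))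
      (Lt (Cl cJN [Lc 0, Ka (Lc 1)])
        (IfZ (Tl (Lc 2)) (Pr (Cl cND2 [Hd (Lc 2), Kb (Lc 1)]) (Nm 0))
          (Pr (Cl cND3 [Hd (Lc 2), Tl (Lc 2), Kb (Lc 1)]) (Nm 0))))
      (Lt (Cl cJN [Lc 0, Ka (Lc 1)])
        (IfZ (Tl (Lc 2)) (Pr (Cl cND3 [Hd (Lc 2), Kb (Lc 1), Kc (Lc 1)]) (Nm 0))
          (Pr (Cl cND2 [Hd (Lc 2), Tl (Lc 2)]) (Cl cND2 [Kb (Lc 1), Kc (Lc 1)]))))))"
definition "bJOIN = IfZ (Lc 0) (Lc 1) (IfZ (Lc 1) (Lc 0)
  (Lt (Cl cJN [Lc 0, Lc 1]) (IfZ (Tl (Lc 2)) (Hd (Lc 2)) (Cl cND2 [Hd (Lc 2), Tl (Lc 2)]))))"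
definition "bSAT = IfZ (Lc 0)
   (Lt (Cl cLS [Lc 2]) (IfLess (Sb (xV (Lc 3)) (xB (Lc 3))) (Lc 1) (Nm 0) (Nm 1)))
   (IfEq (Lc 0) (Nm 1)
     (Lt (Cl cLS [Lc 2]) (IfLess (Lc 1) (Sb (xA (Lc 3)) (xV (Lc 3))) (Nm 1) (Nm 0)))
     (IfLess (Lc 1) (Tl (Cl cGET [Cl cAG [Lc 2], Sb (Lc 0) (Nm 2)])) (Nm 0) (Nm 1)))"
text \<open>On the way down, \<open>bSAT\<close> applied to whole subtrees locates the child that
  contains the first hit; on the way up, its siblings are joined to the two parts.\<close>

definition "bSPL = IfZ (Tl (Lc 2))
   (IfZ (Cl cSAT [Lc 0, Lc 1, Lc 2]) (Pr (Lc 2) (Nm 0)) (Pr (Nm 0) (Lc 2)))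
   (Lt (Ka (Lc 2)) (Lt (Kb (Lc 2))
     (IfZ (Tl (Tl (Tl (Tl (Lc 2)))))
       (IfZ (Cl cSAT [Lc 0, Lc 1, Lc 3])
         (Lt (Cl cSPL [Lc 0, Lc 1, Lc 4]) (Pr (Cl cJOIN [Lc 3, Hd (Lc 5)]) (Tl (Lc 5))))
         (Lt (Cl cSPL [Lc 0, Lc 1, Lc 3]) (Pr (Hd (Lc 5)) (Cl cJOIN [Tl (Lc 5), Lc 4]))))
       (Lt (Kc (Lc 2))
         (IfZ (Cl cSAT [Lc 0, Lc 1, Lc 3])
           (IfZ (Cl cSAT [Lc 0, Lc 1, Lc 4])
             (Lt (Cl cSPL [Lc 0, Lc 1, Lc 5]) (Pr (Cl cJOIN [Cl cND2 [Lc 3, Lc 4], Hd (Lc 6)]) (Tl (Lc 6))))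
             (Lt (Cl cSPL [Lc 0, Lc 1, Lc 4]) (Pr (Cl cJOIN [Lc 3, Hd (Lc 6)]) (Cl cJOIN [Tl (Lc 6), Lc 5]))))
           (Lt (Cl cSPL [Lc 0, Lc 1, Lc 3]) (Pr (Hd (Lc 6)) (Cl cJOIN [Tl (Lc 6), Cl cND2 [Lc 4, Lc 5]]))))))))"
definition "bSPLO = IfZ (Lc 2) (Pr (Nm 0) (Nm 0)) (Cl cSPL [Lc 0, Lc 1, Lc 2])"
definition "bAPPO = IfZ (Lc 1) (Nm 0) (Cl cAPP [Lc 0, Lc 1])"
definition "bFLF = IfZ (Tl (Lc 0)) (Lc 0) (Cl cFLF [Ka (Lc 0)])"
definition "bMV = IfZ (Lc 0) (Lc 3) (Ad (Tl (Cl cGET [Cl cAG [Lc 0], Lc 1])) (Lc 2))"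
definition "bMIN = IfLess (Lc 0) (Lc 1) (Lc 0) (Lc 1)"
definition "bCRN = Pr (eM (Nm 0) (Lc 0) (Nm 0) (Ad (Lc 0) (Lc 1)) (Nm 0) (Sb (Lc 0) (Lc 1))) (Nm 0)"
definition "bMCL = eM (Nm 0) (Nm 0) (Nm 0) (Lc 0) (Nm 2) (Nm 0)"
definition "bMCR = eM (Nm 0) (Nm 0) (Nm 1) (Nm 0) (Nm 0) (Sb (Nm 0) (Lc 0))"
definition "bCUT1 = Lt (Cl cSPLO [Nm 4, Sb (Lc 1) (Lc 0), Lc 2])
   (Pr (Cl cJOIN [Hd (Lc 5), Cl cFLF [Tl (Lc 5)]])
     (Cl cJOIN [Cl cCRN [Lc 1, Lc 0], Cl cJOIN [Cl cAPPO [Cl cMCL [Lc 0], Lc 3], Lc 4]]))"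
definition "bCUT2 = Lt (Cl cSPLO [Nm 2, Lc 1, Lc 3])
   (Pr (Cl cJOIN [Lc 2, Cl cAPPO [Cl cMCR [Lc 0], Cl cJOIN [Hd (Lc 5), Cl cFLF [Tl (Lc 5)]]]])
     (Cl cJOIN [Cl cAPPO [Cl cMCL [Lc 0], Tl (Lc 5)], Lc 4]))"
definition "bCUT3 = Lt (Cl cSPLO [Nm 3, Ad (Lc 1) (Lc 0), Lc 4])
   (Pr (Cl cJOIN [Lc 2, Cl cJOIN [Cl cAPPO [Cl cMCR [Lc 0], Lc 3], Cl cCRN [Lc 1, Lc 0]]]) (Tl (Lc 5)))"
definition "bCUT = Lt (Cl cSPLO [Nm 0, Lc 1, Lc 2]) (Lt (Cl cSPLO [Nm 1, Lc 1, Tl (Lc 3)])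
   (Lt (Cl cMV [Hd (Lc 3), Nm 2, Lc 1, Lc 0]) (Lt (Cl cMV [Hd (Lc 4), Nm 0, Nm 0, Lc 0])
   (Lt (Cl cMV [Tl (Lc 4), Nm 1, Sb (Nm 0) (Lc 1), Lc 0])
   (Lt (Cl cMIN [Lc 5, Cl cMIN [Lc 6, Lc 7]])
     (IfEq (Lc 5) (Lc 8) (Cl cCUT1 [Lc 1, Lc 8, Hd (Lc 3), Hd (Lc 4), Tl (Lc 4)])
     (IfEq (Lc 6) (Lc 8) (Cl cCUT2 [Lc 1, Lc 8, Hd (Lc 3), Hd (Lc 4), Tl (Lc 4)])
       (Cl cCUT3 [Lc 1, Lc 8, Hd (Lc 3), Hd (Lc 4), Tl (Lc 4)]))))))))"
text \<open>\<open>Lc 8\<close>, \<open>Lc 9\<close> and \<open>Lc 10\<close> are the diagonals of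
  the bottom right, bottom left and top right corner. For distinct symbols two lists are cut, and
  one part of each is kept.\<close>

definition "bBLK = Lt (Ad (Lc 5) (Sb (Lc 4) (Lc 3))) (Lt (Sb (Lc 5) (Lc 3)) (Lt (Ad (Lc 5) (Lc 4))
   (IfEq (Lc 1) (Lc 2) (Cl cCUT [Lc 0, Lc 8, Cl cJOIN [Lc 6, Lc 7]])
     (Pr
       (Hd (Cl cCUT [Lc 0, Lc 8, Cl cJOIN [
          Cl cAPP [eM (Nm 1) (Sb (Nm 0) (Lc 9)) (Nm 1) (Nm 0) (Nm 0) (Sb (Nm 0) (Lc 9)), Lc 6],
          Cl cAPP [eM (Nm 0) (Lc 3) (Nm 1) (Nm 0) (Nm 2) (Lc 3), Lc 7]]]))
       (Tl (Cl cCUT [Lc 0, Lc 8, Cl cJOIN [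
          Cl cAPP [eM (Nm 0) (Lc 4) (Nm 1) (Lc 4) (Nm 2) (Nm 0), Lc 6],
          Cl cAPP [eM (Nm 2) (Lc 10) (Nm 0) (Lc 10) (Nm 2) (Nm 0), Lc 7]]]))))))"
definition "bROWF = IfZ (Lc 5) (Nm 0)
   (Lt (Cl cBLK [Lc 0, Lc 1, Hd (Hd (Lc 5)), Lc 2, Hd (Tl (Hd (Lc 5))), Lc 3, Lc 4, Tl (Tl (Hd (Lc 5)))])
     (Pr (Pr (Hd (Hd (Lc 5))) (Pr (Hd (Tl (Hd (Lc 5)))) (Hd (Lc 6))))
       (Cl cROWF [Lc 0, Lc 1, Lc 2, Ad (Lc 3) (Hd (Tl (Hd (Lc 5)))), Tl (Lc 6), Tl (Lc 5)])))"
definition "bROWS = IfZ (Lc 1) (Lc 3)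
   (Cl cROWS [Lc 0, Tl (Lc 1), Sb (Lc 2) (Tl (Hd (Lc 1))),
     Cl cROWF [Lc 0, Hd (Hd (Lc 1)), Tl (Hd (Lc 1)), Lc 2, Cl cCRN [Sb (Nm 0) (Lc 2), Lc 2], Lc 3]])"
definition "bINITC = IfZ (Lc 0) (Nm 0)
   (Pr (Pr (Hd (Hd (Lc 0))) (Pr (Tl (Hd (Lc 0))) (Cl cCRN [Lc 1, Lc 1])))
     (Cl cINITC [Tl (Lc 0), Ad (Lc 1) (Tl (Hd (Lc 0)))]))"
definition "bFIN = IfZ (Tl (Lc 0))
   (Ad (xB (Cl cAG [Tl (Tl (Hd (Lc 0)))])) (Ad (Lc 1) (Hd (Tl (Hd (Lc 0))))))
   (Cl cFIN [Tl (Lc 0), Ad (Lc 1) (Hd (Tl (Hd (Lc 0))))])"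
text \<open>The accumulator reverses the runs, so the last run of each string is processed first.
  This matches \<open>ed\<close>, which peels letters off the front and thus builds the table from
  the ends of the strings.\<close>

definition "bRD = IfZ (Lc 1) (Lc 2)
   (Cl cRD [Ad (Lc 0) (Nm 2), Sb (Lc 1) (Nm 1), Pr (Pr (Rd (Lc 0)) (Rd (Ad (Lc 0) (Nm 1)))) (Lc 2)])"
definition "bLEN = IfZ (Lc 0) (Lc 1) (Cl cLEN [Tl (Lc 0), Ad (Lc 1) (Tl (Hd (Lc 0)))])"
definition "bMAIN = Lt (Cl cRD [Nm 0, Lc 0, Nm 0]) (Lt (Cl cRD [Ad (Lc 0) (Lc 0), Lc 1, Nm 0])
   (Lt (Cl cLEN [Lc 2, Nm 0]) (Lt (Cl cLEN [Lc 3, Nm 0]) (Lt (Ad (Ad (Lc 4) (Lc 5)) (Nm 1))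
     (Cl cFIN [Cl cROWS [Lc 6, Lc 2, Nm 0, Cl cINITC [Lc 3, Nm 0]], Sb (Nm 0) (Lc 4)])))))"

definition program_funs :: "(nat \<times> exp) list" where
  "program_funs = [(2, bGET), (2, bLEN), (2, bCMP), (2, bAPP), (1, bHT), (1, bAG), (1, bLS), (2, bMNC), (2, bMN),
     (2, bND2), (3, bND3), (2, bJN), (2, bJOIN), (3, bSAT), (3, bSPL), (3, bSPLO), (2, bAPPO), (1, bFLF),
     (4, bMV), (2, bMIN), (2, bCRN), (1, bMCL), (1, bMCR), (5, bCUT1), (5, bCUT2), (5, bCUT3), (3, bCUT),
     (8, bBLK), (6, bROWF), (4, bROWS), (2, bINITC), (2, bFIN), (3, bRD), (2, bGK)]"

lemma program_funs_simps [simp]: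
  "length program_funs = 34"
  "program_funs ! 0 = (2, bGET)"
  "program_funs ! Suc 0 = (2, bLEN)"
  "program_funs ! 2 = (2, bCMP)"
  "program_funs ! 3 = (2, bAPP)"
  "program_funs ! 4 = (1, bHT)"
  "program_funs ! 5 = (1, bAG)"
  "program_funs ! 6 = (1, bLS)"
  "program_funs ! 7 = (2, bMNC)"
  "program_funs ! 8 = (2, bMN)"
  "program_funs ! 9 = (2, bND2)"
  "program_funs ! 10 = (3, bND3)"
  "program_funs ! 11 = (2, bJN)"
  "program_funs ! 12 = (2, bJOIN)"
  "program_funs ! 13 = (3, bSAT)"
  "program_funs ! 14 = (3, bSPL)"
  "program_funs ! 15 = (3, bSPLO)"
  "program_funs ! 16 = (2, bAPPO)"
  "program_funs ! 17 = (1, bFLF)"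
  "program_funs ! 18 = (4, bMV)"
  "program_funs ! 19 = (2, bMIN)"
  "program_funs ! 20 = (2, bCRN)"
  "program_funs ! 21 = (1, bMCL)"
  "program_funs ! 22 = (1, bMCR)"
  "program_funs ! 23 = (5, bCUT1)"
  "program_funs ! 24 = (5, bCUT2)"
  "program_funs ! 25 = (5, bCUT3)"
  "program_funs ! 26 = (3, bCUT)"
  "program_funs ! 27 = (8, bBLK)"
  "program_funs ! 28 = (6, bROWF)"
  "program_funs ! 29 = (4, bROWS)"
  "program_funs ! 30 = (2, bINITC)"
  "program_funs ! 31 = (2, bFIN)"
  "program_funs ! 32 = (3, bRD)"
  "program_funs ! 33 = (2, bGK)"
  by (simp_all add: program_funs_def)

section \<open>Encodings and costs of the tree operations\<close>

definition enc_comp :: "comp \<Rightarrow> val" where "enc_comp c = VP (VI (fst c)) (VI (snd c))"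
definition enc_trip :: "trip \<Rightarrow> val" where "enc_trip m = VP (enc_comp (tv m)) (VP (enc_comp (ta m)) (enc_comp (tb m)))"

fun enc_tree :: "tree \<Rightarrow> val" where
  "enc_tree (Lf m) = VP (enc_trip m) (VI 0)"
| "enc_tree (N2 m h g l a b) = VP (enc_trip m) (VP (VP (VI h) (VP (enc_trip g) (enc_trip l))) (VP (enc_tree a) (VP (enc_tree b) (VI 0))))"
| "enc_tree (N3 m h g l a b c) = VP (enc_trip m) (VP (VP (VI h) (VP (enc_trip g) (enc_trip l))) (VP (enc_tree a) (VP (enc_tree b) (enc_tree c))))"

fun enc_treeo :: "tree option \<Rightarrow> val" where "enc_treeo None = VI 0" | "enc_treeo (Some t) = enc_tree t"

lemma enc_comp_simps [simp]: "isP (enc_comp c)" "vhd (enc_comp c) = VI (fst c)" "vtl (enc_comp c) = VI (snd c)"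
  by (simp_all add: enc_comp_def)
lemma enc_trip_simps [simp]: "isP (enc_trip m)" "vhd (enc_trip m) = enc_comp (tv m)" "vtl (enc_trip m) = VP (enc_comp (ta m)) (enc_comp (tb m))"
  by (simp_all add: enc_trip_def)
lemma enc_tree_isP [simp]: "isP (enc_tree t)" "enc_tree t \<noteq> VI i" by (cases t; simp)+

definition good_tree :: "int \<Rightarrow> tree \<Rightarrow> bool" where
  "good_tree K t \<longleftrightarrow> wf_tree t \<and> tree_bound K t"

definition is_node2 :: "tree \<Rightarrow> bool" where "is_node2 t \<longleftrightarrow> (\<exists>m h g l a b. t = N2 m h g l a b)"

lemma is_node2_node2 [simp]: "is_node2 (node2 a b)" by (simp add: is_node2_def node2_def)

lemma trip_bound_nonneg: "trip_bound K m \<Longrightarrow> 0 \<le> K" by (auto simp: trip_bound_def)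

text \<open>\<open>W2\<close> makes the numeric literals of the program fit into a word.\<close>

locale prog =
  fixes inp :: "int list" and W :: int
  assumes W2: "100 \<le> W"
begin

sublocale lisp program_funs inp W .

lemma wpcI: "f < length program_funs \<Longrightarrow> fst (program_funs ! f) = length vs \<Longrightarrow> wp vs (snd (program_funs ! f)) Q \<Longrightarrow> wpc f vs Q"
  by (simp add: wpc_def)

text \<open>The numeric bounds on costs, here and below, are rounded upper bounds on doubled
  costs.\<close>

lemma wpc_GET: "(\<And>t. t \<le> 30 \<Longrightarrow> Q (enc_comp (get m s)) t) \<Longrightarrow> wpc cGET [enc_trip m, VI s] Q"
  by (rule wpcI) (use W2 in \<open>auto simp: bGET_def get_def intro!: wp_intros\<close>)

lemma wpc_GK:
  assumes "trip_bound K m" "\<bar>snd c\<bar> \<le> J" "J + K \<le> W" and Q: "\<And>t. t \<le> 100 \<Longrightarrow> Q (enc_comp (select m c)) t"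
  shows "wpc cGK [enc_trip m, enc_comp c] Q"
proof -
  have "\<bar>snd (get m (fst c)) + snd c\<bar> \<le> W" using assms(1-3) trip_bound_get[of K m "fst c"] by linarith
  then show ?thesis
    by (intro wpcI) (use W2 in \<open>auto simp: bGK_def intro!: wp_intros wpc_GET Q[unfolded enc_comp_def select_def fst_conv snd_conv]\<close>)
qed

lemma wpc_CMP:
  assumes "trip_bound J \<mu>" "trip_bound K m" "J + K \<le> W" and Q: "\<And>t. t \<le> 600 \<Longrightarrow> Q (enc_trip (comp_map \<mu> m)) t"
  shows "wpc cCMP [enc_trip \<mu>, enc_trip m] Q"
  by (rule wpcI)
    (use W2 assms(1-3) in
      \<open>auto simp: bCMP_def trip_bound_def[of J] intro!: wp_intros wpc_GK[of K _ _ J] Q[unfolded enc_trip_def comp_map_def trip.sel]\<close>)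

lemma wpc_APP:
  assumes "trip_bound J \<mu>" "tree_bound K t" "J + K \<le> W" and Q: "\<And>n. n \<le> 800 \<Longrightarrow> Q (enc_tree (apply_map \<mu> t)) n"
  shows "wpc cAPP [enc_trip \<mu>, enc_tree t] Q"
proof -
  obtain m r where t: "enc_tree t = VP (enc_trip m) r" "enc_tree (apply_map \<mu> t) = VP (enc_trip (comp_map \<mu> m)) r" and m: "trip_bound K m"
  proof (cases t)
    case (N2 m h g l a b)
    then obtain k where "trip_bound k m" "trip_bound (K - k) g" using assms(2) by auto
    then have "trip_bound K m" using trip_bound_nonneg[of "K - k" g] by (auto intro: trip_bound_mono)
    then show ?thesis using N2 that by auto
  next
    case (N3 m h g l a b c)
    then obtain k where "trip_bound k m" "trip_bound (K - k) g" using assms(2) by auto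
    then have "trip_bound K m" using trip_bound_nonneg[of "K - k" g] by (auto intro: trip_bound_mono)
    then show ?thesis using N3 that by auto
  qed (use assms(2) in auto)
  show ?thesis by (rule wpcI)
    (use W2 assms(1,3) m t in \<open>auto simp: bAPP_def intro!: wp_intros wpc_CMP[of J _ K] Q[unfolded t]\<close>)
qed

lemma wpc_KID2:
  assumes "tree_bound K (N2 m h g l a b)" "K \<le> W" "x = a \<or> x = b" and Q: "\<And>n. n \<le> 800 \<Longrightarrow> Q (enc_tree (apply_map m x)) n"
  shows "wpc cAPP [enc_trip m, enc_tree x] Q"
proof -
  obtain k where "trip_bound k m" "tree_bound (K - k) x" using assms(1,3) by auto
  then show ?thesis using assms(2) by (intro wpc_APP[of k m "K - k"] Q) auto
qed

lemma wpc_KID3: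
  assumes "tree_bound K (N3 m h g l a b c)" "K \<le> W" "x = a \<or> x = b \<or> x = c" and Q: "\<And>n. n \<le> 800 \<Longrightarrow> Q (enc_tree (apply_map m x)) n"
  shows "wpc cAPP [enc_trip m, enc_tree x] Q"
proof -
  obtain k where "trip_bound k m" "tree_bound (K - k) x" using assms(1,3) by auto
  then show ?thesis using assms(2) by (intro wpc_APP[of k m "K - k"] Q) auto
qed

lemma wpc_AG:
  assumes "tree_bound K t" "K \<le> W" and Q: "\<And>n. n \<le> 800 \<Longrightarrow> Q (enc_trip (tree_min t)) n"
  shows "wpc cAG [enc_tree t] Q"
proof (cases t)
  case (N2 m h g l a b)
  then obtain k where "trip_bound k m" "trip_bound (K - k) g" using assms(1) by auto
  then show ?thesis
    by (intro wpcI) (use N2 W2 assms(2) Q in \<open>auto simp: bAG_def intro!: wp_intros wpc_CMP[of k _ "K - k"]\<close>)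
next
  case (N3 m h g l a b c)
  then obtain k where "trip_bound k m" "trip_bound (K - k) g" using assms(1) by auto
  then show ?thesis
    by (intro wpcI) (use N3 W2 assms(2) Q in \<open>auto simp: bAG_def intro!: wp_intros wpc_CMP[of k _ "K - k"]\<close>)
qed (rule wpcI; use W2 Q in \<open>auto simp: bAG_def intro!: wp_intros\<close>)

lemma wpc_LS:
  assumes "tree_bound K t" "K \<le> W" and Q: "\<And>n. n \<le> 800 \<Longrightarrow> Q (enc_trip (last_leaf t)) n"
  shows "wpc cLS [enc_tree t] Q"
proof (cases t)
  case (N2 m h g l a b)
  then obtain k where "trip_bound k m" "trip_bound (K - k) l" using assms(1) by auto
  then show ?thesis
    by (intro wpcI) (use N2 W2 assms(2) Q in \<open>auto simp: bLS_def intro!: wp_intros wpc_CMP[of k _ "K - k"]\<close>)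
next
  case (N3 m h g l a b c)
  then obtain k where "trip_bound k m" "trip_bound (K - k) l" using assms(1) by auto
  then show ?thesis
    by (intro wpcI) (use N3 W2 assms(2) Q in \<open>auto simp: bLS_def intro!: wp_intros wpc_CMP[of k _ "K - k"]\<close>)
qed (rule wpcI; use W2 Q in \<open>auto simp: bLS_def intro!: wp_intros\<close>)

lemma wpc_HT: "(\<And>n. n \<le> 50 \<Longrightarrow> Q (VI (height t)) n) \<Longrightarrow> wpc cHT [enc_tree t] Q"
  by (rule wpcI) (use W2 in \<open>cases t; auto simp: bHT_def intro!: wp_intros\<close>)+

lemma wpc_MNC: "(\<And>n. n \<le> 100 \<Longrightarrow> Q (enc_comp (comp_min x y)) n) \<Longrightarrow> wpc cMNC [enc_comp x, enc_comp y] Q"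
  by (rule wpcI) (use W2 in \<open>auto simp: bMNC_def enc_comp_def comp_min_def intro!: wp_intros\<close>)

lemma wpc_MN: "(\<And>n. n \<le> 600 \<Longrightarrow> Q (enc_trip (trip_min x y)) n) \<Longrightarrow> wpc cMN [enc_trip x, enc_trip y] Q"
  by (rule wpcI) (use W2 in \<open>auto simp: bMN_def enc_trip_def trip_min_def intro!: wp_intros wpc_MNC\<close>)

lemma enc_trip_id_map: "VP (VP (VI 0) (VI 0)) (VP (VP (VI 1) (VI 0)) (VP (VI 2) (VI 0))) = enc_trip id_map"
  by (simp add: enc_trip_def enc_comp_def id_map_def)

lemma wpc_ND2:
  assumes "tree_bound K a" "tree_bound K b" "K \<le> W" "0 \<le> height a" "height a + 1 \<le> W" and Q: "\<And>n. n \<le> 5000 \<Longrightarrow> Q (enc_tree (node2 a b)) n"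
  shows "wpc cND2 [enc_tree a, enc_tree b] Q"
  by (rule wpcI)
    (use W2 assms(1-5) in \<open>auto simp: bND2_def eIDM_def enc_trip_id_map intro!: wp_intros wpc_HT wpc_MN wpc_AG[of K] wpc_LS[of K] Q[unfolded node2_def enc_tree.simps]\<close>)

lemma wpc_ND3:
  assumes "tree_bound K a" "tree_bound K b" "tree_bound K c" "K \<le> W" "0 \<le> height a" "height a + 1 \<le> W" and Q: "\<And>n. n \<le> 6000 \<Longrightarrow> Q (enc_tree (node3 a b c)) n"
  shows "wpc cND3 [enc_tree a, enc_tree b, enc_tree c] Q"
  by (rule wpcI)
    (use W2 assms(1-6) in \<open>auto simp: bND3_def eIDM_def enc_trip_id_map intro!: wp_intros wpc_HT wpc_MN wpc_AG[of K] wpc_LS[of K] Q[unfolded node3_def enc_tree.simps]\<close>)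

text \<open>The recursion follows one spine for the difference of the heights. A higher tree with a
  binary root absorbs the overflow of its child, which \<open>Q2\<close> records by excluding that
  case; splitting relies on this to keep its parts from growing.\<close>

lemma wpc_JN:
  assumes "good_tree K l" "good_tree K r" "K \<le> W" "height l + 1 \<le> W" "height r + 1 \<le> W"
    and Q1: "\<And>t n. n \<le> 20000 * nat \<bar>height l - height r\<bar> + 500 \<Longrightarrow> good_tree K t \<Longrightarrow> height t = max (height l) (height r) \<Longrightarrow>
       leaves t = leaves l @ leaves r \<Longrightarrow> Q (VP (enc_tree t) (VI 0)) n"
    and Q2: "\<And>t u n. n \<le> 20000 * nat \<bar>height l - height r\<bar> + 500 \<Longrightarrow> good_tree K t \<Longrightarrow> height t = max (height l) (height r) \<Longrightarrow>
       good_tree K u \<Longrightarrow> height u = height t \<Longrightarrow> \<not> (is_node2 l \<and> height r < height l) \<Longrightarrow> \<not> (is_node2 r \<and> height l < height r) \<Longrightarrow>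
       leaves t @ leaves u = leaves l @ leaves r \<Longrightarrow> Q (VP (enc_tree t) (enc_tree u)) n"
  shows "wpc cJN [enc_tree l, enc_tree r] Q"
  using assms
proof (induction "size l + size r" arbitrary: l r Q rule: less_induct)
  case less
  note IH = less.hyps and l = less.prems(1) and r = less.prems(2) and KW = less.prems(3) and hl = less.prems(4)
    and hr = less.prems(5) and Q1 = less.prems(6) and Q2 = less.prems(7)
  have hn: "0 \<le> height l" "0 \<le> height r" using l r height_nonneg by (auto simp: good_tree_def)
  have tK: "tree_bound K t" if "good_tree K t" for t using that by (simp add: good_tree_def)
  consider "height l = height r" | "height r < height l" | "height l < height r" by linarith
  then show ?case
  proof cases
    case 1
    have Q1: "Q (VP (enc_tree l) (enc_tree r)) n" if "n \<le> 500" for n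
      by (rule Q2) (use that l r 1 in auto)
    show ?thesis
      by (rule wpcI) (use W2 1 in \<open>auto simp: bJN_def intro!: wp_intros wpc_HT Q1\<close>)
  next
    case 2
    have k: "nat \<bar>height l - height r\<bar> = nat \<bar>height l - 1 - height r\<bar> + 1" using 2 by simp
    have rec: "wpc cJN [enc_tree b, enc_tree r] Q'"
      if b: "good_tree K b" "height b = height l - 1" "size b < size l" and
        "\<And>t n. n \<le> 20000 * nat \<bar>height l - 1 - height r\<bar> + 500 \<Longrightarrow> good_tree K t \<Longrightarrow> height t = height l - 1 \<Longrightarrow>
          leaves t = leaves b @ leaves r \<Longrightarrow> Q' (VP (enc_tree t) (VI 0)) n"
        "\<And>t u n. n \<le> 20000 * nat \<bar>height l - 1 - height r\<bar> + 500 \<Longrightarrow> good_tree K t \<Longrightarrow> height t = height l - 1 \<Longrightarrow>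
          good_tree K u \<Longrightarrow> height u = height l - 1 \<Longrightarrow>
          leaves t @ leaves u = leaves b @ leaves r \<Longrightarrow> Q' (VP (enc_tree t) (enc_tree u)) n" for Q' b
      by (rule IH) (use b r KW hl hr 2 in \<open>auto intro!: that\<close>)
    show ?thesis
    proof (cases l)
      case (N2 m h g s a b)
      have kb: "good_tree K (apply_map m a)" "good_tree K (apply_map m b)" "height a = height l - 1" "height b = height l - 1" "leaves l = leaves (apply_map m a) @ leaves (apply_map m b)"
        using l N2 tree_bound_kids(1)[of K m h g s a b] by (auto simp: good_tree_def)
      have lt: "tree_bound K (N2 m h g s a b)" using l by (simp only: good_tree_def N2)
      have Qa: "Q (VP (enc_tree (node2 (apply_map m a) t)) (VI 0)) n" if "n \<le> 20000 * nat \<bar>height l - 1 - height r\<bar> + 20000" "good_tree K t" "height t = height l - 1"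
        "leaves t = leaves (apply_map m b) @ leaves r" for n t
        by (rule Q1) (use that kb 2 in \<open>auto simp: good_tree_def wf_tree_nd tree_bound_nd k\<close>)
      have Qb: "Q (VP (enc_tree (node3 (apply_map m a) t u)) (VI 0)) n" if "n \<le> 20000 * nat \<bar>height l - 1 - height r\<bar> + 20000" "good_tree K t" "good_tree K u" "height t = height l - 1" "height u = height l - 1"
        "leaves t @ leaves u = leaves (apply_map m b) @ leaves r" for n t u
        by (rule Q1) (use that kb 2 in \<open>auto simp: good_tree_def wf_tree_nd tree_bound_nd k\<close>)
      have sz: "size (apply_map m b) < size l" using N2 by simp
      have sel: "vhd (enc_tree l) = enc_trip m" "vtl (enc_tree l) = VP (VP (VI h) (VP (enc_trip g) (enc_trip s))) (VP (enc_tree a) (VP (enc_tree b) (VI 0)))"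
        using N2 by simp_all
      show ?thesis
        by (rule wpcI)
          (use W2 2 KW kb hl hn sz in \<open>auto simp: bJN_def sel intro!: wp_intros wpc_HT wpc_KID2[OF lt KW] rec[OF kb(2)] wpc_ND2[of K] wpc_ND3[of K] Qa Qb tK\<close>)
    next
      case (N3 m h g s a b c)
      have kb: "good_tree K (apply_map m a)" "good_tree K (apply_map m b)" "good_tree K (apply_map m c)" "height a = height l - 1" "height b = height l - 1" "height c = height l - 1"
         "leaves l = leaves (apply_map m a) @ leaves (apply_map m b) @ leaves (apply_map m c)"
        using l N3 tree_bound_kids(2)[of K m h g s a b c] by (auto simp: good_tree_def)
      have lt: "tree_bound K (N3 m h g s a b c)" using l by (simp only: good_tree_def N3)
      have nt: "\<not> is_node2 l" using N3 by (simp add: is_node2_def)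
      have Qa: "Q (VP (enc_tree (node3 (apply_map m a) (apply_map m b) t)) (VI 0)) n" if "n \<le> 20000 * nat \<bar>height l - 1 - height r\<bar> + 20000" "good_tree K t" "height t = height l - 1"
        "leaves t = leaves (apply_map m c) @ leaves r" for n t
        by (rule Q1) (use that kb 2 in \<open>auto simp: good_tree_def wf_tree_nd tree_bound_nd k\<close>)
      have Qb: "Q (VP (enc_tree (node2 (apply_map m a) (apply_map m b))) (enc_tree (node2 t u))) n" if "n \<le> 20000 * nat \<bar>height l - 1 - height r\<bar> + 20000" "good_tree K t" "good_tree K u" "height t = height l - 1" "height u = height l - 1"
        "leaves t @ leaves u = leaves (apply_map m c) @ leaves r" for n t u
        by (rule Q2) (use that kb 2 nt in \<open>auto simp: good_tree_def wf_tree_nd tree_bound_nd k\<close>)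
      have sz: "size (apply_map m c) < size l" using N3 by simp
      have sel: "vhd (enc_tree l) = enc_trip m" "vtl (enc_tree l) = VP (VP (VI h) (VP (enc_trip g) (enc_trip s))) (VP (enc_tree a) (VP (enc_tree b) (enc_tree c)))"
        using N3 by simp_all
      show ?thesis
        by (rule wpcI)
          (use W2 2 KW kb hl hn sz in \<open>auto simp: bJN_def sel intro!: wp_intros wpc_HT wpc_KID3[OF lt KW] rec[OF kb(3)] wpc_ND2[of K] wpc_ND3[of K] Qa Qb tK\<close>)
    qed (use 2 hn in auto)
  next
    case 3
    have k: "nat \<bar>height l - height r\<bar> = nat \<bar>height l - (height r - 1)\<bar> + 1" using 3 by simp
    have rec: "wpc cJN [enc_tree l, enc_tree b] Q'"
      if b: "good_tree K b" "height b = height r - 1" "size b < size r" and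
        "\<And>t n. n \<le> 20000 * nat \<bar>height l - (height r - 1)\<bar> + 500 \<Longrightarrow> good_tree K t \<Longrightarrow> height t = height r - 1 \<Longrightarrow>
          leaves t = leaves l @ leaves b \<Longrightarrow> Q' (VP (enc_tree t) (VI 0)) n"
        "\<And>t u n. n \<le> 20000 * nat \<bar>height l - (height r - 1)\<bar> + 500 \<Longrightarrow> good_tree K t \<Longrightarrow> height t = height r - 1 \<Longrightarrow>
          good_tree K u \<Longrightarrow> height u = height r - 1 \<Longrightarrow>
          leaves t @ leaves u = leaves l @ leaves b \<Longrightarrow> Q' (VP (enc_tree t) (enc_tree u)) n" for Q' b
      by (rule IH) (use b l KW hl hr 3 in \<open>auto intro!: that\<close>)
    show ?thesis
    proof (cases r)
      case (N2 m h g s a b)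
      have kb: "good_tree K (apply_map m a)" "good_tree K (apply_map m b)" "height a = height r - 1" "height b = height r - 1" "leaves r = leaves (apply_map m a) @ leaves (apply_map m b)"
        using r N2 tree_bound_kids(1)[of K m h g s a b] by (auto simp: good_tree_def)
      have lt: "tree_bound K (N2 m h g s a b)" using r by (simp only: good_tree_def N2)
      have Qa: "Q (VP (enc_tree (node2 t (apply_map m b))) (VI 0)) n" if "n \<le> 20000 * nat \<bar>height l - (height r - 1)\<bar> + 20000" "good_tree K t" "height t = height r - 1"
        "leaves t = leaves l @ leaves (apply_map m a)" for n t
        by (rule Q1) (use that kb 3 in \<open>auto simp: good_tree_def wf_tree_nd tree_bound_nd k\<close>)
      have Qb: "Q (VP (enc_tree (node3 t u (apply_map m b))) (VI 0)) n" if "n \<le> 20000 * nat \<bar>height l - (height r - 1)\<bar> + 20000" "good_tree K t" "good_tree K u" "height t = height r - 1" "height u = height r - 1"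
        "leaves t @ leaves u = leaves l @ leaves (apply_map m a)" for n t u
        by (rule Q1) (use that kb 3 append_assoc[of "leaves t" "leaves u"] in \<open>auto simp: good_tree_def wf_tree_nd tree_bound_nd k\<close>)
      have sz: "size (apply_map m a) < size r" using N2 by simp
      have sel: "vhd (enc_tree r) = enc_trip m" "vtl (enc_tree r) = VP (VP (VI h) (VP (enc_trip g) (enc_trip s))) (VP (enc_tree a) (VP (enc_tree b) (VI 0)))"
        using N2 by simp_all
      show ?thesis
        by (rule wpcI)
          (use W2 3 KW kb hr hn sz in \<open>auto simp: bJN_def sel intro!: wp_intros wpc_HT wpc_KID2[OF lt KW] rec[OF kb(1)] wpc_ND2[of K] wpc_ND3[of K] Qa Qb tK\<close>)
    next
      case (N3 m h g s a b c)
      have kb: "good_tree K (apply_map m a)" "good_tree K (apply_map m b)" "good_tree K (apply_map m c)" "height a = height r - 1" "height b = height r - 1" "height c = height r - 1"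
         "leaves r = leaves (apply_map m a) @ leaves (apply_map m b) @ leaves (apply_map m c)"
        using r N3 tree_bound_kids(2)[of K m h g s a b c] by (auto simp: good_tree_def)
      have lt: "tree_bound K (N3 m h g s a b c)" using r by (simp only: good_tree_def N3)
      have nt: "\<not> is_node2 r" using N3 by (simp add: is_node2_def)
      have Qa: "Q (VP (enc_tree (node3 t (apply_map m b) (apply_map m c))) (VI 0)) n" if "n \<le> 20000 * nat \<bar>height l - (height r - 1)\<bar> + 20000" "good_tree K t" "height t = height r - 1"
        "leaves t = leaves l @ leaves (apply_map m a)" for n t
        by (rule Q1) (use that kb 3 in \<open>auto simp: good_tree_def wf_tree_nd tree_bound_nd k\<close>)
      have Qb: "Q (VP (enc_tree (node2 t u)) (enc_tree (node2 (apply_map m b) (apply_map m c)))) n" if "n \<le> 20000 * nat \<bar>height l - (height r - 1)\<bar> + 20000" "good_tree K t" "good_tree K u" "height t = height r - 1" "height u = height r - 1"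
        "leaves t @ leaves u = leaves l @ leaves (apply_map m a)" for n t u
        by (rule Q2) (use that kb 3 nt append_assoc[of "leaves t" "leaves u"] in \<open>auto simp: good_tree_def wf_tree_nd tree_bound_nd k\<close>)
      have sz: "size (apply_map m a) < size r" using N3 by simp
      have sel: "vhd (enc_tree r) = enc_trip m" "vtl (enc_tree r) = VP (VP (VI h) (VP (enc_trip g) (enc_trip s))) (VP (enc_tree a) (VP (enc_tree b) (enc_tree c)))"
        using N3 by simp_all
      show ?thesis
        by (rule wpcI)
          (use W2 3 KW kb hr hn sz in \<open>auto simp: bJN_def sel intro!: wp_intros wpc_HT wpc_KID3[OF lt KW] rec[OF kb(1)] wpc_ND2[of K] wpc_ND3[of K] Qa Qb tK\<close>)
    qed (use 3 hn in auto)
  qed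
qed

end

section \<open>Joining and splitting trees\<close>

fun lo :: "tree option \<Rightarrow> trip list" where "lo None = []" | "lo (Some t) = leaves t"
fun good_treeo :: "int \<Rightarrow> tree option \<Rightarrow> bool" where "good_treeo K None = True" | "good_treeo K (Some t) = good_tree K t"
fun heighto :: "tree option \<Rightarrow> nat" where "heighto None = 0" | "heighto (Some t) = nat (height t)"
fun is_node2o :: "tree option \<Rightarrow> bool" where "is_node2o None = False" | "is_node2o (Some t) = is_node2 t"

lemma lo_eq_Nil [simp]: "lo x = [] \<longleftrightarrow> x = None" by (cases x) simp_all

lemma good_treeo_mono: "good_treeo K x \<Longrightarrow> K \<le> K' \<Longrightarrow> good_treeo K' x"
  by (cases x) (auto simp: good_tree_def intro: tree_bound_mono)

text \<open>Turns a bound on the number of cones into a bound \<open>h\<close> on heights, the form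
  in which the logarithm enters all later costs.\<close>

lemma heighto_length: "good_treeo K x \<Longrightarrow> length (lo x) < 2 ^ Suc h \<Longrightarrow> heighto x \<le> h"
proof (cases x)
  case (Some t)
  assume "good_treeo K x" "length (lo x) < 2 ^ Suc h"
  then have "(2::nat) ^ nat (height t) < 2 ^ Suc h" using height_length[of t] Some by (simp add: good_tree_def)
  then show ?thesis using Some by (simp add: power_strict_increasing_iff del: power_Suc)
qed simp

text \<open>The predicates by which trees are split are passed to the program as numbers.  Only 0 and 1 are
  monotone along an ordered list; for the others the first hit is found from the stored minima.\<close>

definition split_pred :: "int \<Rightarrow> int \<Rightarrow> trip \<Rightarrow> bool" where
  "split_pred k x m \<longleftrightarrow> (if k = 0 then x \<le> rgt m else if k = 1 then x < lft m else snd (get m (k - 2)) \<le> x)"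

definition split_sorted :: "int \<Rightarrow> int \<Rightarrow> trip list \<Rightarrow> bool" where
  "split_sorted k x xs \<longleftrightarrow> k \<in> {0, 1} \<longrightarrow> sorted_wrt (\<lambda>a b. split_pred k x a \<longrightarrow> split_pred k x b) xs"

lemma split_sorted_append: "split_sorted k x (xs @ ys) \<Longrightarrow> split_sorted k x xs \<and> split_sorted k x ys"
  by (auto simp: split_sorted_def sorted_wrt_append)

lemma split_sorted_last:
  assumes "split_sorted k x xs" "k \<in> {0, 1}" "xs \<noteq> []"
  shows "split_pred k x (last xs) \<longleftrightarrow> (\<exists>m \<in> set xs. split_pred k x m)"
proof -
  define ys where "ys = butlast xs"
  have xs: "xs = ys @ [last xs]" using assms(3) by (simp add: ys_def)
  have "sorted_wrt (\<lambda>a b. split_pred k x a \<longrightarrow> split_pred k x b) (ys @ [last xs])" using assms(1,2) xs unfolding split_sorted_def by metis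
  then have "\<forall>m \<in> set ys. split_pred k x m \<longrightarrow> split_pred k x (last xs)" by (simp add: sorted_wrt_append)
  moreover have "set xs = insert (last xs) (set ys)" using arg_cong[OF xs, of set] by simp
  ultimately show ?thesis by auto
qed

lemma split_first_append:
  "split_first p (xs @ ys) = (if \<exists>x \<in> set xs. p x then (fst (split_first p xs), snd (split_first p xs) @ ys)
     else (xs @ fst (split_first p ys), snd (split_first p ys)))"
  by (induction xs) (auto simp: split_first_def)

context prog
begin

text \<open>Written additively, the cost is the difference of the heights up to a constant. As the
  result is at least as high as both operands, the cost can be charged to the gain in height over
  the lower one. The last clause about \<open>x\<close> says that joining a lower tree to one with a
  binary root does not raise the height.\<close>

lemma wpc_JOIN:
  assumes "good_treeo K l" "good_treeo K r" "K \<le> W" "int (heighto l) + 1 \<le> W" "int (heighto r) + 1 \<le> W"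
    and Q: "\<And>x n. n + 20000 * min (heighto l) (heighto r) \<le> 20000 * max (heighto l) (heighto r) + 10000 \<Longrightarrow> good_treeo K x \<Longrightarrow>
       lo x = lo l @ lo r \<Longrightarrow> max (heighto l) (heighto r) \<le> heighto x \<Longrightarrow> heighto x \<le> Suc (max (heighto l) (heighto r)) \<Longrightarrow>
       (is_node2o l \<and> heighto r < heighto l \<or> is_node2o r \<and> heighto l < heighto r \<longrightarrow> heighto x = max (heighto l) (heighto r)) \<Longrightarrow> Q (enc_treeo x) n"
  shows "wpc cJOIN [enc_treeo l, enc_treeo r] Q"
proof -
  consider "l = None" | "l \<noteq> None" "r = None" | a b where "l = Some a" "r = Some b" by (cases l; cases r) auto
  then show ?thesis
  proof cases
    case 1
    have Q': "Q (enc_treeo r) n" if "n \<le> 100" for n by (rule Q) (use 1 that assms in auto)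
    show ?thesis by (rule wpcI) (use 1 W2 in \<open>auto simp: bJOIN_def intro!: wp_intros Q'\<close>)
  next
    case 2
    then obtain a where a: "l = Some a" by auto
    have Q': "Q (enc_tree a) n" if "n \<le> 100" for n
      by (rule Q[of n l, unfolded a enc_treeo.simps]) (use 2 a that assms in auto)
    show ?thesis by (rule wpcI) (use 2 a W2 in \<open>auto simp: bJOIN_def intro!: wp_intros Q'\<close>)
  next
    case 3
    have h: "0 \<le> height a" "0 \<le> height b" using assms 3 height_nonneg by (auto simp: good_tree_def)
    have hW: "height a + 1 \<le> W" "height b + 1 \<le> W" using assms 3 h by auto
    have tt: "good_tree K a" "good_tree K b" using assms(1,2) 3 by auto
    have d: "nat \<bar>height a - height b\<bar> + min (heighto l) (heighto r) = max (heighto l) (heighto r)" using h unfolding 3 heighto.simps by (auto simp: min_def max_def nat_diff_distrib)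
    have m: "nat (max (height a) (height b)) = max (heighto l) (heighto r)" using h 3 by (simp add: max_def)
    have tnd: "good_tree K (node2 t u)" if "good_tree K t" "good_tree K u" "height u = height t" for t u
      using that by (auto simp: good_tree_def tree_bound_nd intro!: wf_tree_nd)
    have Qa: "Q (enc_tree t) n" if "n \<le> 20000 * nat \<bar>height a - height b\<bar> + 10000" "good_tree K t"
      "leaves t = leaves a @ leaves b" "height t = max (height a) (height b) \<or>
        height t = max (height a) (height b) + 1 \<and> \<not> (is_node2 a \<and> height b < height a) \<and> \<not> (is_node2 b \<and> height a < height b)" for t n
    proof -
      have "nat (max (height a) (height b) + 1) = Suc (max (heighto l) (heighto r))" using m h by linarith
      then show ?thesis
        by (intro Q[of n "Some t", unfolded enc_treeo.simps]) (use that 3 d m h in \<open>auto simp: le_SucI\<close>)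
    qed
    have tK: "tree_bound K t" if "good_tree K t" for t using that by (simp add: good_tree_def)
    have "0 \<le> max (height a) (height b)" "max (height a) (height b) + 1 \<le> W" using h hW by auto
    then show ?thesis unfolding 3 enc_treeo.simps
      by (intro wpcI)
        (use W2 assms(3) in \<open>auto simp: bJOIN_def intro!: wp_intros wpc_JN[OF tt assms(3) hW] wpc_ND2[of K] Qa tnd tK\<close>)
  qed
qed

lemmas wpc_JOIN_eo = wpc_JOIN[where l = "Some l" for l, unfolded enc_treeo.simps(2)]
lemmas wpc_JOIN_oe = wpc_JOIN[where r = "Some r" for r, unfolded enc_treeo.simps(2)]

text \<open>Whether a subtree contains a hit is read off its root: from the last leaf for the two
  predicates that are monotone along the list, from a stored minimum for the others. The factor 2
  leaves room for the difference of two parameters.\<close>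

lemma wpc_SAT:
  assumes "good_tree K t" "2 * K \<le> W" "k \<in> {0, 1, 2, 3, 4}" "split_sorted k x (leaves t)"
    and Q: "\<And>n. n \<le> 2000 \<Longrightarrow> Q (VI (if \<exists>m \<in> set (leaves t). split_pred k x m then 1 else 0)) n"
  shows "wpc cSAT [VI k, VI x, enc_tree t] Q"
proof -
  have t: "wf_tree t" "tree_bound K t" using assms(1) by (simp_all add: good_tree_def)
  have b: "trip_bound K (last_leaf t)" using tree_bound_last_leaf[OF t(2)] .
  have "0 \<le> K" using trip_bound_nonneg b by blast
  then have KW: "K \<le> W" using assms(2) by simp
  have W': "\<bar>rgt (last_leaf t)\<bar> \<le> W" "\<bar>lft (last_leaf t)\<bar> \<le> W" using b assms(2) by (auto simp: trip_bound_def lft_def rgt_def vv_def aa_def bb_def)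
  define s where "s = (\<exists>m \<in> set (leaves t). split_pred k x m)"
  have Qs: "Q (VI 1) n" if "n \<le> 2000" "s" for n using Q[OF that(1)] that(2) by (simp add: s_def)
  have Qn: "Q (VI 0) n" if "n \<le> 2000" "\<not> s" for n using Q[OF that(1)] that(2) by (simp add: s_def)
  consider "k = 0" | "k = 1" | "k \<in> {2, 3, 4}" using assms(3) by auto
  then show ?thesis
  proof cases
    case 1
    then have s: "s \<longleftrightarrow> x \<le> rgt (last_leaf t)" using split_sorted_last[OF assms(4)] last_leaf_last[OF t(1)] by (simp add: s_def split_pred_def)
    show ?thesis
      by (rule wpcI) (use 1 s W2 W' KW t in \<open>auto simp: bSAT_def rgt_def vv_def bb_def intro!: wp_intros wpc_LS[of K] Qs Qn\<close>)
  next
    case 2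
    then have s: "s \<longleftrightarrow> x < lft (last_leaf t)" using split_sorted_last[OF assms(4)] last_leaf_last[OF t(1)] by (simp add: s_def split_pred_def)
    show ?thesis
      by (rule wpcI) (use 2 s W2 W' KW t in \<open>auto simp: bSAT_def lft_def vv_def aa_def intro!: wp_intros wpc_LS[of K] Qs Qn\<close>)
  next
    case 3
    then have "s \<longleftrightarrow> Min ((\<lambda>m. snd (get m (k - 2))) ` set (leaves t)) \<le> x" by (auto simp: s_def split_pred_def Min_le_iff)
    then have s: "s \<longleftrightarrow> snd (get (tree_min t) (k - 2)) \<le> x" using tree_min_Min[OF t(1)] by simp
    show ?thesis
      by (rule wpcI) (use 3 s W2 KW t in \<open>auto simp: bSAT_def intro!: wp_intros wpc_AG[of K] wpc_GET Qs Qn\<close>)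
  qed
qed

text \<open>The heights of the two parts act as a potential. A join on the way up costs the
  difference of the heights, which is about what the part gains, so the costs of all joins
  telescope; the parts never become higher than the tree.\<close>

lemma wpc_SPL:
  assumes "good_tree K t" "2 * K \<le> W" "height t + 1 \<le> W" "k \<in> {0, 1, 2, 3, 4}" "split_sorted k x (leaves t)"
    and Q: "\<And>l r n. n \<le> 60000 * (nat (height t) + 1) + 20000 * (heighto l + heighto r) \<Longrightarrow> good_treeo K l \<Longrightarrow> good_treeo K r \<Longrightarrow>
       heighto l \<le> nat (height t) \<Longrightarrow> heighto r \<le> nat (height t) \<Longrightarrow> split_first (split_pred k x) (leaves t) = (lo l, lo r) \<Longrightarrow> Q (VP (enc_treeo l) (enc_treeo r)) n"
  shows "wpc cSPL [VI k, VI x, enc_tree t] Q"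
  using assms
proof (induction "size t" arbitrary: t Q rule: less_induct)
  case less
  note IH = less.hyps and t = less.prems(1) and KW = less.prems(2) and h = less.prems(3)
    and k = less.prems(4) and so = less.prems(5) and Q = less.prems(6)
  have "0 \<le> K" using t tree_bound_last_leaf trip_bound_nonneg by (auto simp: good_tree_def)
  then have KW': "K \<le> W" using KW by simp
  have hn: "0 \<le> height t" using t height_nonneg by (simp add: good_tree_def)
  have rec: "wpc cSPL [VI k, VI x, enc_tree b] Q'"
    if b: "good_tree K b" "height b = height t - 1" "size b < size t" "split_sorted k x (leaves b)" and
    "\<And>l r n. n \<le> 60000 * nat (height t) + 20000 * (heighto l + heighto r) \<Longrightarrow> good_treeo K l \<Longrightarrow> good_treeo K r \<Longrightarrow>
       heighto l \<le> nat (height t) - 1 \<Longrightarrow> heighto r \<le> nat (height t) - 1 \<Longrightarrow> fst (split_first (split_pred k x) (leaves b)) = lo l \<Longrightarrow>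
       snd (split_first (split_pred k x) (leaves b)) = lo r \<Longrightarrow> Q' (VP (enc_treeo l) (enc_treeo r)) n" for Q' b
    apply (rule IH[OF b(3,1) KW _ k b(4)])
    subgoal using b(2) h by simp
    subgoal for l r n
      using b(2) height_nonneg[of b] b(1) by (intro that(5)) (auto simp: good_tree_def nat_diff_distrib)
    done
  have tK: "tree_bound K t" if "good_tree K t" for t using that by (simp add: good_tree_def)
  show ?case
  proof (cases t)
    case (Lf m)
    have Qa: "Q (VP (enc_tree t) (VI 0)) n" if "n \<le> 4000" "\<not> split_pred k x m" for n
      by (rule Q[of n "Some t" None, unfolded enc_treeo.simps]) (use Lf that t in \<open>auto simp: split_first_def\<close>)
    have Qb: "Q (VP (VI 0) (enc_tree t)) n" if "n \<le> 4000" "split_pred k x m" for n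
      by (rule Q[of n None "Some t", unfolded enc_treeo.simps]) (use Lf that t in \<open>auto simp: split_first_def\<close>)
    have sel: "vtl (enc_tree t) = VI 0" "leaves t = [m]" using Lf by simp_all
    show ?thesis
      by (rule wpcI) (use W2 sel in \<open>auto simp: bSPL_def intro!: wp_intros wpc_SAT[OF t KW k so] Qa Qb split: if_splits\<close>)
  next
    case (N2 m h' g s a b)
    define A where "A = apply_map m a"
    define B where "B = apply_map m b"
    have kb: "good_tree K A" "good_tree K B" "height A = height t - 1" "height B = height t - 1" "leaves t = leaves A @ leaves B"
        "size A < size t" "size B < size t"
      using t N2 tree_bound_kids(1)[of K m h' g s a b] by (auto simp: good_tree_def A_def B_def)
    have kt: "good_treeo K (Some A)" "good_treeo K (Some B)" using kb by simp_all
    have sk: "split_sorted k x (leaves A)" "split_sorted k x (leaves B)" using so split_sorted_append unfolding kb(5) by blast+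
    have lt: "tree_bound K (N2 m h' g s a b)" using t by (simp only: good_tree_def N2)
    have hA: "0 \<le> height A" using kb(1) height_nonneg by (simp add: good_tree_def)
    obtain D where D: "nat (height t) = Suc D" using kb(3) hA by (cases "nat (height t)") auto
    have nA: "heighto (Some A) = D" "heighto (Some B) = D" using kb D by auto
    have nW: "int q + 1 \<le> W" if "q \<le> Suc D" for q using that h hn D by linarith
    have sel: "vhd (enc_tree t) = enc_trip m" "vtl (enc_tree t) = VP (VP (VI h') (VP (enc_trip g) (enc_trip s))) (VP (enc_tree a) (VP (enc_tree b) (VI 0)))"
      using N2 by simp_all
    have Qa: "Q (VP (enc_treeo y) (enc_treeo r)) n" if "fst (split_first (split_pred k x) (leaves A @ leaves B)) = lo y"
      "snd (split_first (split_pred k x) (leaves A @ leaves B)) = lo r" "good_treeo K y" "good_treeo K r"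
      "heighto y \<le> Suc D" "heighto r \<le> Suc D" "n \<le> 60000 * (Suc D + 1) + 20000 * (heighto y + heighto r)" for y r n
      by (rule Q) (use that D in \<open>auto simp: kb(5) prod_eq_iff\<close>)
    have J1: "wpc cJOIN [enc_tree A, enc_treeo l] Q'" if "good_treeo K l" "heighto l \<le> D"
      "\<And>y n. n + 20000 * heighto l \<le> 20000 * heighto y + 10000 \<Longrightarrow> good_treeo K y \<Longrightarrow> lo y = leaves A @ lo l \<Longrightarrow>
         heighto y \<le> Suc D \<Longrightarrow> Q' (enc_treeo y) n" for l Q'
      by (rule wpc_JOIN_eo[OF kt(1) that(1) KW' nW nW]) (use that(2) nA in \<open>auto intro!: that(3)\<close>)
    have J2: "wpc cJOIN [enc_treeo l, enc_tree B] Q'" if "good_treeo K l" "heighto l \<le> D"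
      "\<And>y n. n + 20000 * heighto l \<le> 20000 * heighto y + 10000 \<Longrightarrow> good_treeo K y \<Longrightarrow> lo y = lo l @ leaves B \<Longrightarrow>
         heighto y \<le> Suc D \<Longrightarrow> Q' (enc_treeo y) n" for l Q'
      by (rule wpc_JOIN_oe[OF that(1) kt(2) KW' nW nW]) (use that(2) nA in \<open>auto intro!: that(3)\<close>)
    show ?thesis
      by (rule wpcI)
       (use W2 KW' D in \<open>auto simp: bSPL_def sel A_def[symmetric] B_def[symmetric] split_first_append intro!: wp_intros wpc_KID2[OF lt KW']
         wpc_SAT[OF kb(1) KW k sk(1)] rec[OF kb(1,3,6) sk(1)] rec[OF kb(2,4,7) sk(2)] J1 J2 Qa\<close>)
  next
    case (N3 m h' g s a b c)
    define A where "A = apply_map m a"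
    define B where "B = apply_map m b"
    define C where "C = apply_map m c"
    have kb: "good_tree K A" "good_tree K B" "good_tree K C" "height A = height t - 1" "height B = height t - 1" "height C = height t - 1"
        "leaves t = leaves A @ leaves B @ leaves C" "size A < size t" "size B < size t" "size C < size t"
      using t N3 tree_bound_kids(2)[of K m h' g s a b c] by (auto simp: good_tree_def A_def B_def C_def)
    have kt: "good_treeo K (Some A)" "good_treeo K (Some B)" "good_treeo K (Some C)" using kb by simp_all
    have sk: "split_sorted k x (leaves A)" "split_sorted k x (leaves B)" "split_sorted k x (leaves C)" using so split_sorted_append unfolding kb(7) by blast+
    have lt: "tree_bound K (N3 m h' g s a b c)" using t by (simp only: good_tree_def N3)
    have hA: "0 \<le> height A" using kb(1) height_nonneg by (simp add: good_tree_def)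
    obtain D where D: "nat (height t) = Suc D" using kb(4) hA by (cases "nat (height t)") auto
    have nA: "heighto (Some A) = D" "heighto (Some B) = D" "heighto (Some C) = D" using kb D by auto
    have nW: "int q + 1 \<le> W" if "q \<le> Suc D" for q using that h hn D by linarith
    have sel: "vhd (enc_tree t) = enc_trip m" "vtl (enc_tree t) = VP (VP (VI h') (VP (enc_trip g) (enc_trip s))) (VP (enc_tree a) (VP (enc_tree b) (enc_tree c)))"
      using N3 by simp_all
    have AB: "good_tree K (node2 A B)" "good_tree K (node2 B C)" using kb by (auto simp: good_tree_def tree_bound_nd wf_tree_nd)
    then have ktAB: "good_treeo K (Some (node2 A B))" "good_treeo K (Some (node2 B C))" by simp_all
    have nAB: "heighto (Some (node2 A B)) = Suc D" "heighto (Some (node2 B C)) = Suc D" using kb D hA by auto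
    have Qa: "Q (VP (enc_treeo y) (enc_treeo r)) n" if "fst (split_first (split_pred k x) (leaves A @ leaves B @ leaves C)) = lo y"
      "snd (split_first (split_pred k x) (leaves A @ leaves B @ leaves C)) = lo r" "good_treeo K y" "good_treeo K r"
      "heighto y \<le> Suc D" "heighto r \<le> Suc D" "n \<le> 60000 * (Suc D + 1) + 20000 * (heighto y + heighto r)" for y r n
      by (rule Q) (use that D in \<open>auto simp: kb(7) prod_eq_iff\<close>)
    have J1: "wpc cJOIN [enc_tree A, enc_treeo l] Q'" if "good_treeo K l" "heighto l \<le> D"
      "\<And>y n. n + 20000 * heighto l \<le> 20000 * heighto y + 10000 \<Longrightarrow> good_treeo K y \<Longrightarrow> lo y = leaves A @ lo l \<Longrightarrow>
         heighto y \<le> Suc D \<Longrightarrow> Q' (enc_treeo y) n" for l Q'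
      by (rule wpc_JOIN_eo[OF kt(1) that(1) KW' nW nW]) (use that(2) nA in \<open>auto intro!: that(3)\<close>)
    have J2: "wpc cJOIN [enc_treeo l, enc_tree C] Q'" if "good_treeo K l" "heighto l \<le> D"
      "\<And>y n. n + 20000 * heighto l \<le> 20000 * heighto y + 10000 \<Longrightarrow> good_treeo K y \<Longrightarrow> lo y = lo l @ leaves C \<Longrightarrow>
         heighto y \<le> Suc D \<Longrightarrow> Q' (enc_treeo y) n" for l Q'
      by (rule wpc_JOIN_oe[OF that(1) kt(3) KW' nW nW]) (use that(2) nA in \<open>auto intro!: that(3)\<close>)
    \<comment> \<open>The clause on binary roots is needed here: \<open>node2 A B\<close> is as high
      as \<open>t\<close>, the part joined to it is lower, so the result is not higher than
      \<open>t\<close>.\<close>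
    have J3: "wpc cJOIN [enc_tree (node2 A B), enc_treeo l] Q'" if "good_treeo K l" "heighto l \<le> D"
      "\<And>y n. n + 20000 * heighto l \<le> 20000 * heighto y + 10000 \<Longrightarrow> good_treeo K y \<Longrightarrow> lo y = leaves A @ leaves B @ lo l \<Longrightarrow>
         heighto y \<le> Suc D \<Longrightarrow> Q' (enc_treeo y) n" for l Q'
      by (rule wpc_JOIN_eo[OF ktAB(1) that(1) KW' nW nW]) (use that(2) nAB in \<open>auto intro!: that(3)\<close>)
    have J4: "wpc cJOIN [enc_treeo l, enc_tree (node2 B C)] Q'" if "good_treeo K l" "heighto l \<le> D"
      "\<And>y n. n + 20000 * heighto l \<le> 20000 * heighto y + 10000 \<Longrightarrow> good_treeo K y \<Longrightarrow> lo y = lo l @ leaves B @ leaves C \<Longrightarrow>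
         heighto y \<le> Suc D \<Longrightarrow> Q' (enc_treeo y) n" for l Q'
      by (rule wpc_JOIN_oe[OF that(1) ktAB(2) KW' nW nW]) (use that(2) nAB in \<open>auto intro!: that(3)\<close>)
    have hAW: "0 \<le> height A" "0 \<le> height B" "height A + 1 \<le> W" "height B + 1 \<le> W" using hA kb h by auto
    have tk: "tree_bound K A" "tree_bound K B" "tree_bound K C" using kb by (simp_all add: good_tree_def)
    show ?thesis
      by (rule wpcI)
       (use W2 KW' D in \<open>auto simp: bSPL_def sel A_def[symmetric] B_def[symmetric] C_def[symmetric] split_first_append intro!: wp_intros wpc_KID3[OF lt KW']
         wpc_SAT[OF kb(1) KW k sk(1)] wpc_SAT[OF kb(2) KW k sk(2)] rec[OF kb(1,4,8) sk(1)] rec[OF kb(2,5,9) sk(2)] rec[OF kb(3,6,10) sk(3)]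
         wpc_ND2[OF tk(1,2) KW' hAW(1,3)] wpc_ND2[OF tk(2,3) KW' hAW(2,4)] J1 J2 J3 J4 Qa\<close>)
  qed
qed

end

section \<open>Processing a block\<close>

lemma tree_bound_leaves: "tree_bound K t \<Longrightarrow> m \<in> set (leaves t) \<Longrightarrow> trip_bound K m"
proof (induction t arbitrary: K m)
  case (N2 \<mu> h g l a b)
  then obtain k where k: "trip_bound k \<mu>" "tree_bound (K - k) a" "tree_bound (K - k) b" by auto
  from N2.prems obtain m' where "m = comp_map \<mu> m'" "m' \<in> set (leaves a) \<or> m' \<in> set (leaves b)" by auto
  then show ?case using N2.IH(1)[OF k(2)] N2.IH(2)[OF k(3)] trip_bound_comp_map[OF k(1), of "K - k" m'] by auto
next
  case (N3 \<mu> h g l a b c)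
  then obtain k where k: "trip_bound k \<mu>" "tree_bound (K - k) a" "tree_bound (K - k) b" "tree_bound (K - k) c" by auto
  from N3.prems obtain m' where "m = comp_map \<mu> m'" "m' \<in> set (leaves a) \<or> m' \<in> set (leaves b) \<or> m' \<in> set (leaves c)" by auto
  then show ?case using N3.IH(1)[OF k(2)] N3.IH(2)[OF k(3)] N3.IH(3)[OF k(4)] trip_bound_comp_map[OF k(1), of "K - k" m'] by auto
qed simp

text \<open>The last conjunct keeps the sentinel from winning the comparison of the three
  classes.\<close>

definition cuttable :: "int \<Rightarrow> int \<Rightarrow> trip list \<Rightarrow> bool" where
  "cuttable bg e t \<longleftrightarrow> sorted (map lft t) \<and> sorted (map rgt t) \<and> (\<exists>x \<in> set t. cone x e < bg)"

definition blk_bottom :: "int \<Rightarrow> bool \<Rightarrow> int \<Rightarrow> int \<Rightarrow> int \<Rightarrow> trip list \<Rightarrow> trip list \<Rightarrow> trip list" where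
  "blk_bottom bg eq h w c L T = (if eq then fst (cut_list bg (c + w - h) (L @ T))
     else fst (cut_list bg (c + w - h) (map (comp_map (left_to_bottom (c - h))) L @ map (comp_map (top_to_bottom h)) T)))"

definition blk_right :: "int \<Rightarrow> bool \<Rightarrow> int \<Rightarrow> int \<Rightarrow> int \<Rightarrow> trip list \<Rightarrow> trip list \<Rightarrow> trip list" where
  "blk_right bg eq h w c L T = (if eq then snd (cut_list bg (c + w - h) (L @ T))
     else snd (cut_list bg (c + w - h) (map (comp_map (left_to_right w)) L @ map (comp_map (top_to_right (c + w))) T)))"

context prog
begin

lemma wpc_SPLO:
  assumes "good_treeo K t" "2 * K \<le> W" "length (lo t) < 2 ^ Suc h" "int h + 1 \<le> W" "k \<in> {0, 1, 2, 3, 4}" "split_sorted k x (lo t)"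
    and Q: "\<And>l r n. n \<le> 200000 * Suc h \<Longrightarrow> good_treeo K l \<Longrightarrow> good_treeo K r \<Longrightarrow> split_first (split_pred k x) (lo t) = (lo l, lo r) \<Longrightarrow> Q (VP (enc_treeo l) (enc_treeo r)) n"
  shows "wpc cSPLO [VI k, VI x, enc_treeo t] Q"
proof (cases t)
  case None
  have Qa: "Q (VP (VI 0) (VI 0)) n" if "n \<le> 200000" for n
    by (rule Q[of n None None, unfolded enc_treeo.simps]) (use that None in \<open>auto simp: split_first_def\<close>)
  show ?thesis by (rule wpcI) (use W2 None in \<open>auto simp: bSPLO_def intro!: wp_intros Qa\<close>)
next
  case (Some a)
  have a: "good_tree K a" "split_sorted k x (leaves a)" using assms Some by simp_all
  have heighto: "nat (height a) \<le> h" using heighto_length[OF assms(1,3)] Some by simp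
  then have hW: "height a + 1 \<le> W" using assms(4) by linarith
  have Qa: "Q (VP (enc_treeo l) (enc_treeo r)) n" if "n \<le> 60000 * (nat (height a) + 1) + 20000 * (heighto l + heighto r) + 1000" "good_treeo K l" "good_treeo K r"
     "heighto l \<le> nat (height a)" "heighto r \<le> nat (height a)" "split_first (split_pred k x) (leaves a) = (lo l, lo r)" for l r n
    by (rule Q) (use that Some heighto in auto)
  show ?thesis by (rule wpcI) (use W2 Some in \<open>auto simp: bSPLO_def intro!: wp_intros wpc_SPL[OF a(1) assms(2) hW assms(5) a(2)] Qa\<close>)
qed

lemma wpc_JOINU:
  assumes "good_treeo K l" "good_treeo K r" "K \<le> W" "length (lo l) + length (lo r) < 2 ^ Suc h" "int h + 1 \<le> W"
    and Q: "\<And>x n. n \<le> 20000 * Suc h \<Longrightarrow> good_treeo K x \<Longrightarrow> lo x = lo l @ lo r \<Longrightarrow> Q (enc_treeo x) n"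
  shows "wpc cJOIN [enc_treeo l, enc_treeo r] Q"
proof -
  have h: "heighto l \<le> h" "heighto r \<le> h" using heighto_length[OF assms(1), of h] heighto_length[OF assms(2), of h] assms(4) by auto
  then have hW: "int (heighto l) + 1 \<le> W" "int (heighto r) + 1 \<le> W" using assms(5) by linarith+
  show ?thesis
    by (rule wpc_JOIN[OF assms(1,2,3) hW]) (use h in \<open>auto intro!: Q\<close>)
qed

lemma wpc_APPO:
  assumes "trip_bound J \<mu>" "good_treeo K t" "J + K \<le> W"
    and Q: "\<And>x n. n \<le> 1000 \<Longrightarrow> good_treeo (J + K) x \<Longrightarrow> lo x = map (comp_map \<mu>) (lo t) \<Longrightarrow> Q (enc_treeo x) n"
  shows "wpc cAPPO [enc_trip \<mu>, enc_treeo t] Q"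
proof (cases t)
  case None
  have Qa: "Q (VI 0) n" if "n \<le> 1000" for n using Q[of n None] that None by simp
  show ?thesis by (rule wpcI) (use W2 None in \<open>auto simp: bAPPO_def intro!: wp_intros Qa\<close>)
next
  case (Some a)
  have Qa: "Q (enc_tree (apply_map \<mu> a)) n" if "n \<le> 1000" for n
    using Q[of n "Some (apply_map \<mu> a)"] that Some assms(1,2) tree_bound_apply_map by (simp add: good_tree_def)
  have "tree_bound K a" using Some assms(2) by (simp add: good_tree_def)
  then show ?thesis
    by (intro wpcI) (use W2 Some assms(1,3) in \<open>auto simp: bAPPO_def intro!: wp_intros wpc_APP[of J _ K] Qa\<close>)
qed

lemma wpc_FLF_tree:
  assumes "good_tree K t" "K \<le> W"
    and Q: "\<And>n. n \<le> 2000 * Suc (nat (height t)) \<Longrightarrow> Q (enc_tree (Lf (hd (leaves t)))) n"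
  shows "wpc cFLF [enc_tree t] Q"
  using assms
proof (induction "size t" arbitrary: t Q rule: less_induct)
  case less
  note t = less.prems(1) and KW = less.prems(2) and Q = less.prems(3)
  have step: "wpc cFLF [enc_tree t] Q"
    if lt: "\<And>Q'. (\<And>n. n \<le> 800 \<Longrightarrow> Q' (enc_tree (apply_map m a)) n) \<Longrightarrow> wpc cAPP [enc_trip m, enc_tree a] Q'"
      and a: "good_tree K (apply_map m a)" "hd (leaves t) = hd (leaves (apply_map m a))" "height t = height a + 1" "size a < size t"
      and sel: "vhd (enc_tree t) = enc_trip m" "isP (vtl (enc_tree t))" "isP (vtl (vtl (enc_tree t)))" "vhd (vtl (vtl (enc_tree t))) = enc_tree a" for m a
  proof -
    have "0 \<le> height a" using a(1) height_nonneg by (auto simp: good_tree_def)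
    then have h: "nat (height t) = Suc (nat (height a))" using a(3) by simp
    have rec: "wpc cFLF [enc_tree (apply_map m a)] Q'" if "\<And>n. n \<le> 2000 * Suc (nat (height a)) \<Longrightarrow> Q' (enc_tree (Lf (hd (leaves t)))) n" for Q'
      by (rule less.hyps[OF _ a(1) KW]) (use a(4) that a(2) in auto)
    have Qa: "Q (enc_tree (Lf (hd (leaves t)))) n" if "n \<le> 2000 * Suc (nat (height a)) + 2000" for n
      by (rule Q) (use that h in simp)
    have z: "vtl (enc_tree t) \<noteq> VI 0" using sel(2) by auto
    show ?thesis
      by (rule wpcI) (use W2 z in \<open>auto simp: bFLF_def sel simp del: enc_tree.simps intro!: wp_intros lt rec Qa\<close>)
  qed
  show ?case
  proof (cases t)
    case (Lf m)
    have sel: "vtl (enc_tree t) = VI 0" using Lf by simp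
    have Qa: "Q (enc_tree t) n" if "n \<le> 500" for n using Q[of n] that Lf t by simp
    show ?thesis by (rule wpcI) (use W2 sel in \<open>auto simp: bFLF_def intro!: wp_intros Qa\<close>)
  next
    case (N2 m h g s a b)
    have lt: "tree_bound K (N2 m h g s a b)" using t by (simp only: good_tree_def N2)
    show ?thesis
      by (rule step[of m a], rule wpc_KID2[OF lt KW]) (use t N2 tree_bound_kids(1)[OF lt] in \<open>auto simp: good_tree_def\<close>)
  next
    case (N3 m h g s a b c)
    have lt: "tree_bound K (N3 m h g s a b c)" using t by (simp only: good_tree_def N3)
    show ?thesis
      by (rule step[of m a], rule wpc_KID3[OF lt KW]) (use t N3 tree_bound_kids(2)[OF lt] in \<open>auto simp: good_tree_def\<close>)
  qed
qed

lemma wpc_FLF: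
  assumes "good_treeo K t" "K \<le> W" "lo t \<noteq> []" "length (lo t) < 2 ^ Suc h"
    and Q: "\<And>x n. n \<le> 2000 * Suc h \<Longrightarrow> good_treeo K x \<Longrightarrow> lo x = [hd (lo t)] \<Longrightarrow> Q (enc_treeo x) n"
  shows "wpc cFLF [enc_treeo t] Q"
proof -
  obtain a where a: "t = Some a" using assms(3) by (cases t) auto
  have ta: "good_tree K a" using assms(1) a by simp
  have h: "nat (height a) \<le> h" using heighto_length[OF assms(1,4)] a by simp
  have bl: "trip_bound K (hd (leaves a))" using tree_bound_leaves[of K a "hd (leaves a)"] ta by (simp add: good_tree_def)
  have Qa: "Q (enc_tree (Lf (hd (leaves a)))) n" if "n \<le> 2000 * Suc (nat (height a))" for n
    using Q[of n "Some (Lf (hd (leaves a)))"] that h a bl by (simp add: good_tree_def)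
  show ?thesis unfolding a enc_treeo.simps by (rule wpc_FLF_tree[OF ta assms(2)]) (rule Qa)
qed

lemma wpc_MV:
  assumes "good_treeo K t" "K + \<bar>s\<bar> \<le> W"
    and Q: "\<And>n. n \<le> 2000 \<Longrightarrow> \<bar>min_list_val bg (\<lambda>m. snd (get m i) + s) (lo t)\<bar> \<le> max (K + \<bar>s\<bar>) \<bar>bg\<bar> \<Longrightarrow>
      Q (VI (min_list_val bg (\<lambda>m. snd (get m i) + s) (lo t))) n"
  shows "wpc cMV [enc_treeo t, VI i, VI s, VI bg] Q"
proof (cases t)
  case None
  have Qa: "Q (VI bg) n" if "n \<le> 2000" for n using Q[OF that] None by (simp add: min_list_val_def)
  show ?thesis by (rule wpcI) (use W2 None in \<open>auto simp: bMV_def intro!: wp_intros Qa\<close>)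
next
  case (Some a)
  have a: "wf_tree a" "tree_bound K a" using assms(1) Some by (simp_all add: good_tree_def)
  have b: "\<bar>snd (get (tree_min a) i)\<bar> \<le> K" using trip_bound_get tree_bound_tree_min a by blast
  have "min_list_val bg (\<lambda>m. snd (get m i) + s) (lo t) = snd (get (tree_min a) i) + s"
    using Some tree_min_Min[OF a(1), of i] Min_image_add[of "set (leaves a)" "\<lambda>m. snd (get m i)" s] by (simp add: min_list_val_def)
  then have Qa: "Q (VI (snd (get (tree_min a) i) + s)) n" if "n \<le> 2000" for n using Q[OF that] b by simp
  have "\<bar>snd (get (tree_min a) i) + s\<bar> \<le> W" "K \<le> W" using b assms(2) by linarith+
  then show ?thesis
    by (intro wpcI) (use W2 Some a in \<open>auto simp: bMV_def intro!: wp_intros wpc_AG[of K] wpc_GET Qa\<close>)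
qed

lemma wpc_MIN:
  assumes Q: "\<And>n. n \<le> 100 \<Longrightarrow> Q (VI (min x y)) n"
  shows "wpc cMIN [VI x, VI y] Q"
proof (cases "x < y")
  case True
  then have "min x y = x" by simp
  then show ?thesis by (intro wpcI) (use W2 True Q in \<open>auto simp: bMIN_def intro!: wp_intros\<close>)
next
  case False
  then have "min x y = y" by simp
  then show ?thesis by (intro wpcI) (use W2 False Q in \<open>auto simp: bMIN_def intro!: wp_intros\<close>)
qed

section \<open>The cut as carried out on trees\<close>

lemma eM_enc_trip: "VP (VP (VI a) (VI b)) (VP (VP (VI c) (VI d)) (VP (VI e) (VI f))) = enc_trip (Trip (a, b) (c, d) (e, f))"
  by (simp add: enc_trip_def enc_comp_def)

lemma wpc_CRN:
  assumes "\<bar>v\<bar> + \<bar>d\<bar> \<le> J" "J \<le> W"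
    and Q: "\<And>x n. n \<le> 500 \<Longrightarrow> good_treeo J x \<Longrightarrow> lo x = [corner v d] \<Longrightarrow> Q (enc_treeo x) n"
  shows "wpc cCRN [VI v, VI d] Q"
proof -
  have b: "\<bar>v + d\<bar> \<le> W" "\<bar>v - d\<bar> \<le> W" "trip_bound J (corner v d)" using assms by (auto simp: trip_bound_def corner_def)
  have Qa: "Q (VP (enc_trip (corner v d)) (VI 0)) n" if "n \<le> 500" for n
    using Q[of n "Some (Lf (corner v d))"] that b by (simp add: good_tree_def)
  show ?thesis
    by (rule wpcI) (use W2 b in \<open>auto simp: bCRN_def eM_enc_trip intro!: wp_intros Qa[unfolded corner_def]\<close>)
qed

lemma wpc_MCL: "(\<And>n. n \<le> 200 \<Longrightarrow> Q (enc_trip (clip_left e)) n) \<Longrightarrow> wpc cMCL [VI e] Q"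
  by (rule wpcI) (use W2 in \<open>auto simp: bMCL_def eM_enc_trip clip_left_def intro!: wp_intros\<close>)

lemma wpc_MCR: "\<bar>e\<bar> \<le> W \<Longrightarrow> (\<And>n. n \<le> 200 \<Longrightarrow> Q (enc_trip (clip_right e)) n) \<Longrightarrow> wpc cMCR [VI e] Q"
  by (rule wpcI) (use W2 in \<open>auto simp: bMCR_def eM_enc_trip clip_right_def intro!: wp_intros\<close>)

lemma trip_bound_clip_left: "\<bar>e\<bar> \<le> E \<Longrightarrow> trip_bound E (clip_left e)" and trip_bound_clip_right: "\<bar>e\<bar> \<le> E \<Longrightarrow> trip_bound E (clip_right e)"
  by (auto simp: trip_bound_def clip_left_def clip_right_def)

lemma split_pred_simps: "split_pred 2 x = (\<lambda>m. vv m \<le> x)" "split_pred 3 x = (\<lambda>m. aa m \<le> x)" "split_pred 4 x = (\<lambda>m. bb m \<le> x)"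
  "split_pred 0 x = (\<lambda>m. x \<le> rgt m)" "split_pred 1 x = (\<lambda>m. x < lft m)"
  by (auto simp: split_pred_def get_def vv_def aa_def bb_def)

lemma wpc_JU:
  assumes "good_treeo J l" "good_treeo J r" "J \<le> W" "length (lo l @ lo r) < N" "N \<le> 2 ^ Suc h" "int h + 1 \<le> W"
    and Q: "\<And>x n. n \<le> 20000 * Suc h \<Longrightarrow> good_treeo J x \<Longrightarrow> lo x = lo l @ lo r \<Longrightarrow> Q (enc_treeo x) n"
  shows "wpc cJOIN [enc_treeo l, enc_treeo r] Q"
  by (rule wpc_JOINU[OF assms(1-3)]) (use assms in auto)

text \<open>Two bounds are carried at once, because a cut joins trees both before and after a
  clipping map is applied. Before the map the sharper bound \<open>K\<close> has to survive, as the
  map adds \<open>E\<close>; afterwards only \<open>J\<close> holds.\<close>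

lemma wpc_JK:
  assumes "K \<le> J" "J \<le> W" "N \<le> 2 ^ Suc h" "int h + 1 \<le> W"
    and "good_treeo J l" "good_treeo J r" "length (lo l @ lo r) < N"
    and Q: "\<And>x n. n \<le> 20000 * Suc h \<Longrightarrow> good_treeo J x \<Longrightarrow> (good_treeo K l \<and> good_treeo K r \<longrightarrow> good_treeo K x) \<Longrightarrow>
      lo x = lo l @ lo r \<Longrightarrow> Q (enc_treeo x) n"
  shows "wpc cJOIN [enc_treeo l, enc_treeo r] Q"
proof (cases "good_treeo K l \<and> good_treeo K r")
  case True
  show ?thesis by (rule wpc_JU[of K, OF _ _ _ assms(7,3,4)]) (use True assms(1,2) good_treeo_mono in \<open>auto intro!: Q\<close>)
next
  case False
  show ?thesis by (rule wpc_JU[OF assms(5,6,2,7,3,4)]) (use False in \<open>auto intro!: Q\<close>)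
qed

text \<open>The growth by \<open>2 * E\<close> comes from the corner: the minimum \<open>D\<close>
  may reach \<open>K + E\<close>, and the arms of the corner add the absolute value of
  \<open>e\<close> once more.\<close>

lemma wpc_CUT1:
  assumes t: "good_treeo K p" "good_treeo K m" "good_treeo K s" and K: "K + 2 * E \<le> J" "2 * J \<le> W" "\<bar>e\<bar> \<le> E" "\<bar>D\<bar> \<le> K + E" "0 \<le> K"
    and len: "length (lo p) + length (lo m) + length (lo s) + 1 < N" "N \<le> 2 ^ Suc h" "int h + 1 \<le> W"
    and b: "split_first (\<lambda>x. bb x \<le> D - e) (lo p) = (P1, P2)" "P2 \<noteq> []"
    and Q: "\<And>l r n. n \<le> 400000 * Suc h \<Longrightarrow> good_treeo J l \<Longrightarrow> good_treeo J r \<Longrightarrow> lo l = P1 @ [hd P2] \<Longrightarrow>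
      lo r = corner D e # map (comp_map (clip_left e)) (lo m) @ lo s \<Longrightarrow> Q (VP (enc_treeo l) (enc_treeo r)) n"
  shows "wpc cCUT1 [VI e, VI D, enc_treeo p, enc_treeo m, enc_treeo s] Q"
proof -
  have W': "\<bar>D - e\<bar> \<le> W" "2 * K \<le> W" "K \<le> W" "J \<le> W" "K \<le> J" "E + K \<le> W" "E + K \<le> J" "\<bar>D\<bar> + \<bar>e\<bar> \<le> J" using K by linarith+
  have lp: "lo p = P1 @ P2" using split_first_props(1)[OF b(1)] .
  have l1: "length P1 + length P2 + length (lo m) + length (lo s) + 1 < N" "1 \<le> length P2" using len lp b(2) by (auto simp: Suc_le_eq)
  have tJ: "good_treeo J s" using t W' by (auto intro: good_treeo_mono)
  have S: "wpc cSPLO [VI 4, VI (D - e), enc_treeo p] Q'"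
    if "\<And>l r n. n \<le> 200000 * Suc h \<Longrightarrow> good_treeo J l \<Longrightarrow> good_treeo J r \<Longrightarrow> lo l = P1 \<Longrightarrow> lo r = P2 \<Longrightarrow> Q' (VP (enc_treeo l) (enc_treeo r)) n" for Q'
    by (rule wpc_SPLO[OF t(1) W'(2) _ len(3)]) (use len b W'(5) good_treeo_mono in \<open>auto simp: split_pred_simps split_sorted_def intro!: that\<close>)
  have F: "wpc cFLF [enc_treeo x] Q'" if "good_treeo J x" "lo x = P2"
     "\<And>x n. n \<le> 2000 * Suc h \<Longrightarrow> good_treeo J x \<Longrightarrow> lo x = [hd P2] \<Longrightarrow> Q' (enc_treeo x) n" for x Q'
    by (rule wpc_FLF[OF that(1) W'(4)]) (use that len lp b in auto)
  have A: "wpc cAPPO [enc_trip (clip_left e), enc_treeo m] Q'"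
    if "\<And>x n. n \<le> 1000 \<Longrightarrow> good_treeo J x \<Longrightarrow> lo x = map (comp_map (clip_left e)) (lo m) \<Longrightarrow> Q' (enc_treeo x) n" for Q'
    by (rule wpc_APPO[OF trip_bound_clip_left[OF K(3)] t(2) W'(6)]) (use W' good_treeo_mono in \<open>auto intro!: that\<close>)
  show ?thesis
    by (rule wpcI) (use W2 l1 tJ in \<open>auto simp: bCUT1_def W'(1) simp del: enc_treeo.simps intro!: wp_intros S F wpc_JU[OF _ _ W'(4) _ len(2,3)]
      wpc_CRN[OF W'(8,4)] wpc_MCL A Q\<close>)
qed

lemma wpc_CUT2:
  assumes t: "good_treeo K p" "good_treeo K m" "good_treeo K s" and K: "K + 2 * E \<le> J" "2 * J \<le> W" "\<bar>e\<bar> \<le> E" "\<bar>D\<bar> \<le> K + E" "0 \<le> K"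
    and len: "length (lo p) + length (lo m) + length (lo s) + 1 < N" "N \<le> 2 ^ Suc h" "int h + 1 \<le> W"
    and b: "split_first (\<lambda>x. vv x \<le> D) (lo m) = (P1, P2)" "P2 \<noteq> []"
    and Q: "\<And>l r n. n \<le> 400000 * Suc h \<Longrightarrow> good_treeo J l \<Longrightarrow> good_treeo J r \<Longrightarrow> lo l = lo p @ map (comp_map (clip_right e)) (P1 @ [hd P2]) \<Longrightarrow>
      lo r = map (comp_map (clip_left e)) P2 @ lo s \<Longrightarrow> Q (VP (enc_treeo l) (enc_treeo r)) n"
  shows "wpc cCUT2 [VI e, VI D, enc_treeo p, enc_treeo m, enc_treeo s] Q"
proof -
  have W': "\<bar>D\<bar> \<le> W" "2 * K \<le> W" "K \<le> W" "J \<le> W" "K \<le> J" "E + K \<le> W" "E + K \<le> J" "\<bar>e\<bar> \<le> W" using K by linarith+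
  have lp: "lo m = P1 @ P2" using split_first_props(1)[OF b(1)] .
  have l1: "length (lo p) + length P1 + length P2 + length (lo s) + 1 < N" "1 \<le> length P2" using len lp b(2) by (auto simp: Suc_le_eq)
  have tJ: "good_treeo J s" "good_treeo J p" using t W' by (auto intro: good_treeo_mono)
  have S: "wpc cSPLO [VI 2, VI D, enc_treeo m] Q'"
    if "\<And>l r n. n \<le> 200000 * Suc h \<Longrightarrow> good_treeo K l \<Longrightarrow> good_treeo K r \<Longrightarrow> good_treeo J l \<Longrightarrow> good_treeo J r \<Longrightarrow>
      lo l = P1 \<Longrightarrow> lo r = P2 \<Longrightarrow> Q' (VP (enc_treeo l) (enc_treeo r)) n" for Q'
    by (rule wpc_SPLO[OF t(2) W'(2) _ len(3)]) (use len b W'(5) good_treeo_mono in \<open>auto simp: split_pred_simps split_sorted_def intro!: that\<close>)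
  have F: "wpc cFLF [enc_treeo x] Q'" if "good_treeo K x" "lo x = P2"
     "\<And>x n. n \<le> 2000 * Suc h \<Longrightarrow> good_treeo K x \<Longrightarrow> good_treeo J x \<Longrightarrow> lo x = [hd P2] \<Longrightarrow> Q' (enc_treeo x) n" for x Q'
    by (rule wpc_FLF[OF that(1) W'(3)]) (use that len lp b W'(5) good_treeo_mono in auto)
  have A: "wpc cAPPO [enc_trip \<mu>, enc_treeo m] Q'"
    if "trip_bound E \<mu>" "good_treeo K m" "\<And>x n. n \<le> 1000 \<Longrightarrow> good_treeo J x \<Longrightarrow> lo x = map (comp_map \<mu>) (lo m) \<Longrightarrow> Q' (enc_treeo x) n" for Q' m \<mu>
    by (rule wpc_APPO[OF that(1,2) W'(6)]) (use W' good_treeo_mono in \<open>auto intro!: that\<close>)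
  show ?thesis
    by (rule wpcI) (use W2 l1 tJ in \<open>auto simp: bCUT2_def W'(1,8) simp del: enc_treeo.simps intro!: wp_intros S F wpc_JK[OF W'(5,4) len(2,3)]
      wpc_MCL wpc_MCR trip_bound_clip_left trip_bound_clip_right K(3) A Q\<close>)
qed

lemma wpc_CUT3:
  assumes t: "good_treeo K p" "good_treeo K m" "good_treeo K s" and K: "K + 2 * E \<le> J" "2 * J \<le> W" "\<bar>e\<bar> \<le> E" "\<bar>D\<bar> \<le> K + E" "0 \<le> K"
    and len: "length (lo p) + length (lo m) + length (lo s) + 1 < N" "N \<le> 2 ^ Suc h" "int h + 1 \<le> W"
    and b: "split_first (\<lambda>x. aa x \<le> D + e) (lo s) = (P1, P2)"
    and Q: "\<And>l r n. n \<le> 400000 * Suc h \<Longrightarrow> good_treeo J l \<Longrightarrow> good_treeo J r \<Longrightarrow>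
      lo l = lo p @ map (comp_map (clip_right e)) (lo m) @ [corner D e] \<Longrightarrow> lo r = P2 \<Longrightarrow> Q (VP (enc_treeo l) (enc_treeo r)) n"
  shows "wpc cCUT3 [VI e, VI D, enc_treeo p, enc_treeo m, enc_treeo s] Q"
proof -
  have W': "\<bar>D + e\<bar> \<le> W" "2 * K \<le> W" "K \<le> W" "J \<le> W" "K \<le> J" "E + K \<le> W" "E + K \<le> J" "\<bar>D\<bar> + \<bar>e\<bar> \<le> J" "\<bar>e\<bar> \<le> W" using K by linarith+
  have lp: "lo s = P1 @ P2" using split_first_props(1)[OF b(1)] .
  have l1: "length (lo p) + length (lo m) + length P1 + length P2 + 1 < N" using len lp by auto
  have tJ: "good_treeo J p" using t W' by (auto intro: good_treeo_mono)
  have S: "wpc cSPLO [VI 3, VI (D + e), enc_treeo s] Q'"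
    if "\<And>l r n. n \<le> 200000 * Suc h \<Longrightarrow> good_treeo J l \<Longrightarrow> good_treeo J r \<Longrightarrow> lo l = P1 \<Longrightarrow> lo r = P2 \<Longrightarrow> Q' (VP (enc_treeo l) (enc_treeo r)) n" for Q'
    by (rule wpc_SPLO[OF t(3) W'(2) _ len(3)]) (use len b W'(5) good_treeo_mono in \<open>auto simp: split_pred_simps split_sorted_def intro!: that\<close>)
  have A: "wpc cAPPO [enc_trip (clip_right e), enc_treeo m] Q'"
    if "\<And>x n. n \<le> 1000 \<Longrightarrow> good_treeo J x \<Longrightarrow> lo x = map (comp_map (clip_right e)) (lo m) \<Longrightarrow> Q' (enc_treeo x) n" for Q'
    by (rule wpc_APPO[OF trip_bound_clip_right[OF K(3)] t(2) W'(6)]) (use W' good_treeo_mono in \<open>auto intro!: that\<close>)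
  show ?thesis
    by (rule wpcI) (use W2 l1 tJ in \<open>auto simp: bCUT3_def W'(1,9) simp del: enc_treeo.simps intro!: wp_intros S wpc_JU[OF _ _ W'(4) _ len(2,3)]
      wpc_CRN[OF W'(8,4)] wpc_MCR A Q\<close>)
qed

lemma sorted_split_sorted:
  "sorted (map rgt xs) \<Longrightarrow> split_sorted 0 e xs" "sorted (map lft xs) \<Longrightarrow> split_sorted 1 e xs"
  unfolding split_sorted_def split_pred_simps sorted_wrt_map by (auto elim!: sorted_wrt_mono_rel[rotated])

lemma wpc_CUT:
  assumes t: "good_treeo K t" and cut: "cuttable bg e (lo t)"
    and K: "K + 2 * E \<le> J" "2 * J \<le> W" "\<bar>e\<bar> \<le> E" "\<bar>bg\<bar> \<le> E" "0 \<le> K"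
    and len: "length (lo t) + 1 < N" "N \<le> 2 ^ Suc h" "int h + 1 \<le> W"
    and Q: "\<And>l r n. n \<le> 1000000 * Suc h \<Longrightarrow> good_treeo J l \<Longrightarrow> good_treeo J r \<Longrightarrow> lo l = fst (cut_list bg e (lo t)) \<Longrightarrow>
      lo r = snd (cut_list bg e (lo t)) \<Longrightarrow> Q (VP (enc_treeo l) (enc_treeo r)) n"
  shows "wpc cCUT [VI bg, VI e, enc_treeo t] Q"
proof -
  have W': "2 * K \<le> W" "\<bar>e\<bar> \<le> W" "K + \<bar>e\<bar> \<le> W" "K + \<bar>- e\<bar> \<le> W" "K + \<bar>0\<bar> \<le> W" using K by linarith+
  obtain p r where split_pred: "split_first (\<lambda>x. e \<le> rgt x) (lo t) = (p, r)" by force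
  obtain m s where ms: "split_first (\<lambda>x. e < lft x) r = (m, s)" by force
  have tp: "lo t = p @ r" "r = m @ s" using split_first_props(1)[OF split_pred] split_first_props(1)[OF ms] by auto
  have so: "split_sorted 0 e (lo t)" "split_sorted 1 e r"
    using cut tp by (auto simp: cuttable_def sorted_append intro!: sorted_split_sorted)
  have l1: "length p + length m + length s + 1 < N" using len tp by simp
  define vp where "vp = min_list_val bg (\<lambda>x. bb x + e) p"
  define vm where "vm = min_list_val bg vv m"
  define vs where "vs = min_list_val bg (\<lambda>x. aa x - e) s"
  define D where "D = min vp (min vm vs)"
  have mv: "min_list_val bg (\<lambda>m. snd (get m 2) + e) p = vp" "min_list_val bg (\<lambda>m. snd (get m 0) + 0) m = vm" "min_list_val bg (\<lambda>m. snd (get m 1) + - e) s = vs"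
    by (simp_all add: vp_def vm_def vs_def get_def vv_def[abs_def] aa_def bb_def)
  have "D < bg"
  proof -
    obtain x where x: "x \<in> set (lo t)" "cone x e < bg" using cut by (auto simp: cuttable_def)
    have "min_list_val bg f xs \<le> cone x e" if "x \<in> set xs" "f x \<le> cone x e" for f xs
    proof -
      have "Min (f ` set xs) \<le> f x" using that by simp
      moreover have "min_list_val bg f xs = Min (f ` set xs)" using that(1) by (auto simp: min_list_val_def)
      ultimately show ?thesis using that(2) by linarith
    qed
    then have "vp \<le> cone x e \<or> vm \<le> cone x e \<or> vs \<le> cone x e"
      using x(1) tp by (auto simp: vp_def vm_def vs_def cone_def)
    then show ?thesis using x(2) by (auto simp: D_def)
  qed
  \<comment> \<open>Since \<open>D\<close> is below \<open>bg\<close>, a class that attains it is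
    not empty, so the search for its first hit succeeds.\<close>
  have hit: "snd (split_first (\<lambda>x. f x \<le> D) xs) \<noteq> []" if "min_list_val bg f xs = D" for f xs
  proof -
    have "xs \<noteq> []" using that \<open>D < bg\<close> by (auto simp: min_list_val_def)
    then have "Min (f ` set xs) \<in> f ` set xs" "Min (f ` set xs) = D" using that by (auto simp: min_list_val_def intro!: Min_in)
    then show ?thesis by (auto simp: split_first_def)
  qed
  define bdd where "bdd x \<longleftrightarrow> \<bar>x\<bar> \<le> K + E" for x
  have S1: "wpc cSPLO [VI 0, VI e, enc_treeo t] Q'"
    if "\<And>x y n. n \<le> 200000 * Suc h \<Longrightarrow> good_treeo K x \<Longrightarrow> good_treeo K y \<Longrightarrow> lo x = p \<Longrightarrow> lo y = r \<Longrightarrow> Q' (VP (enc_treeo x) (enc_treeo y)) n" for Q'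
    by (rule wpc_SPLO[OF t W'(1) _ len(3) _ so(1)]) (use len split_pred in \<open>auto simp: split_pred_simps intro!: that\<close>)
  have S2: "wpc cSPLO [VI 1, VI e, enc_treeo z] Q'" if "good_treeo K z" "lo z = r"
    "\<And>x y n. n \<le> 200000 * Suc h \<Longrightarrow> good_treeo K x \<Longrightarrow> good_treeo K y \<Longrightarrow> lo x = m \<Longrightarrow> lo y = s \<Longrightarrow> Q' (VP (enc_treeo x) (enc_treeo y)) n" for Q' z
    by (rule wpc_SPLO[OF that(1) W'(1) _ len(3)]) (use len ms so(2) that tp in \<open>auto simp: split_pred_simps intro!: that\<close>)
  have M1: "wpc cMV [enc_treeo z, VI 2, VI e, VI bg] Q'" if "good_treeo K z" "lo z = p" "\<And>n. n \<le> 2000 \<Longrightarrow> bdd vp \<Longrightarrow> Q' (VI vp) n" for z Q'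
    by (rule wpc_MV[OF that(1) W'(3)]) (use that(2,3) K mv in \<open>simp_all del: max_less_iff_conj add: bdd_def max_def split: if_splits\<close>)
  have M2: "wpc cMV [enc_treeo z, VI 0, VI 0, VI bg] Q'" if "good_treeo K z" "lo z = m" "\<And>n. n \<le> 2000 \<Longrightarrow> bdd vm \<Longrightarrow> Q' (VI vm) n" for z Q'
    by (rule wpc_MV[OF that(1) W'(5)]) (use that(2,3) K mv in \<open>simp_all del: max_less_iff_conj add: bdd_def max_def split: if_splits\<close>)
  have M3: "wpc cMV [enc_treeo z, VI 1, VI (- e), VI bg] Q'" if "good_treeo K z" "lo z = s" "\<And>n. n \<le> 2000 \<Longrightarrow> bdd vs \<Longrightarrow> Q' (VI vs) n" for z Q'
    by (rule wpc_MV[OF that(1) W'(4)]) (use that(2,3) K mv in \<open>simp_all del: max_less_iff_conj add: bdd_def max_def split: if_splits\<close>)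
  have MM: "wpc cMIN [VI vp, VI (min vm vs)] Q'" if "\<And>n. n \<le> 100 \<Longrightarrow> Q' (VI D) n" for Q'
    by (rule wpc_MIN) (use that D_def in simp)
  have M4: "wpc cMIN [VI vm, VI vs] Q'" if "\<And>n. n \<le> 100 \<Longrightarrow> Q' (VI (min vm vs)) n" for Q'
    by (rule wpc_MIN) (rule that)
  note cut_eq = cut_list_def[of bg e "lo t", unfolded split_pred prod.case ms vp_def[symmetric] vm_def[symmetric]
      vs_def[symmetric] D_def[symmetric] Let_def]
  have C1: "wpc cCUT1 [VI e, VI D, enc_treeo x, enc_treeo y, enc_treeo z] Q'" if "vp = D" "good_treeo K x" "good_treeo K y" "good_treeo K z" "lo x = p" "lo y = m" "lo z = s"
    "bdd D" "\<And>l r n. n \<le> 400000 * Suc h \<Longrightarrow> good_treeo J l \<Longrightarrow> good_treeo J r \<Longrightarrow> lo l = fst (cut_list bg e (lo t)) \<Longrightarrow> lo r = snd (cut_list bg e (lo t)) \<Longrightarrow> Q' (VP (enc_treeo l) (enc_treeo r)) n" for x y z Q'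
  proof -
    obtain P1 P2 where b: "split_first (\<lambda>x. bb x \<le> D - e) p = (P1, P2)" by force
    have "(\<lambda>x. bb x \<le> D - e) = (\<lambda>x. bb x + e \<le> D)" by auto
    then have "P2 \<noteq> []" using hit[of "\<lambda>x. bb x + e" p] that(1) b by (simp add: vp_def)
    then show ?thesis
      by (intro wpc_CUT1[OF that(2-4) K(1-3) that(8)[unfolded bdd_def] K(5) _ len(2,3), of P1 P2]) (use that b cut_eq l1 in auto)
  qed
  have C2: "wpc cCUT2 [VI e, VI D, enc_treeo x, enc_treeo y, enc_treeo z] Q'" if "vm = D" "vp \<noteq> D" "good_treeo K x" "good_treeo K y" "good_treeo K z" "lo x = p" "lo y = m" "lo z = s"
    "bdd D" "\<And>l r n. n \<le> 400000 * Suc h \<Longrightarrow> good_treeo J l \<Longrightarrow> good_treeo J r \<Longrightarrow> lo l = fst (cut_list bg e (lo t)) \<Longrightarrow> lo r = snd (cut_list bg e (lo t)) \<Longrightarrow> Q' (VP (enc_treeo l) (enc_treeo r)) n" for x y z Q'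
  proof -
    obtain P1 P2 where b: "split_first (\<lambda>x. vv x \<le> D) m = (P1, P2)" by force
    then have "P2 \<noteq> []" using hit[of vv m] that(1) by (simp add: vm_def)
    then show ?thesis
      by (intro wpc_CUT2[OF that(3-5) K(1-3) that(9)[unfolded bdd_def] K(5) _ len(2,3), of P1 P2]) (use that b cut_eq l1 in auto)
  qed
  have C3: "wpc cCUT3 [VI e, VI D, enc_treeo x, enc_treeo y, enc_treeo z] Q'" if "vm \<noteq> D" "vp \<noteq> D" "good_treeo K x" "good_treeo K y" "good_treeo K z" "lo x = p" "lo y = m" "lo z = s"
    "bdd D" "\<And>l r n. n \<le> 400000 * Suc h \<Longrightarrow> good_treeo J l \<Longrightarrow> good_treeo J r \<Longrightarrow> lo l = fst (cut_list bg e (lo t)) \<Longrightarrow> lo r = snd (cut_list bg e (lo t)) \<Longrightarrow> Q' (VP (enc_treeo l) (enc_treeo r)) n" for x y z Q'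
  proof -
    obtain P1 P2 where b: "split_first (\<lambda>x. aa x \<le> D + e) s = (P1, P2)" by force
    then show ?thesis
      by (intro wpc_CUT3[OF that(3-5) K(1-3) that(9)[unfolded bdd_def] K(5) _ len(2,3), of P1 P2]) (use that b cut_eq l1 in auto)
  qed
  have Db: "bdd D" if "bdd vp" "bdd vm" "bdd vs" using that by (auto simp: D_def min_def)
  show ?thesis
    by (rule wpcI) (use W2 Db in \<open>auto simp: bCUT_def W'(2) simp del: enc_treeo.simps intro!: wp_intros S1 S2 M1 M2 M3 MM M4 C1 C2 C3 Q\<close>)
qed

text \<open>Of the growth by \<open>3 * E\<close>, one \<open>E\<close> is due to the map that
  crosses the block and \<open>2 * E\<close> to the cut that follows.\<close>

lemma wpc_BLK:
  assumes t: "good_tree K l" "good_tree K t"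
    and cut: "a = b \<Longrightarrow> cuttable bg (c + w - h) (leaves l @ leaves t)"
      "a \<noteq> b \<Longrightarrow> cuttable bg (c + w - h) (map (comp_map (left_to_bottom (c - h))) (leaves l) @ map (comp_map (top_to_bottom h)) (leaves t))"
      "a \<noteq> b \<Longrightarrow> cuttable bg (c + w - h) (map (comp_map (left_to_right w)) (leaves l) @ map (comp_map (top_to_right (c + w))) (leaves t))"
    and K: "K + 3 * E \<le> J" "2 * J \<le> W" "\<bar>h\<bar> \<le> E" "\<bar>w\<bar> \<le> E" "\<bar>c - h\<bar> \<le> E" "\<bar>c + w\<bar> \<le> E" "\<bar>c + w - h\<bar> \<le> E" "\<bar>bg\<bar> \<le> E" "0 \<le> K"
    and len: "length (leaves l) + length (leaves t) + 1 < N" "N \<le> 2 ^ Suc hb" "int hb + 1 \<le> W"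
    and Q: "\<And>x y n. n \<le> 3000000 * Suc hb \<Longrightarrow> good_treeo J x \<Longrightarrow> good_treeo J y \<Longrightarrow> lo x = blk_bottom bg (a = b) h w c (leaves l) (leaves t) \<Longrightarrow>
      lo y = blk_right bg (a = b) h w c (leaves l) (leaves t) \<Longrightarrow> Q (VP (enc_treeo x) (enc_treeo y)) n"
  shows "wpc cBLK [VI bg, VI a, VI b, VI h, VI w, VI c, enc_tree l, enc_tree t] Q"
proof -
  have E0: "0 \<le> E" using K by linarith
  have W': "\<bar>w - h\<bar> \<le> W" "\<bar>c + (w - h)\<bar> \<le> W" "\<bar>c - h\<bar> \<le> W" "\<bar>c + w\<bar> \<le> W" "\<bar>h - c\<bar> \<le> W" "E + K \<le> W" "K \<le> W" "K + E \<le> W" "\<bar>- (c - h)\<bar> \<le> W"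
  proof -
    have b: "- E \<le> h" "h \<le> E" "- E \<le> w" "w \<le> E" "- E \<le> c - h" "c - h \<le> E" "- E \<le> c + w" "c + w \<le> E" "- E \<le> c + w - h" "c + w - h \<le> E"
      using K(3-7) by (auto simp: abs_le_iff)
    have c: "6 * E + 2 * K \<le> W" using K(1,2) by linarith
    show "\<bar>w - h\<bar> \<le> W" "\<bar>c + (w - h)\<bar> \<le> W" "\<bar>c - h\<bar> \<le> W" "\<bar>c + w\<bar> \<le> W" "\<bar>h - c\<bar> \<le> W" "\<bar>- (c - h)\<bar> \<le> W"
      unfolding abs_le_iff using b c E0 K(9) by (simp_all; linarith)+
    show "E + K \<le> W" "K \<le> W" "K + E \<le> W" using c E0 K(9) by linarith+
  qed
  have e: "c + (w - h) = c + w - h" by simp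
  have tb: "tree_bound K l" "tree_bound K t" using t by (simp_all add: good_tree_def)
  have bX: "trip_bound E (top_to_bottom h)" "trip_bound E (top_to_right (c + w))" "trip_bound E (left_to_right w)" "trip_bound E (left_to_bottom (c - h))"
    using K E0 by (auto simp: trip_bound_def top_to_bottom_def top_to_right_def left_to_right_def left_to_bottom_def)
  have mX: "Trip (1, - (c - h)) (1, 0) (0, - (c - h)) = left_to_bottom (c - h)" "Trip (0, h) (1, 0) (2, h) = top_to_bottom h"
    "Trip (0, w) (1, w) (2, 0) = left_to_right w" "Trip (2, c + w) (0, c + w) (2, 0) = top_to_right (c + w)"
    by (simp_all add: top_to_bottom_def top_to_right_def left_to_right_def left_to_bottom_def)
  have mX4': "Trip (1, h - c) (1, 0) (0, h - c) = left_to_bottom (c - h)" by (simp add: left_to_bottom_def)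
  have A: "wpc cAPP [enc_trip \<mu>, enc_tree x] Q'" if "trip_bound E \<mu>" "tree_bound K x" "\<And>n. n \<le> 800 \<Longrightarrow> Q' (enc_tree (apply_map \<mu> x)) n" for \<mu> x Q'
    by (rule wpc_APP[OF that(1,2) W'(6)]) (rule that(3))
  have J: "wpc cJOIN [enc_tree x, enc_tree y] Q'" if "good_treeo (E + K) (Some x)" "good_treeo (E + K) (Some y)" "length (leaves x @ leaves y) < N"
    "\<And>z n. n \<le> 20000 * Suc hb \<Longrightarrow> good_treeo (E + K) z \<Longrightarrow> lo z = leaves x @ leaves y \<Longrightarrow> Q' (enc_treeo z) n" for x y Q'
    using wpc_JU[OF that(1,2) W'(6) _ len(2,3), of Q'] that(3,4) by simp
  have tX: "good_treeo (E + K) (Some (apply_map \<mu> x))" if "trip_bound E \<mu>" "good_tree K x" for \<mu> x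
    using that tree_bound_apply_map by (auto simp: good_tree_def)
  have tl: "good_treeo (E + K) (Some l)" "good_treeo (E + K) (Some t)" using t E0 good_treeo_mono[of K "Some l" "E + K"] good_treeo_mono[of K "Some t" "E + K"] by auto
  have C: "wpc cCUT [VI bg, VI (c + w - h), enc_treeo z] Q'" if "good_treeo (E + K) z" "cuttable bg (c + w - h) (lo z)" "length (lo z) + 1 < N"
    "\<And>x y n. n \<le> 1000000 * Suc hb \<Longrightarrow> good_treeo J x \<Longrightarrow> good_treeo J y \<Longrightarrow> lo x = fst (cut_list bg (c + w - h) (lo z)) \<Longrightarrow>
      lo y = snd (cut_list bg (c + w - h) (lo z)) \<Longrightarrow> Q' (VP (enc_treeo x) (enc_treeo y)) n" for z Q'
    by (rule wpc_CUT[OF that(1,2) _ K(2,7,8) _ that(3) len(2,3)]) (use K E0 in \<open>auto intro: that(4)\<close>)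
  show ?thesis
  proof (cases "a = b")
    case True
    have Qa: "Q (VP (enc_treeo x) (enc_treeo y)) n" if "n \<le> 3000000 * Suc hb" "good_treeo J x" "good_treeo J y" "lo x = fst (cut_list bg (c + w - h) (leaves l @ leaves t))"
      "lo y = snd (cut_list bg (c + w - h) (leaves l @ leaves t))" for x y n
      by (rule Q) (use that True in \<open>auto simp: blk_bottom_def blk_right_def\<close>)
    show ?thesis
      by (rule wpcI) (use W2 True cut(1) len(1) tl in \<open>auto simp: bBLK_def W' W'(2)[unfolded e] e simp del: enc_treeo.simps intro!: wp_intros J C Qa\<close>)
  next
    case False
    have Qa: "Q (VP (enc_treeo x) (enc_treeo y)) n" if "n \<le> 3000000 * Suc hb" "good_treeo J x" "good_treeo J y"
      "lo x = fst (cut_list bg (c + w - h) (map (comp_map (left_to_bottom (c - h))) (leaves l) @ map (comp_map (top_to_bottom h)) (leaves t)))"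
      "lo y = snd (cut_list bg (c + w - h) (map (comp_map (left_to_right w)) (leaves l) @ map (comp_map (top_to_right (c + w))) (leaves t)))" for x y n
      by (rule Q) (use that False in \<open>auto simp: blk_bottom_def blk_right_def\<close>)
    show ?thesis
      by (rule wpcI) (use W2 False cut(2,3) len(1) t tb bX tX in \<open>auto simp: bBLK_def W' W'(2)[unfolded e] e eM_enc_trip mX mX4' simp del: enc_treeo.simps good_treeo.simps intro!: wp_intros A J C Qa\<close>)
  qed
qed

end

section \<open>Processing the table\<close>

lemma ed_le_sum: "ed xs ys \<le> length xs + length ys"
  by (induction xs ys rule: ed.induct) auto

lemma Lipschitz_from_steps:
  fixes F :: "int \<Rightarrow> int"
  assumes step: "\<And>d. a \<le> d \<Longrightarrow> d < b \<Longrightarrow> \<bar>F (d + 1) - F d\<bar> \<le> 1"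
    and "a \<le> d" "d \<le> d'" "d' \<le> b"
  shows "\<bar>F d' - F d\<bar> \<le> d' - d"
  using assms(3,4)
proof (induction d' rule: int_ge_induct)
  case (step i)
  then show ?case using assms(1)[of i] assms(2) by linarith
qed simp

lemma represents_cong:
  assumes "represents a b p q xs F" "\<And>d. p \<le> d \<Longrightarrow> d \<le> q \<Longrightarrow> F d = F' d"
  shows "represents a b p q xs F'"
  using assms unfolding represents_def by simp

lemma represents_sub: "represents a b p q xs F \<Longrightarrow> p \<le> p' \<Longrightarrow> q' \<le> q \<Longrightarrow> represents a b p' q' xs F"
  unfolding represents_def by (meson order_trans)

lemma represents_cuttable:
  assumes "represents a b p q xs F" "p \<le> e" "e \<le> q" "F e < bg"
  shows "cuttable bg e xs"
  using assms unfolding represents_def cuttable_def by metis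

text \<open>Entry \<open>G i j\<close> lies on diagonal \<open>c + j - i\<close>. Both kinds of
  blocks are reduced to one situation: lists \<open>U\<close> and \<open>V\<close> for the bottom
  and the right side that have equal values at the corner diagonal \<open>e\<close>, where both are
  then cut.\<close>

lemma block_step:
  fixes X Y :: "'a list" and a b :: 'a
  defines "G \<equiv> \<lambda>i j. int (ed (replicate i a @ X) (replicate j b @ Y))"
  assumes c: "c = int (length Y) - int (length X)"
    and L: "represents (c - int h) c (c - int h) c Ls (\<lambda>d. G (nat (c - d)) 0)"
    and T: "represents c (c + int w) c (c + int w) Ts (\<lambda>d. G 0 (nat (d - c)))"
    and bg: "int (length X + length Y + h + w) < bg"
  defines "e \<equiv> c + int w - int h"
  shows "a = b \<Longrightarrow> cuttable bg e (Ls @ Ts)"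
    and "a \<noteq> b \<Longrightarrow> cuttable bg e (map (comp_map (left_to_bottom (c - int h))) Ls @ map (comp_map (top_to_bottom (int h))) Ts)"
    and "a \<noteq> b \<Longrightarrow> cuttable bg e (map (comp_map (left_to_right (int w))) Ls @ map (comp_map (top_to_right (c + int w))) Ts)"
    and "represents (c - int h) e (c - int h) e
      (blk_bottom bg (a = b) (int h) (int w) c Ls Ts) (\<lambda>d. G h (nat (d - (c - int h))))"
    and "represents e (c + int w) e (c + int w)
      (blk_right bg (a = b) (int h) (int w) c Ls Ts) (\<lambda>d. G (nat (c + int w - d)) w)"
    and "length (blk_bottom bg (a = b) (int h) (int w) c Ls Ts) +
      length (blk_right bg (a = b) (int h) (int w) c Ls Ts) \<le> length Ls + length Ts + 1"
proof -
  have s1: "\<bar>G (Suc i) j - G i j\<bar> \<le> 1" for i j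
    using ed_Cons_Lipschitz[of a "replicate i a @ X" "replicate j b @ Y"]
    unfolding G_def replicate_Suc append_Cons by linarith
  have s2: "\<bar>G i (Suc j) - G i j\<bar> \<le> 1" for i j
    using ed_Cons2_Lipschitz(1)[of "replicate i a @ X" b "replicate j b @ Y"]
      ed_Cons2_Lipschitz(2)[of "replicate i a @ X" "replicate j b @ Y" b]
    unfolding G_def replicate_Suc append_Cons by linarith
  have lipL: "G i 0 \<le> G 0 0 + int i" for i
  proof (induction i)
    case (Suc i) then show ?case using s1[of i 0] by linarith
  qed simp
  have lipT: "G 0 j \<le> G 0 0 + int j" for j
  proof (induction j)
    case (Suc j) then show ?case using s2[of 0 j] by linarith
  qed simp
  define FB where "FB d = G h (nat (d - (c - int h)))" for d
  define FR where "FR d = G (nat (c + int w - d)) w" for d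
  have lB: "\<bar>FB d' - FB d\<bar> \<le> d' - d" if "c - int h \<le> d" "d \<le> d'" "d' \<le> e" for d d'
  proof (rule Lipschitz_from_steps[where a = "c - int h" and b = e])
    fix d assume "c - int h \<le> d" "d < e"
    then have "nat (d + 1 - (c - int h)) = Suc (nat (d - (c - int h)))" by simp
    then show "\<bar>FB (d + 1) - FB d\<bar> \<le> 1" unfolding FB_def using s2 by simp
  qed (use that in auto)
  have lR: "\<bar>FR d' - FR d\<bar> \<le> d' - d" if "e \<le> d" "d \<le> d'" "d' \<le> c + int w" for d d'
  proof (rule Lipschitz_from_steps[where a = e and b = "c + int w"])
    fix d assume "e \<le> d" "d < c + int w"
    then have "nat (c + int w - d) = Suc (nat (c + int w - (d + 1)))" by simp
    then show "\<bar>FR (d + 1) - FR d\<bar> \<le> 1" unfolding FR_def using s1 by (simp add: abs_minus_commute)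
  qed (use that in auto)
  have lB': "FB d \<le> FB e + (e - d)" if "c - int h \<le> d" "d \<le> e" for d using lB[of d e] that by linarith
  have lR': "FR d \<le> FR e + (d - e)" if "e \<le> d" "d \<le> c + int w" for d using lR[of e d] that by linarith
  have FBe: "FB e = G h w" and FRe: "FR e = G h w" by (simp_all add: FB_def FR_def e_def)
  have ebg: "G h w < bg" using ed_le_sum[of "replicate h a @ X" "replicate w b @ Y"] bg by (simp add: G_def)
  have e: "c - int h \<le> e" "e \<le> c + int w" by (simp_all add: e_def)
  define U where "U = (if a = b then Ls @ Ts else map (comp_map (left_to_bottom (c - int h))) Ls @ map (comp_map (top_to_bottom (int h))) Ts)"
  define V where "V = (if a = b then Ls @ Ts else map (comp_map (left_to_right (int w))) Ls @ map (comp_map (top_to_right (c + int w))) Ts)"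
  have UV: "represents (c - int h) (c + int w) (c - int h) e U FB \<and> represents (c - int h) (c + int w) e (c + int w) V FR"
  proof (cases "a = b")
    case True
    have diag: "G (Suc i) (Suc j) = G i j" for i j using True by (simp add: G_def)
    \<comment> \<open>With equal symbols the table depends only on the diagonal, so the left and top
      sides together describe a single function of \<open>d\<close>, which also gives the outgoing
      sides.\<close>
    define F where "F d = (if d \<le> c then G (nat (c - d)) 0 else G 0 (nat (d - c)))" for d
    have GF: "G i j = F (c + int j - int i)" for i j
    proof (induction i arbitrary: j)
      case 0 show ?case by (simp add: F_def)
    next
      case (Suc i)
      show ?case
      proof (cases j)
        case (Suc j')
        then show ?thesis using diag[of i j'] Suc.IH[of j'] by (simp add: algebra_simps)
      qed (simp add: F_def, metis nat_int of_nat_Suc)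
    qed
    have lF: "\<bar>F d' - F d\<bar> \<le> d' - d" if "c - int h \<le> d" "d \<le> d'" "d' \<le> c + int w" for d d'
    proof (rule Lipschitz_from_steps[where a = "c - int h" and b = "c + int w"])
      fix d
      show "\<bar>F (d + 1) - F d\<bar> \<le> 1"
      proof (cases "d < c")
        case True
        then have "nat (c - d) = Suc (nat (c - (d + 1)))" by simp
        then show ?thesis unfolding F_def using s1 True by (simp add: abs_minus_commute)
      next
        case False
        then have "nat (d + 1 - c) = Suc (nat (d - c))" by simp
        then show ?thesis unfolding F_def using s2[of 0 "nat (d - c)"] False by auto
      qed
    qed (use that in auto)
    have "represents (c - int h) (c + int w) (c - int h) (c + int w) (Ls @ Ts) F"
    proof (rule match_concat)
      show "represents (c - int h) c (c - int h) c Ls F" by (rule represents_cong[OF L]) (simp add: F_def)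
      show "represents c (c + int w) c (c + int w) Ts F" by (rule represents_cong[OF T]) (auto simp: F_def)
      show "F d \<le> F d' + \<bar>d - d'\<bar>" if "c - int h \<le> d" "d \<le> c + int w" "c - int h \<le> d'" "d' \<le> c + int w" for d d'
        using lF[of d d'] lF[of d' d] that by (cases "d \<le> d'") auto
    qed auto
    then have r: "represents (c - int h) (c + int w) (c - int h) (c + int w) U F" "U = V" using True by (simp_all add: U_def V_def)
    have "represents (c - int h) (c + int w) (c - int h) e U FB"
      by (rule represents_cong[OF represents_sub[OF r(1)]]) (use e in \<open>auto simp: FB_def GF\<close>)
    moreover have "represents (c - int h) (c + int w) e (c + int w) U FR"
      by (rule represents_cong[OF represents_sub[OF r(1)]]) (use e in \<open>auto simp: FR_def GF\<close>)
    ultimately show ?thesis using r(2) by simp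
  next
    case False
    have step: "G (Suc i) (Suc j) = 1 + min (G i j) (min (G i (Suc j)) (G (Suc i) j))" for i j
      using False by (simp add: G_def)
    have "represents (c - int h) (c + int w) (c - int h) e U FB"
      using mismatch_bottom[OF step lipL lipT L T] False by (simp add: U_def e_def FB_def[abs_def] algebra_simps)
    moreover have "represents (c - int h) (c + int w) e (c + int w) V FR"
      using mismatch_right[OF step lipL lipT L T] False by (simp add: V_def e_def FR_def[abs_def])
    ultimately show ?thesis ..
  qed
  then have rU: "represents (c - int h) (c + int w) (c - int h) e U FB" and rV: "represents (c - int h) (c + int w) e (c + int w) V FR"
    by auto
  have cU: "cuttable bg e U" and cV: "cuttable bg e V"
    using represents_cuttable[OF rU] represents_cuttable[OF rV] e ebg FBe FRe by auto
  show "a = b \<Longrightarrow> cuttable bg e (Ls @ Ts)" using cU by (simp add: U_def)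
  show "a \<noteq> b \<Longrightarrow> cuttable bg e (map (comp_map (left_to_bottom (c - int h))) Ls @ map (comp_map (top_to_bottom (int h))) Ts)" using cU by (simp add: U_def)
  show "a \<noteq> b \<Longrightarrow> cuttable bg e (map (comp_map (left_to_right (int w))) Ls @ map (comp_map (top_to_right (c + int w))) Ts)" using cV by (simp add: V_def)
  have bt: "blk_bottom bg (a = b) (int h) (int w) c Ls Ts = fst (cut_list bg e U)"
    and rt: "blk_right bg (a = b) (int h) (int w) c Ls Ts = snd (cut_list bg e V)"
    by (simp_all add: blk_bottom_def blk_right_def U_def V_def e_def)
  show "represents (c - int h) e (c - int h) e (blk_bottom bg (a = b) (int h) (int w) c Ls Ts) (\<lambda>d. G h (nat (d - (c - int h))))"
    unfolding bt FB_def[symmetric]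
    by (rule cut_list_left[OF rU]) (use e ebg FBe lB' in \<open>auto simp: algebra_simps\<close>)
  show "represents e (c + int w) e (c + int w) (blk_right bg (a = b) (int h) (int w) c Ls Ts) (\<lambda>d. G (nat (c + int w - d)) w)"
    unfolding rt FR_def[symmetric]
    by (rule cut_list_right[OF rV]) (use e ebg FRe lR' in \<open>auto simp: algebra_simps\<close>)
  have L1: "c - int h \<le> lft x" "lft x \<le> rgt x" "rgt x \<le> c" if "x \<in> set Ls" for x using L that by (auto simp: represents_def)
  have T1: "c \<le> lft x" "lft x \<le> rgt x" "rgt x \<le> c + int w" if "x \<in> set Ts" for x using T that by (auto simp: represents_def)
  \<comment> \<open>The corner belongs to both outgoing sides, so the two images of a cone agree
    there: both give the value of its continuation at the corner.\<close>
  have "cone (comp_map (left_to_bottom (c - int h)) x) e = cone (comp_map (left_to_right (int w)) x) e" if "x \<in> set Ls" for x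
    using L1[OF that] unfolding cone_def comp_map_comps e_def lft_def rgt_def by (simp add: max_def)
  moreover have "cone (comp_map (top_to_bottom (int h)) x) e = cone (comp_map (top_to_right (c + int w)) x) e" if "x \<in> set Ts" for x
    using T1[OF that] unfolding cone_def comp_map_comps e_def lft_def rgt_def by (simp add: max_def)
  ultimately have eq: "map (\<lambda>x. cone x e) U = map (\<lambda>x. cone x e) V" by (simp add: U_def V_def)
  have lenUV: "length U = length Ls + length Ts" "length V = length Ls + length Ts" by (simp_all add: U_def V_def)
  \<comment> \<open>By \<open>eq\<close> this is the position of the first minimiser in
    \<open>V\<close> as well, so it serves both cuts.\<close>
  define k where "k = length (takeWhile (\<lambda>y. y \<noteq> G h w) (map (\<lambda>x. cone x e) U))"
  obtain x where "x \<in> set U" "cone x e = G h w" "\<forall>x \<in> set U. G h w \<le> cone x e" "\<forall>x \<in> set U. lft x \<le> rgt x" "sorted (map lft U)" "sorted (map rgt U)"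
    using rU e FBe unfolding represents_def by (metis order_refl)
  then have "length (fst (cut_list bg e U)) \<le> k + 1" unfolding k_def using ebg by (intro cut_list_length(1)) auto
  moreover obtain x where "x \<in> set V" "cone x e = G h w" "\<forall>x \<in> set V. G h w \<le> cone x e" "\<forall>x \<in> set V. lft x \<le> rgt x" "sorted (map lft V)" "sorted (map rgt V)"
    using rV e FRe unfolding represents_def by (metis order_refl)
  then have "length (snd (cut_list bg e V)) + k \<le> length V" unfolding k_def eq using ebg by (intro cut_list_length(2)) auto
  ultimately show "length (blk_bottom bg (a = b) (int h) (int w) c Ls Ts) +
      length (blk_right bg (a = b) (int h) (int w) c Ls Ts) \<le> length Ls + length Ts + 1"
    unfolding bt rt using lenUV by simp
qed

section \<open>Rows and columns of blocks\<close>

type_synonym col = "int \<times> nat \<times> tree"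

fun enc_cols :: "col list \<Rightarrow> val" where
  "enc_cols [] = VI 0"
| "enc_cols ((b, w, t) # cs) = VP (VP (VI b) (VP (VI (int w)) (enc_tree t))) (enc_cols cs)"

fun enc_runs :: "(int \<times> nat) list \<Rightarrow> val" where
  "enc_runs [] = VI 0"
| "enc_runs ((a, h) # rs) = VP (VP (VI a) (VI (int h))) (enc_runs rs)"

lemma enc_cols_0 [simp]: "enc_cols cs = VI 0 \<longleftrightarrow> cs = []" by (cases cs) auto

text \<open>Runs are put in front one after the other, so the last run of the list becomes the
  outermost. The table grows by prefixing, because \<open>ed\<close> recurses on suffixes.\<close>

fun expand :: "int list \<Rightarrow> (int \<times> nat) list \<Rightarrow> int list" where
  "expand X [] = X"
| "expand X ((a, h) # rs) = expand (replicate h a @ X) rs"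

lemma length_expand: "length (expand X rs) = length X + sum_list (map snd rs)"
  by (induction X rs rule: expand.induct) auto

definition col_runs :: "col list \<Rightarrow> (int \<times> nat) list" where
  "col_runs cs = map (\<lambda>(b, w, t). (b, w)) cs"

definition col_leaves :: "col list \<Rightarrow> nat" where
  "col_leaves cs = sum_list (map (\<lambda>(b, w, t). length (leaves t)) cs)"

definition col_trees :: "int \<Rightarrow> col list \<Rightarrow> bool" where
  "col_trees K cs \<longleftrightarrow> (\<forall>(b, w, t) \<in> set cs. good_tree K t)"

lemma cols_simps [simp]:
  "col_runs [] = []" "col_runs ((b, w, t) # cs) = (b, w) # col_runs cs"
  "col_leaves [] = 0" "col_leaves ((b, w, t) # cs) = length (leaves t) + col_leaves cs"
  "col_trees K []" "col_trees K ((b, w, t) # cs) \<longleftrightarrow> good_tree K t \<and> col_trees K cs"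
  by (simp_all add: col_runs_def col_leaves_def col_trees_def)

text \<open>The top sides of the blocks below the rows \<open>X\<close>, right of the columns \<open>Y\<close>.\<close>

fun columns_ok :: "int list \<Rightarrow> int list \<Rightarrow> col list \<Rightarrow> bool" where
  "columns_ok X Y [] \<longleftrightarrow> True"
| "columns_ok X Y ((b, w, t) # cs) \<longleftrightarrow>
    (let c = int (length Y) - int (length X) in
      represents c (c + int w) c (c + int w) (leaves t) (\<lambda>d. int (ed X (replicate (nat (d - c)) b @ Y)))) \<and>
    columns_ok X (replicate w b @ Y) cs"

lemma good_tree_mono: "good_tree K t \<Longrightarrow> K \<le> K' \<Longrightarrow> good_tree K' t"
  by (auto simp: good_tree_def intro: tree_bound_mono)

lemma col_trees_mono: "col_trees K cs \<Longrightarrow> K \<le> K' \<Longrightarrow> col_trees K' cs"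
  by (auto simp: col_trees_def intro: good_tree_mono)

context prog
begin

text \<open>Each block adds at most one cone and \<open>3 * E\<close> to the size of the numbers,
  which explains the terms with \<open>length cs\<close>. The right side of a block becomes the left
  side of the next one; after the last block it is dropped.\<close>

lemma wpc_ROWF:
  assumes "columns_ok X Y cs" "good_tree K l" "col_trees K cs" "c = int (length Y) - int (length X)"
    "represents (c - int h) c (c - int h) c (leaves l) (\<lambda>d. int (ed (replicate (nat (c - d)) a @ X) Y))"
    "int (length X + length (expand Y (col_runs cs)) + h) < bg" "bg \<le> E" "K + 3 * E * int (length cs) \<le> J" "2 * J \<le> W" "0 \<le> K"
    "length (leaves l) + col_leaves cs + length cs < N" "N \<le> 2 ^ Suc hb" "int hb + 1 \<le> W"
    and Q: "\<And>cs' n. n \<le> 4000000 * Suc hb * Suc (length cs) \<Longrightarrow> columns_ok (replicate h a @ X) Y cs' \<Longrightarrow> col_trees J cs' \<Longrightarrow>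
      col_runs cs' = col_runs cs \<Longrightarrow> col_leaves cs' \<le> length (leaves l) + col_leaves cs + length cs \<Longrightarrow> Q (enc_cols cs') n"
  shows "wpc cROWF [VI bg, VI a, VI (int h), VI c, enc_tree l, enc_cols cs] Q"
  using assms
proof (induction cs arbitrary: Y K l c Q)
  case Nil
  have Qa: "Q (VI 0) n" if "n \<le> 1000" for n
    by (rule Nil.prems(14)[of n "[]", unfolded enc_cols.simps]) (use that in auto)
  show ?case by (rule wpcI) (use W2 in \<open>auto simp: bROWF_def intro!: wp_intros Qa\<close>)
next
  case (Cons col cs)
  obtain b w t where col: "col = (b, w, t)" by (cases col)
  note P = Cons.prems[unfolded col]
  have E0: "0 \<le> E" using P(6,7) by linarith
  have t: "good_tree K t" "col_trees K cs" using P(3) by auto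
  have KJ: "K + 3 * E \<le> J" "K + 3 * E + 3 * E * int (length cs) \<le> J"
  proof -
    have "3 * E * int (length ((b, w, t) # cs)) = 3 * E + 3 * E * int (length cs)" by (simp add: algebra_simps)
    moreover have "0 \<le> 3 * E * int (length cs)" using E0 by simp
    ultimately show "K + 3 * E \<le> J" "K + 3 * E + 3 * E * int (length cs) \<le> J" using P(8) by linarith+
  qed
  have T: "represents c (c + int w) c (c + int w) (leaves t) (\<lambda>d. int (ed (replicate 0 a @ X) (replicate (nat (d - c)) b @ Y)))"
    using P(1,4) by (simp add: Let_def)
  have L: "represents (c - int h) c (c - int h) c (leaves l) (\<lambda>d. int (ed (replicate (nat (c - d)) a @ X) (replicate 0 b @ Y)))"
    using P(5) by simp
  have lenE: "length Y + w \<le> length (expand Y (col_runs ((b, w, t) # cs)))" by (simp add: length_expand)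
  have bg: "int (length X + length Y + h + w) < bg" using P(6) lenE by linarith
  note blk = block_step[OF P(4) L T bg]
  let ?K = "K + 3 * E"
  have K2: "2 * ?K \<le> W" using order_trans[OF mult_left_mono[OF KJ(1), of 2] P(9)] by simp
  have bs: "\<bar>int h\<bar> \<le> E" "\<bar>int w\<bar> \<le> E" "\<bar>c - int h\<bar> \<le> E" "\<bar>c + int w\<bar> \<le> E" "\<bar>c + int w - int h\<bar> \<le> E" "\<bar>bg\<bar> \<le> E"
    using bg P(4,7) by auto
  have W': "\<bar>c + int w\<bar> \<le> W"
    by (rule order_trans[OF bs(4)], rule order_trans[OF _ K2]) (use E0 P(10) in auto)
  have lenB: "length (leaves l) + length (leaves t) + 1 < N" using P(11) by simp
  define BB RR where BR: "BB = blk_bottom bg (a = b) (int h) (int w) c (leaves l) (leaves t)"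
    "RR = blk_right bg (a = b) (int h) (int w) c (leaves l) (leaves t)"
  note blk = blk[folded BR]
  define A B where AB: "A = 4000000 * Suc hb * Suc (length cs)" "B = 3000000 * Suc hb"
  have AB': "A + B + 1000 \<le> 4000000 * Suc hb * Suc (length ((b, w, t) # cs))" by (simp add: AB)
  have B: "wpc cBLK [VI bg, VI a, VI b, VI (int h), VI (int w), VI c, enc_tree l, enc_tree t] Q'"
    if "\<And>x y n. n \<le> B \<Longrightarrow> good_tree ?K x \<Longrightarrow> good_tree ?K y \<Longrightarrow> leaves x = BB \<Longrightarrow>
      leaves y = RR \<Longrightarrow> Q' (VP (enc_tree x) (enc_tree y)) n" for Q'
  proof (rule wpc_BLK[OF P(2) t(1) blk(1-3) order_refl K2 bs P(10) lenB P(12,13)])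
    fix x y n
    assume asm: "n \<le> 3000000 * Suc hb" "good_treeo ?K x" "good_treeo ?K y" "lo x = blk_bottom bg (a = b) (int h) (int w) c (leaves l) (leaves t)"
      "lo y = blk_right bg (a = b) (int h) (int w) c (leaves l) (leaves t)"
    note 1 = asm[folded BR AB(2)]
    \<comment> \<open>A list that represents a function on a nonempty interval is itself nonempty,
      so the optional trees are present.\<close>
    have "lo x \<noteq> []" unfolding 1(4) using blk(4) by (force simp: represents_def)
    moreover have "lo y \<noteq> []" unfolding 1(5) using blk(5) by (force simp: represents_def)
    ultimately obtain x' y' where "x = Some x'" "y = Some y'" by (cases x; cases y) auto
    then show "Q' (VP (enc_treeo x) (enc_treeo y)) n" using that[of n x' y'] 1 by simp
  qed
  have rec: "wpc cROWF [VI bg, VI a, VI (int h), VI (c + int w), enc_tree y, enc_cols cs] Q'"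
    if y: "good_tree ?K y" "leaves y = RR"
    and Q': "\<And>cs' n. n \<le> A \<Longrightarrow> columns_ok (replicate h a @ X) (replicate w b @ Y) cs' \<Longrightarrow> col_trees J cs' \<Longrightarrow>
      col_runs cs' = col_runs cs \<Longrightarrow> col_leaves cs' + length BB \<le> length (leaves l) + length (leaves t) + col_leaves cs + length cs + 1 \<Longrightarrow> Q' (enc_cols cs') n" for y Q'
  proof (rule Cons.IH[of "replicate w b @ Y" ?K y "c + int w" Q', folded AB(1)])
    show "columns_ok X (replicate w b @ Y) cs" using P(1) by simp
    show "col_trees ?K cs" using t(2) E0 by (auto intro: col_trees_mono)
    show "represents (c + int w - int h) (c + int w) (c + int w - int h) (c + int w) (leaves y)
      (\<lambda>d. int (ed (replicate (nat (c + int w - d)) a @ X) (replicate w b @ Y)))" using blk(5) y(2) by simp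
    show "int (length X + length (expand (replicate w b @ Y) (col_runs cs)) + h) < bg" using P(6) by simp
    show "length (leaves y) + col_leaves cs + length cs < N" using blk(6) P(11) y(2) by simp
    show "Q' (enc_cols cs') n" if "n \<le> A" "columns_ok (replicate h a @ X) (replicate w b @ Y) cs'" "col_trees J cs'"
      "col_runs cs' = col_runs cs" "col_leaves cs' \<le> length (leaves y) + col_leaves cs + length cs" for cs' n
      by (rule Q') (use that blk(6) y(2) in auto)
  qed (use P y KJ E0 in auto)
  have Qa: "Q (VP (VP (VI b) (VP (VI (int w)) (enc_tree x))) (enc_cols cs')) n"
    if "n \<le> A + B + 1000" "good_tree ?K x"
      "leaves x = BB"
      "columns_ok (replicate h a @ X) (replicate w b @ Y) cs'" "col_trees J cs'" "col_runs cs' = col_runs cs"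
      "col_leaves cs' + length BB \<le> length (leaves l) + length (leaves t) + col_leaves cs + length cs + 1" for x cs' n
  proof (rule P(14)[of n "(b, w, x) # cs'", unfolded enc_cols.simps])
    have "int (length Y) - int (length (replicate h a @ X)) = c - int h" using P(4) by simp
    moreover have "c - int h + int w = c + int w - int h" by simp
    ultimately show "columns_ok (replicate h a @ X) Y ((b, w, x) # cs')"
      using blk(4) that(4) by (simp only: columns_ok.simps Let_def that(3) simp_thms)
    show "col_trees J ((b, w, x) # cs')" using that(2,5) KJ by (auto intro: good_tree_mono)
  qed (use that AB' in auto)
  show ?case unfolding col enc_cols.simps
    apply (rule wpcI) using W2 apply simp using W2 apply simp using W2
    by (auto simp: bROWF_def W' intro!: wp_intros B rec Qa)
qed

end

lemma expand_rev: "expand Z (rev rs) = concat (map (\<lambda>(a, i). replicate i a) rs) @ Z"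
proof -
  have "expand Z (xs @ ys) = expand (expand Z xs) ys" for Z xs ys
    by (induction Z xs rule: expand.induct) auto
  then show ?thesis by (induction rs arbitrary: Z) auto
qed

lemma length_col_runs: "length (col_runs cs) = length cs" by (simp add: col_runs_def)

lemma represents_corner:
  assumes "p \<le> e" "e \<le> q" "\<And>d. p \<le> d \<Longrightarrow> d \<le> q \<Longrightarrow> F d = v + \<bar>d - e\<bar>"
  shows "represents p q p q [corner v e] F"
  using assms by (simp add: represents_def cone_corner lft_def rgt_def)

context prog
begin

lemma wpc_CRNt:
  assumes "\<bar>v\<bar> + \<bar>d\<bar> \<le> J" "J \<le> W"
    and Q: "\<And>t n. n \<le> 500 \<Longrightarrow> good_tree J t \<Longrightarrow> leaves t = [corner v d] \<Longrightarrow> Q (enc_tree t) n"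
  shows "wpc cCRN [VI v, VI d] Q"
proof (rule wpc_CRN[OF assms(1,2)])
  fix x n assume "n \<le> (500::nat)" "good_treeo J x" "lo x = [corner v d]"
  then show "Q (enc_treeo x) n" using Q by (cases x) auto
qed

text \<open>On the left edge the table contains the lengths \<open>ed Z []\<close>, which form a
  single corner of height \<open>- c\<close> at diagonal \<open>c\<close>. This cone and at most one
  more per block explain the summand \<open>Suc (length cs)\<close> per row.\<close>

lemma wpc_ROWS:
  assumes "columns_ok X [] cs" "col_trees K cs" "c = - int (length X)"
    "int (length (expand X rs) + length (expand [] (col_runs cs))) < bg" "bg \<le> E"
    "K + 3 * E * int (length cs) * int (length rs) \<le> J" "2 * J \<le> W" "2 * E \<le> K"
    "col_leaves cs + length rs * Suc (length cs) < N" "N \<le> 2 ^ Suc hb" "int hb + 1 \<le> W"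
    and Q: "\<And>cs' n. n \<le> length rs * (4000000 * Suc hb * Suc (length cs) + 1000) + 100 \<Longrightarrow>
      columns_ok (expand X rs) [] cs' \<Longrightarrow> col_trees J cs' \<Longrightarrow> col_runs cs' = col_runs cs \<Longrightarrow> Q (enc_cols cs') n"
  shows "wpc cROWS [VI bg, enc_runs rs, VI c, enc_cols cs] Q"
  using assms
proof (induction rs arbitrary: X K c cs Q)
  case Nil
  have Qa: "Q (enc_cols cs) n" if "n \<le> 100" for n
    by (rule Nil.prems(12)) (use that Nil.prems(1-11) in \<open>auto intro: col_trees_mono\<close>)
  show ?case by (rule wpcI) (use W2 in \<open>auto simp: bROWS_def intro!: wp_intros Qa\<close>)
next
  case (Cons r rs)
  obtain a h where r: "r = (a, h)" by (cases r)
  note P = Cons.prems[unfolded r]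
  have E0: "0 \<le> E" using P(4,5) by linarith
  define K' where "K' = K + 3 * E * int (length cs)"
  have nn: "0 \<le> 3 * E * int (length cs)" "0 \<le> 3 * E * int (length cs) * int (length rs)" using E0 by simp_all
  have "3 * E * int (length cs) * int (length ((a, h) # rs)) = 3 * E * int (length cs) + 3 * E * int (length cs) * int (length rs)"
    by (simp add: algebra_simps)
  then have K': "K' + 3 * E * int (length cs) * int (length rs) \<le> J" "K' \<le> J" "K \<le> K'" "2 * E \<le> K'"
    using P(6,8) nn unfolding K'_def by linarith+
  have K2: "2 * K' \<le> W" "K \<le> W" using K' P(7,8) E0 by linarith+
  have cE: "\<bar>c\<bar> + \<bar>c\<bar> \<le> K" "\<bar>c\<bar> \<le> W" "\<bar>c - int h\<bar> \<le> W"
    using P(3,4,5,8) K2 by (auto simp: length_expand)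
  define A where "A = 4000000 * Suc hb * Suc (length cs)"
  have row: "wpc cROWF [VI bg, VI a, VI (int h), VI c, enc_tree l, enc_cols cs] Q'"
    if l: "good_tree K l" "leaves l = [corner (- c) c]"
    and Q': "\<And>cs' n. n \<le> A \<Longrightarrow> columns_ok (replicate h a @ X) [] cs' \<Longrightarrow> col_trees K' cs' \<Longrightarrow>
      col_runs cs' = col_runs cs \<Longrightarrow> col_leaves cs' \<le> 1 + col_leaves cs + length cs \<Longrightarrow> Q' (enc_cols cs') n" for l Q'
  proof (rule wpc_ROWF[OF P(1) l(1) P(2) _ _ _ P(5) _ K2(1) _ _ P(10,11)])
    show "c = int (length []) - int (length X)" using P(3) by simp
    show "represents (c - int h) c (c - int h) c (leaves l) (\<lambda>d. int (ed (replicate (nat (c - d)) a @ X) []))"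
      unfolding l(2) by (rule represents_corner) (use P(3) in \<open>auto\<close>)
    show "int (length X + length (expand [] (col_runs cs)) + h) < bg" using P(4) by (simp add: length_expand)
    show "length (leaves l) + col_leaves cs + length cs < N" using P(9) l(2) by simp
  qed (use Q' l(2) P(8) E0 in \<open>auto simp: K'_def A_def\<close>)
  have rec: "wpc cROWS [VI bg, enc_runs rs, VI (c - int h), enc_cols cs'] Q'"
    if cs': "columns_ok (replicate h a @ X) [] cs'" "col_trees K' cs'" "col_runs cs' = col_runs cs" "col_leaves cs' \<le> 1 + col_leaves cs + length cs"
    and Q': "\<And>cs'' n. n \<le> length rs * (A + 1000) + 100 \<Longrightarrow> columns_ok (expand X ((a, h) # rs)) [] cs'' \<Longrightarrow> col_trees J cs'' \<Longrightarrow>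
      col_runs cs'' = col_runs cs \<Longrightarrow> Q' (enc_cols cs'') n" for cs' Q'
  proof -
    have len: "length cs' = length cs" using cs'(3) by (metis length_col_runs)
    show ?thesis
    proof (rule Cons.IH[OF cs'(1,2) _ _ P(5) _ P(7) K'(4) _ P(10,11)])
      show "col_leaves cs' + length rs * Suc (length cs') < N" using P(9) cs'(4) by (simp add: len)
    qed (use P K' cs' Q' in \<open>auto simp: len A_def\<close>)
  qed
  have Qa: "Q (enc_cols cs'') n" if "n \<le> length rs * (A + 1000) + A + 1100"
    "columns_ok (expand X ((a, h) # rs)) [] cs''" "col_trees J cs''" "col_runs cs'' = col_runs cs" for cs'' n
    by (rule P(12)) (use that in \<open>auto simp: A_def\<close>)
  define B where "B = length rs * (A + 1000)"
  note rec = rec[folded B_def] note Qa = Qa[folded B_def]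
  show ?case unfolding r enc_runs.simps
    by (rule wpcI) (use W2 cE in \<open>auto simp: bROWS_def intro!: wp_intros wpc_CRNt[of "- c" c K] K2 rec row Qa\<close>)
qed

text \<open>On the top edge the value equals the diagonal, so each column starts with a single
  corner.\<close>

lemma wpc_INITC:
  assumes "j = int (length Y)" "2 * int (length (expand Y ss)) \<le> K" "K \<le> W"
    and Q: "\<And>cs n. n \<le> 1000 * Suc (length ss) \<Longrightarrow> columns_ok [] Y cs \<Longrightarrow> col_trees K cs \<Longrightarrow> col_runs cs = ss \<Longrightarrow>
      col_leaves cs = length ss \<Longrightarrow> Q (enc_cols cs) n"
  shows "wpc cINITC [enc_runs ss, VI j] Q"
  using assms
proof (induction ss arbitrary: Y j Q)
  case Nil
  have Qa: "Q (VI 0) n" if "n \<le> 100" for n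
    by (rule Nil.prems(4)[of n "[]", unfolded enc_cols.simps]) (use that in auto)
  show ?case by (rule wpcI) (use W2 in \<open>auto simp: bINITC_def intro!: wp_intros Qa\<close>)
next
  case (Cons s ss)
  obtain b w where s: "s = (b, w)" by (cases s)
  note P = Cons.prems[unfolded s]
  have jK: "\<bar>j\<bar> + \<bar>j\<bar> \<le> K" "\<bar>j + int w\<bar> \<le> W" using P(1-3) by (auto simp: length_expand)
  have rec: "wpc cINITC [enc_runs ss, VI (j + int w)] Q'"
    if "\<And>cs n. n \<le> 1000 * Suc (length ss) \<Longrightarrow> columns_ok [] (replicate w b @ Y) cs \<Longrightarrow> col_trees K cs \<Longrightarrow> col_runs cs = ss \<Longrightarrow>
      col_leaves cs = length ss \<Longrightarrow> Q' (enc_cols cs) n" for Q'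
    by (rule Cons.IH[where Y = "replicate w b @ Y"]) (use P that in auto)
  have Qa: "Q (VP (VP (VI b) (VP (VI (int w)) (enc_tree t))) (enc_cols cs)) n"
    if "n \<le> 1000 * Suc (length ss) + 1000" "good_tree K t" "leaves t = [corner j j]" "columns_ok [] (replicate w b @ Y) cs" "col_trees K cs" "col_runs cs = ss"
      "col_leaves cs = length ss" for t cs n
  proof (rule P(4)[of n "(b, w, t) # cs", unfolded enc_cols.simps])
    have "represents j (j + int w) j (j + int w) [corner j j] (\<lambda>d. int (ed [] (replicate (nat (d - j)) b @ Y)))"
      by (rule represents_corner) (use P(1) in \<open>auto\<close>)
    then show "columns_ok [] Y ((b, w, t) # cs)" using that P(1) by simp
  qed (use that in auto)
  show ?case unfolding s enc_runs.simps
    by (rule wpcI) (use W2 jK(2) in \<open>auto simp: bINITC_def intro!: wp_intros wpc_CRNt[OF jK(1) P(3)] rec Qa\<close>)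
qed

text \<open>At the right end of the last column all plateaus lie at or before the diagonal in
  question. Every cone therefore has the value \<open>bb\<close> plus that diagonal, and the stored
  minimum of \<open>bb\<close> gives the answer; the columns before it only contribute their widths
  to the diagonal.\<close>

lemma wpc_FIN:
  assumes "columns_ok X Y cs" "col_trees K cs" "cs \<noteq> []" "c = int (length Y) - int (length X)"
    "K + int (length X + length (expand Y (col_runs cs))) \<le> W" "0 \<le> K"
    and Q: "\<And>n. n \<le> 3000 * Suc (length cs) \<Longrightarrow> Q (VI (int (ed X (expand Y (col_runs cs))))) n"
  shows "wpc cFIN [enc_cols cs, VI c] Q"
  using assms
proof (induction cs arbitrary: Y c Q)
  case (Cons col cs)
  obtain b w t where col: "col = (b, w, t)" by (cases col)
  note P = Cons.prems[unfolded col]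
  have cw: "\<bar>c + int w\<bar> \<le> W" "\<bar>c + int w\<bar> + K \<le> W" using P(4-6) by (auto simp: length_expand)
  show ?case
  proof (cases "cs = []")
    case True
    have t: "good_tree K t" using P(2) by simp
    then have t': "tree_bound K t" "K \<le> W" using cw(2) by (auto simp: good_tree_def)
    define F where "F d = int (ed X (replicate (nat (d - c)) b @ Y))" for d
    have R: "represents c (c + int w) c (c + int w) (leaves t) F"
      unfolding F_def using P(1,4) by (simp add: Let_def)
    have cone: "cone x (c + int w) = snd (get x 2) + (c + int w)" if "x \<in> set (leaves t)" for x
    proof -
      have "lft x \<le> c + int w" "rgt x \<le> c + int w" using R that unfolding represents_def by force+
      then show ?thesis by (simp add: cone_def lft_def rgt_def bb_def get_def)
    qed
    have "Min ((\<lambda>x. snd (get x 2)) ` set (leaves t)) = F (c + int w) - (c + int w)"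
    proof (rule Min_eqI)
      have R': "(\<forall>x \<in> set (leaves t). F (c + int w) \<le> cone x (c + int w)) \<and> (\<exists>x \<in> set (leaves t). cone x (c + int w) = F (c + int w))"
        using R unfolding represents_def by simp
      then show "F (c + int w) - (c + int w) \<in> (\<lambda>x. snd (get x 2)) ` set (leaves t)"
        using cone by (force simp: image_iff)
      show "F (c + int w) - (c + int w) \<le> y" if "y \<in> (\<lambda>x. snd (get x 2)) ` set (leaves t)" for y
        using that R' cone by force
    qed simp
    then have F: "snd (tb (tree_min t)) + (c + int w) = F (c + int w)"
      using tree_min_Min[of t 2] t by (simp add: good_tree_def get_def)
    have "\<bar>snd (tb (tree_min t))\<bar> \<le> K" using t tree_bound_tree_min by (auto simp: good_tree_def trip_bound_def)
    then have FW: "\<bar>F (c + int w)\<bar> \<le> W" using F cw by linarith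
    have Qa: "Q (VI (F (c + int w))) n" if "n \<le> 3000" for n
      using P(7)[of n] that True by (simp add: F_def)
    show ?thesis unfolding col enc_cols.simps
      by (rule wpcI) (use W2 True cw t' in \<open>auto simp: bFIN_def F FW intro!: wp_intros wpc_AG[of K] Qa\<close>)
  next
    case False
    have rec: "wpc cFIN [enc_cols cs, VI (c + int w)] Q'"
      if "\<And>n. n \<le> 3000 * Suc (length cs) \<Longrightarrow> Q' (VI (int (ed X (expand (replicate w b @ Y) (col_runs cs))))) n" for Q'
      by (rule Cons.IH[where Y = "replicate w b @ Y"]) (use P that False in auto)
    have Qa: "Q (VI (int (ed X (expand (replicate w b @ Y) (col_runs cs))))) n" if "n \<le> 3000 * Suc (length cs) + 3000" for n
      using P(7)[of n] that by simp
    show ?thesis unfolding col enc_cols.simps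
      by (rule wpcI) (use W2 False in \<open>auto simp: bFIN_def cw intro!: wp_intros rec Qa\<close>)
  qed
qed simp

lemma wpc_RD:
  assumes "inp = us @ encode_runs rs @ vs" "i = int (length us)" "i + 2 * int (length rs) \<le> W"
    and Q: "\<And>n. n \<le> 1000 * Suc (length rs) \<Longrightarrow> Q (enc_runs (rev rs @ acc)) n"
  shows "wpc cRD [VI i, VI (int (length rs)), enc_runs acc] Q"
  using assms
proof (induction rs arbitrary: us i acc Q)
  case Nil
  show ?case by (rule wpcI) (use W2 in \<open>auto simp: bRD_def intro!: wp_intros Nil.prems(4)[simplified]\<close>)
next
  case (Cons r rs)
  obtain a h where r: "r = (a, h)" by (cases r)
  note P = Cons.prems[unfolded r]
  have i: "0 \<le> i" "i + 2 \<le> W" "int (length rs) \<le> W" "nat i < length inp" "nat (i + 1) < length inp" "inp ! nat i = a" "inp ! nat (i + 1) = int h"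
    using P(1-3) by (auto simp: encode_runs_def nat_add_distrib nth_append)
  have rec: "wpc cRD [VI (i + 2), VI (int (length rs)), VP (VP (VI a) (VI (int h))) (enc_runs acc)] Q'"
    if "\<And>n. n \<le> 1000 * Suc (length rs) \<Longrightarrow> Q' (enc_runs (rev ((a, h) # rs) @ acc)) n" for Q'
    by (rule Cons.IH[where us = "us @ [a, int h]" and acc = "(a, h) # acc", unfolded enc_runs.simps]) (use P that in \<open>auto simp: encode_runs_def\<close>)
  have Qa: "Q (enc_runs (rev ((a, h) # rs) @ acc)) n" if "n \<le> 1000 * Suc (length rs) + 1000" for n
    using P(4)[of n] that by simp
  show ?case unfolding r
    by (rule wpcI) (use W2 i(1-5) in \<open>auto simp: bRD_def i(6,7) simp del: rev.simps intro!: wp_intros rec Qa\<close>)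
qed

lemma wpc_LEN:
  assumes "0 \<le> x" "x + int (sum_list (map snd rs)) \<le> W"
    and Q: "\<And>n. n \<le> 1000 * Suc (length rs) \<Longrightarrow> Q (VI (x + int (sum_list (map snd rs)))) n"
  shows "wpc cLEN [enc_runs rs, VI x] Q"
  using assms
proof (induction rs arbitrary: x Q)
  case Nil
  show ?case by (rule wpcI) (use W2 in \<open>auto simp: bLEN_def intro!: wp_intros Nil.prems(3)[simplified]\<close>)
next
  case (Cons r rs)
  obtain a h where r: "r = (a, h)" by (cases r)
  note P = Cons.prems[unfolded r]
  have rec: "wpc cLEN [enc_runs rs, VI (x + int h)] Q'"
    if "\<And>n. n \<le> 1000 * Suc (length rs) \<Longrightarrow> Q' (VI (x + int h + int (sum_list (map snd rs)))) n" for Q'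
    by (rule Cons.IH) (use P that in auto)
  have Qa: "Q (VI (x + int h + int (sum_list (map snd rs)))) n" if "n \<le> 1000 * Suc (length rs) + 1000" for n
    using P(3)[of n] that by (simp add: add.assoc)
  show ?case unfolding r
    by (rule wpcI) (use W2 P(1,2) in \<open>auto simp: bLEN_def intro!: wp_intros rec Qa\<close>)
qed

text \<open>\<open>E\<close> exceeds every distance in the table and is also the sentinel that the
  program computes. The initial cones are bounded by \<open>2 * E\<close>, and \<open>J\<close> adds
  \<open>3 * E\<close> for each block. \<open>N\<close> bounds the number of cones over the whole
  run.\<close>

lemma wp_MAIN:
  assumes inp: "inp = encode_runs r @ encode_runs s" "s \<noteq> []"
    and XY: "X = expand [] (rev r)" "Y = expand [] (rev s)"
    and EJ: "E = int (length X + length Y) + 1" "J = 2 * E + 3 * E * int (length s) * int (length r)" "2 * J \<le> W"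
      "2 * int (length r + length s) \<le> W"
    and N: "length s + length r * Suc (length s) < N" "N \<le> 2 ^ Suc hb" "int hb + 1 \<le> W"
    and Q: "\<And>n. n \<le> length r * (4000000 * Suc hb * Suc (length s) + 1000) + 10000 * (length r + length s) + 10000 \<Longrightarrow>
      Q (VI (int (ed X Y))) n"
  shows "wp [VI (int (length r)), VI (int (length s))] bMAIN Q"
proof -
  have lX: "int (sum_list (map snd (rev r))) = int (length X)" "int (sum_list (map snd (rev s))) = int (length Y)"
    using XY by (simp_all add: length_expand)
  have "0 \<le> 3 * E * int (length s) * int (length r)" using EJ(1) by simp
  then have J: "2 * E \<le> J" "J + E \<le> W" "2 * E \<le> W" using EJ by linarith+
  have lW: "int (length X) \<le> W" "int (length Y) \<le> W" "int (length X) + int (length Y) + 1 \<le> W" using J EJ(1) by linarith+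
  have nW: "int (length r) + int (length r) \<le> W" "2 * int (length r) \<le> W" "2 * int (length r) + 2 * int (length s) \<le> W" using EJ(4) by auto
  have rd1: "wpc cRD [VI 0, VI (int (length r)), VI 0] Q'" if "\<And>n. n \<le> 1000 * Suc (length r) \<Longrightarrow> Q' (enc_runs (rev r)) n" for Q'
    by (rule wpc_RD[of "[]" r _ 0 Q' "[]", unfolded enc_runs.simps]) (use inp nW that in auto)
  have "length (encode_runs xs) = 2 * length xs" for xs by (induction xs) (auto simp: encode_runs_def)
  then have rd2: "wpc cRD [VI (2 * int (length r)), VI (int (length s)), VI 0] Q'"
    if "\<And>n. n \<le> 1000 * Suc (length s) \<Longrightarrow> Q' (enc_runs (rev s)) n" for Q'
    by (intro wpc_RD[of "encode_runs r" s "[]" _ Q' "[]", unfolded enc_runs.simps]) (use inp nW that in auto)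
  have len1: "wpc cLEN [enc_runs (rev r), VI 0] Q'" if "\<And>n. n \<le> 1000 * Suc (length r) \<Longrightarrow> Q' (VI (int (length X))) n" for Q'
    by (rule wpc_LEN) (use lX lW that in auto)
  have len2: "wpc cLEN [enc_runs (rev s), VI 0] Q'" if "\<And>n. n \<le> 1000 * Suc (length s) \<Longrightarrow> Q' (VI (int (length Y))) n" for Q'
    by (rule wpc_LEN) (use lX lW that in auto)
  have init: "wpc cINITC [enc_runs (rev s), VI 0] Q'"
    if "\<And>cs n. n \<le> 1000 * Suc (length s) \<Longrightarrow> columns_ok [] [] cs \<Longrightarrow> col_trees (2 * E) cs \<Longrightarrow> col_runs cs = rev s \<Longrightarrow>
      col_leaves cs = length s \<Longrightarrow> Q' (enc_cols cs) n" for Q'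
    by (rule wpc_INITC[where Y = "[]" and K = "2 * E"]) (use J EJ(1) XY that in auto)
  define B where "B = length r * (4000000 * Suc hb * Suc (length s) + 1000)"
  have rows: "wpc cROWS [VI (int (length X) + int (length Y) + 1), enc_runs (rev r), VI 0, enc_cols cs] Q'"
    if cs: "columns_ok [] [] cs" "col_trees (2 * E) cs" "col_runs cs = rev s" "col_leaves cs = length s"
    and Q': "\<And>cs' n. n \<le> B + 100 \<Longrightarrow> columns_ok X [] cs' \<Longrightarrow> col_trees J cs' \<Longrightarrow> col_runs cs' = rev s \<Longrightarrow> Q' (enc_cols cs') n" for cs Q'
  proof -
    have len: "length cs = length s" using cs(3) by (metis length_col_runs length_rev)
    show ?thesis
      by (rule wpc_ROWS[OF cs(1,2) _ _ _ _ EJ(3) order_refl _ N(2,3)])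
        (use cs EJ XY N Q' in \<open>auto simp: len B_def\<close>)
  qed
  have fin: "wpc cFIN [enc_cols cs', VI (- int (length X))] Q'"
    if cs': "columns_ok X [] cs'" "col_trees J cs'" "col_runs cs' = rev s"
    and Q': "\<And>n. n \<le> 3000 * Suc (length s) \<Longrightarrow> Q' (VI (int (ed X Y))) n" for cs' Q'
  proof -
    have len: "length cs' = length s" using cs'(3) by (metis length_col_runs length_rev)
    show ?thesis
      by (rule wpc_FIN[OF cs'(1,2)]) (use cs' inp(2) len EJ J XY Q' in auto)
  qed
  have Qa: "Q (VI (int (ed X Y))) n" if "n \<le> B + 10000 * (length r + length s) + 10000" for n
    by (rule Q) (use that in \<open>simp add: B_def\<close>)
  show ?thesis
    by (use W2 lW nW in \<open>auto simp: bMAIN_def intro!: wp_intros rd1 rd2 len1 len2 init rows fin Qa\<close>)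
qed

end

section \<open>Choice of the word size and the final estimate\<close>

lemma length_rle: "length (rle X) \<le> length X"
  by (induction X) (auto split: list.splits)

lemma expand_rev_rle: "expand [] (rev (rle X)) = X"
  by (simp add: expand_rev concat_rle)

lemma set_rle: "(a, i) \<in> set (rle X) \<Longrightarrow> a \<in> set X \<and> i \<le> length X"
  by (induction X arbitrary: a i) (auto split: list.splits if_splits dest: le_SucI)

theorem theorem1p1:
  shows "\<exists>(P :: program) (k :: nat) (C :: real).
    \<forall>(X :: word list) (Y :: word list) (n :: nat) (m :: nat) (W :: word).
      X \<noteq> [] \<longrightarrow> Y \<noteq> [] \<longrightarrow> n = length (rle X) \<longrightarrow> m = length (rle Y) \<longrightarrow> word_fits k X Y W \<longrightarrow>
      (\<exists>t. halts_with W P (initial_config (rle X) (rle Y)) t (int (edit_distance X Y)) \<and>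
           real t \<le> C * (real (m * n) * log1 (real (m * n))))"
proof -
  define P where "P = compile program_funs bMAIN"
  define C where "C = 2 * length P + 40"
  \<comment> \<open>The heap may take \<open>C * t\<close> cells, where \<open>t\<close> is at most
    45000000 times the fourth power of the total length; 200 covers the other, smaller demands on
    \<open>W\<close>.\<close>
  define D where "D = C * 45000000 + 200"
  have "\<exists>t. halts_with W P (initial_config (rle X) (rle Y)) t (int (edit_distance X Y)) \<and>
      real t \<le> real (40000000 * C) * (real (m * n) * log1 (real (m * n)))"
    if ne: "X \<noteq> []" "Y \<noteq> []" and n: "n = length (rle X)" and m: "m = length (rle Y)" and fits: "word_fits (4 + D) X Y W"
    for X Y :: "word list" and n m :: nat and W :: word
  proof -
    define N0 where "N0 = length X + length Y"
    have "length X \<ge> 1" "length Y \<ge> 1" using ne by (simp_all add: Suc_leI)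
    then have N2: "2 \<le> N0" by (simp add: N0_def)
    have "rle X \<noteq> []" "rle Y \<noteq> []" using ne by (simp_all add: rle_eq_Nil_iff)
    then have nm1: "1 \<le> n" "1 \<le> m" unfolding n m by (simp_all add: Suc_leI)
    have nmN: "n + m \<le> N0" "n \<le> N0" "m \<le> N0" using length_rle[of X] length_rle[of Y] by (simp_all add: n m N0_def)
    have pow: "N0 \<le> N0 ^ 4" "N0 ^ 2 \<le> N0 ^ 4" "N0 ^ 3 \<le> N0 ^ 4" "1 \<le> N0 ^ 4"
      using N2 by (auto intro: power_increasing self_le_power)
    \<comment> \<open>\<open>N0 \<ge> 2\<close>, so that \<open>N0 ^ D\<close> absorbs the constant \<open>D\<close>\<close>
    have "D < 2 ^ D" by (rule less_exp)
    also have "\<dots> \<le> N0 ^ D" using N2 by (rule power_mono) simp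
    finally have "N0 ^ 4 * D \<le> N0 ^ 4 * N0 ^ D" by simp
    then have "int (N0 ^ 4 * D) \<le> int (N0 ^ (4 + D))" by (simp add: power_add del: of_nat_mult of_nat_power)
    also have "\<dots> \<le> W" using fits by (simp add: word_fits_def N0_def)
    finally have big: "int (D * N0 ^ 4) \<le> W" by (simp add: mult.commute)
    have le: "int x \<le> W" if "x \<le> D * N0 ^ 4" for x using that big by (meson of_nat_mono order_trans)
    have D1: "D \<le> D * N0 ^ 4" using pow(4) by simp
    define M where "M = n * m"
    have M1: "1 \<le> M" "n \<le> M" "m \<le> M" using nm1 by (simp_all add: M_def)
    have nSm: "n * Suc m = M + n" by (simp add: M_def)
    \<comment> \<open>The count of cones is at most \<open>m + n * (m + 1)\<close>, that is
      \<open>M + n + m\<close>, which is below \<open>4 * M\<close>; \<open>hb\<close> is the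
      integer part of the binary logarithm of \<open>4 * M\<close>.\<close>
    obtain hb where hb: "2 ^ hb \<le> 4 * M" "4 * M < 2 ^ Suc hb" using ex_power_ivl1[of 2 "4 * M"] M1 by auto
    have wpc_MN: "M \<le> N0 ^ 2" using mult_le_mono[OF nmN(2,3)] by (simp add: M_def power2_eq_square)
    have "hb < 4 * M" using less_exp[of hb] hb(1) by linarith
    then have Hb: "Suc hb \<le> 5 * N0 ^ 2" using wpc_MN M1 by linarith
    \<comment> \<open>As \<open>n * Suc m\<close> is at most \<open>2 * M\<close>, the main term of
      the cost has the factor 8000000; the additional million absorbs the terms linear in
      \<open>n\<close> and \<open>m\<close>.\<close>
    define tb where "tb = 9000000 * Suc hb * M"
    have tbN: "tb \<le> 45000000 * N0 ^ 4"
    proof -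
      have "Suc hb * M \<le> 5 * N0 ^ 2 * N0 ^ 2" by (rule mult_le_mono[OF Hb wpc_MN])
      then have "9000000 * (Suc hb * M) \<le> 9000000 * (5 * N0 ^ 2 * N0 ^ 2)" by (rule mult_le_mono2)
      also have "\<dots> = 45000000 * N0 ^ 4" by (simp add: power4_eq_xxxx power2_eq_square)
      finally show ?thesis unfolding tb_def mult.assoc .
    qed
    define inp where "inp = encode_runs (rle X) @ encode_runs (rle Y)"
    define E where "E = int (length X + length Y) + 1"
    define J where "J = 2 * E + 3 * E * int m * int n"
    have J: "2 * J \<le> W"
    proof -
      have "N0 + 1 \<le> 2 * N0" using N2 by simp
      then have "2 * (2 * (N0 + 1) + 3 * (N0 + 1) * M) \<le> 2 * (2 * (2 * N0) + 3 * (2 * N0) * N0 ^ 2)"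
        using wpc_MN by (intro mult_le_mono add_mono) auto
      also have "\<dots> = 8 * N0 + 12 * N0 ^ 3" by (simp add: power2_eq_square power3_eq_cube)
      also have "\<dots> \<le> 20 * N0 ^ 4" using pow by linarith
      also have "\<dots> \<le> D * N0 ^ 4" by (intro mult_le_mono) (auto simp: D_def)
      finally have "int (2 * (2 * (N0 + 1) + 3 * (N0 + 1) * M)) \<le> W" by (rule le)
      then show ?thesis by (simp add: J_def E_def N0_def M_def algebra_simps)
    qed
    interpret prog inp W
    proof
      have "100 \<le> D * N0 ^ 4" by (rule order_trans[OF _ D1]) (simp add: D_def)
      from le[OF this] show "100 \<le> W" by simp
    qed
    have "wp [VI (int n), VI (int m)] bMAIN (\<lambda>v t. v = VI (int (ed X Y)) \<and> t \<le> tb + 10000)"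
      unfolding n m
    proof (rule wp_MAIN[where E = E and J = J and N = "4 * M" and hb = hb])
      show "X = expand [] (rev (rle X))" "Y = expand [] (rev (rle Y))" by (simp_all add: expand_rev_rle)
      show "2 * int (length (rle X) + length (rle Y)) \<le> W"
      proof -
        have "2 * (n + m) \<le> 2 * N0 ^ 4" by (rule mult_le_mono2) (use nmN(1) pow(1) in linarith)
        also have "\<dots> \<le> D * N0 ^ 4" by (intro mult_le_mono) (auto simp: D_def)
        finally have "int (2 * (n + m)) \<le> W" by (rule le)
        then show ?thesis by (simp add: n m)
      qed
      show "length (rle Y) + length (rle X) * Suc (length (rle Y)) < 4 * M"
        using M1 nSm unfolding n[symmetric] m[symmetric] by linarith
      show "int hb + 1 \<le> W"
      proof -
        have "hb + 1 \<le> 5 * N0 ^ 4" using Hb pow by linarith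
        also have "\<dots> \<le> D * N0 ^ 4" by (intro mult_le_mono) (auto simp: D_def)
        finally have "int (hb + 1) \<le> W" by (rule le)
        then show ?thesis by simp
      qed
      show "VI (int (ed X Y)) = VI (int (ed X Y)) \<and> t \<le> tb + 10000"
        if t: "t \<le> length (rle X) * (4000000 * Suc hb * Suc (length (rle Y)) + 1000) + 10000 * (length (rle X) + length (rle Y)) + 10000" for t
      proof -
        have "n * Suc m \<le> 2 * M" using M1 nSm by linarith
        define p q where pq: "p = Suc hb * (n * Suc m)" "q = Suc hb * M"
        have "p \<le> Suc hb * (2 * M)" unfolding pq by (rule mult_le_mono2) fact
        then have 1: "p \<le> 2 * q" by (simp add: pq)
        have 2: "M \<le> q" by (simp add: pq)
        have "t \<le> 4000000 * p + 1000 * n + 10000 * (n + m) + 10000"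
          using t unfolding n[symmetric] m[symmetric] pq by (simp add: algebra_simps)
        also have "\<dots> \<le> 8000000 * q + 21000 * M + 10000" using 1 M1 by auto
        also have "\<dots> \<le> 9000000 * q + 10000" using 2 by auto
        also have "\<dots> = tb + 10000" by (simp add: tb_def pq algebra_simps)
        finally show ?thesis by simp
      qed
    qed (use ne hb J in \<open>auto simp: inp_def rle_eq_Nil_iff E_def J_def n m\<close>)
    then obtain t where t: "ev program_funs inp W [VI (int n), VI (int m)] bMAIN (VI (int (ed X Y))) t" "2 * t \<le> tb + 10000"
      unfolding wp_def by auto
    have tb1: "9000000 \<le> tb" 
      using mult_le_mono2[of 1 "Suc hb * M" 9000000] M1 unfolding tb_def mult.assoc by simp
    have "\<exists>T. halts_with W (compile program_funs bMAIN) (initial_config (rle X) (rle Y)) T (int (ed X Y)) \<and> T \<le> (2 * length (compile program_funs bMAIN) + 40) * (t + 1)"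
    proof (rule compile_correct[OF t(1)[unfolded inp_def n m]])
      show "\<bar>x\<bar> \<le> W" if "x \<in> set (encode_runs (rle X) @ encode_runs (rle Y))" for x
      proof -
        have "(\<exists>a \<in> set X \<union> set Y. x = a) \<or> (\<exists>i \<le> N0. x = int i)"
          using that by (auto simp: encode_runs_def N0_def dest!: set_rle intro: le_add1 trans_le_add1 trans_le_add2)
        moreover have "int i \<le> W" if "i \<le> N0" for i
        proof -
          have "i \<le> N0 ^ 4" using that pow by linarith
          also have "\<dots> \<le> D * N0 ^ 4" by (simp add: D_def)
          finally show ?thesis by (rule le)
        qed
        ultimately show ?thesis using fits by (auto simp: word_fits_def)
      qed
      show "2 * int (length (rle X) + length (rle Y)) + 4 + int ((2 * length (compile program_funs bMAIN) + 40) * t) \<le> W"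
      proof -
        have "C * t \<le> C * (45000000 * N0 ^ 4)" using t(2) tb1 tbN by (intro mult_le_mono) linarith+
        then have "2 * (n + m) + 4 + C * t \<le> 2 * N0 ^ 4 + 4 * N0 ^ 4 + C * (45000000 * N0 ^ 4)"
          using order_trans[OF nmN(1) pow(1)] pow(4) by (intro add_mono) auto
        also have "\<dots> \<le> D * N0 ^ 4" by (simp add: D_def algebra_simps)
        finally have "int (2 * (n + m) + 4 + C * t) \<le> W" by (rule le)
        then show ?thesis by (simp add: n m C_def P_def)
      qed
      show "int (length (compile program_funs bMAIN)) \<le> W"
      proof (rule le)
        show "length (compile program_funs bMAIN) \<le> D * N0 ^ 4" by (rule order_trans[OF _ D1]) (simp add: D_def C_def P_def)
      qed
    qed (use ne in \<open>auto simp: rle_eq_Nil_iff\<close>)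
    then obtain T where T: "halts_with W P (initial_config (rle X) (rle Y)) T (int (ed X Y))" "T \<le> C * (t + 1)"
      by (auto simp: P_def C_def)
    \<comment> \<open>\<open>tb\<close> is at least 9000000, so half of \<open>tb + 10000\<close>,
      increased by 1, is still below \<open>tb\<close>.\<close>
    have "C * (t + 1) \<le> C * tb" using t(2) tb1 by (intro mult_le_mono) linarith+
    then have "real T \<le> real (C * tb)" using T(2) by linarith
    also have "\<dots> = real C * 9000000 * real M * real (Suc hb)" by (simp add: tb_def)
    \<comment> \<open>\<open>hb\<close> is at most \<open>2 + log 2 M\<close>, so
      \<open>Suc hb\<close> is at most \<open>3 + log 2 M\<close>. Here the truncation in
      \<open>log1\<close> matters: it turns the constant 3 into \<open>3 * log1 M\<close>, also for
      \<open>M = 1\<close>.\<close>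
    also have "\<dots> \<le> real C * 9000000 * real M * (4 * log1 (real M))"
    proof (rule mult_left_mono)
      have "real hb = log 2 (2 ^ hb)" by simp
      also have "\<dots> \<le> log 2 (4 * real M)" 
      proof (subst log_le_cancel_iff)
        have "real (2 ^ hb) \<le> real (4 * M)" using hb(1) by (rule of_nat_mono)
        then show "2 ^ hb \<le> 4 * real M" by simp
      qed (use M1 in auto)
      also have "\<dots> = log 2 4 + log 2 (real M)" by (subst log_mult) (use M1 in auto)
      also have "log 2 4 = (2::real)" using log_pow_cancel[of "2::real" 2] by simp
      finally have "real hb \<le> 2 + log 2 (real M)" .
      then show "real (Suc hb) \<le> 4 * log1 (real M)" by (auto simp: log1_def)
    qed simp
    also have "\<dots> \<le> real (40000000 * C) * (real M * log1 (real M))"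
    proof -
      have "0 \<le> real C * (real M * log1 (real M))" by (simp add: log1_def)
      then show ?thesis by (simp add: algebra_simps)
    qed
    finally have "real T \<le> real (40000000 * C) * (real (m * n) * log1 (real (m * n)))" by (simp add: M_def mult.commute)
    then show ?thesis using T(1) by (auto simp: edit_distance_eq_ed)
  qed
  then show ?thesis by blast
qed

end
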